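(* Suppose that $c_i(0)\ge0$, $c_i(0)\in H^2(\mathbb{R}^3)\cap L^1(\mathbb{R}^3)$ and $\int_{\mathbb{R}^3}|x|^6c_i(0)^2\,dx<\infty$ for any $i\in\{1,\dots,N\}$, and that $\int_{\mathbb{R}^3}\rho_0\,dx=0$. Let $(c_1,\dots,c_N)$ be the corresponding solution of the Nernst--Planck--Darcy system on $\mathbb{R}^3$, and let $\mathcal{E}(t)=\sum_{i=1}^N\int_{\mathbb{R}^3}c_i(x,t)\log c_i(x,t)\,dx$. Then there exist a time $T_\Gamma$ depending on the $L^1$ and $H^2$ norms of the initial concentrations, and positive constants $\Gamma_4,\Gamma_5,\Gamma_6$ depending on $\|c_i(0)\|_{L^1}$, $\|c_i(0)\|_{H^2}$ and $\||x|^3c_i(0)\|_{L^2}$, such that $$-\mathcal{E}(t)\le\Gamma_4\log\bigl(\Gamma_5+\Gamma_6\,t^{\frac{15}{16}}\bigr)$$ for any $t\ge T_\Gamma$.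
   Context: Fix an integer $N\ge1$, a common diffusivity $D>0$, and real valences $z_1,\dots,z_N$ with equal absolute values $|z_1|=\dots=|z_N|=z$ (the parameters of the problem, regarded as fixed). The Nernst--Planck--Darcy (NPD) system on $\mathbb{R}^3$, with decay at infinity, is the system for the ionic concentrations $c_i(x,t)$, the velocity $u$, the pressure $p$ and the potential $\phi$: $$\partial_t c_i+u\cdot\nabla c_i-D\Delta c_i-z_iD\,\nabla\cdot(c_i\nabla\phi)=0\quad(i=1,\dots,N),$$ $$u+\nabla p=-\rho\nabla\phi,\qquad \nabla\cdot u=0,\qquad -\Delta\phi=\rho,\qquad \rho:=\sum_{i=1}^N z_ic_i,$$ with initial data $c_i(\cdot,0)=c_i(0)$ and $\rho_0:=\sum_i z_ic_i(0)$. Decay at infinity means in particular $\phi=(-\Delta)^{-1}\rho$ and $u=-\mathbb{P}(\rho\nabla\phi)$, where $\mathbb{P}$ is the Leray projector onto divergence-free fields. For nonnegative initial data in $H^1\cap L^1$ with $\int\rho_0=0$, the system has a unique smooth solution, nonnegativity of the $c_i$ is preserved, and the solution is global in time; "the solution" refers to this one. The convention $0\log0=0$ is used. *)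

theory Defs
  imports "HOL-Analysis.Analysis"
begin

type_synonym space = "real ^ 3"

section \<open>Classical derivatives\<close>

definition partial :: "3 \<Rightarrow> (space \<Rightarrow> real) \<Rightarrow> space \<Rightarrow> real" where
  "partial j f x = frechet_derivative f (at x) (axis j 1)"

definition iter_partial :: "3 list \<Rightarrow> (space \<Rightarrow> real) \<Rightarrow> space \<Rightarrow> real" where
  "iter_partial js f = foldr partial js f"

definition gradient :: "(space \<Rightarrow> real) \<Rightarrow> space \<Rightarrow> space" where
  "gradient f x = (\<chi> j. partial j f x)"

definition divergence :: "(space \<Rightarrow> space) \<Rightarrow> space \<Rightarrow> real" where
  "divergence F x = (\<Sum>j\<in>UNIV. partial j (\<lambda>y. F y $ j) x)"

definition laplacian :: "(space \<Rightarrow> real) \<Rightarrow> space \<Rightarrow> real" where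
  "laplacian f x = (\<Sum>j\<in>UNIV. partial j (partial j f) x)"

text \<open>The set \<open>S\<close> is meant to be open.\<close>

primrec Ck_on :: "nat \<Rightarrow> 'a set \<Rightarrow> ('a::euclidean_space \<Rightarrow> 'b::real_normed_vector) \<Rightarrow> bool" where
  "Ck_on 0 S f \<longleftrightarrow> continuous_on S f"
| "Ck_on (Suc k) S f \<longleftrightarrow>
     (\<forall>x\<in>S. f differentiable (at x)) \<and>
     (\<forall>b\<in>Basis. Ck_on k S (\<lambda>x. frechet_derivative f (at x) b))"

definition smooth_on :: "'a set \<Rightarrow> ('a::euclidean_space \<Rightarrow> 'b::real_normed_vector) \<Rightarrow> bool" where
  "smooth_on S f \<longleftrightarrow> (\<forall>k. Ck_on k S f)"

definition test_function :: "(space \<Rightarrow> real) \<Rightarrow> bool" where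
  "test_function \<psi> \<longleftrightarrow> smooth_on UNIV \<psi> \<and> compact (closure {x. \<psi> x \<noteq> 0})"


section \<open>Lebesgue and Sobolev spaces\<close>

definition l1_norm :: "(space \<Rightarrow> real) \<Rightarrow> real" where
  "l1_norm f = (LINT x|lborel. \<bar>f x\<bar>)"

definition square_integrable :: "(space \<Rightarrow> 'b::euclidean_space) \<Rightarrow> bool" where
  "square_integrable f \<longleftrightarrow>
     f \<in> borel_measurable lborel \<and> integrable lborel (\<lambda>x. (norm (f x))\<^sup>2)"

definition l2_norm :: "(space \<Rightarrow> 'b::euclidean_space) \<Rightarrow> real" where
  "l2_norm f = sqrt (LINT x|lborel. (norm (f x))\<^sup>2)"

definition has_weak_partial :: "3 list \<Rightarrow> (space \<Rightarrow> real) \<Rightarrow> (space \<Rightarrow> real) \<Rightarrow> bool" where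
  "has_weak_partial js f g \<longleftrightarrow>
     (\<forall>\<psi>. test_function \<psi> \<longrightarrow>
        (LINT x|lborel. f x * iter_partial js \<psi> x)
          = (- 1) ^ length js * (LINT x|lborel. g x * \<psi> x))"

definition weak_partial :: "3 list \<Rightarrow> (space \<Rightarrow> real) \<Rightarrow> space \<Rightarrow> real" where
  "weak_partial js f = (SOME g. square_integrable g \<and> has_weak_partial js f g)"

text \<open>
  \<open>sobolev k\<close> is the space \<open>H\<^sup>k\<close>. Derivatives are indexed by lists of directions, so that the
  squared norm is the sum over \<open>m \<le> k\<close> of the squared \<open>L\<^sup>2\<close> norm of the full tensor of
  \<open>m\<close>-th order derivatives. The choice made in \<^const>\<open>weak_partial\<close> is
  unique up to null sets, hence does not affect the norm.
\<close>

definition sobolev :: "nat \<Rightarrow> (space \<Rightarrow> real) \<Rightarrow> bool" where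
  "sobolev k f \<longleftrightarrow> square_integrable f \<and>
     (\<forall>js. length js \<le> k \<longrightarrow> (\<exists>g. square_integrable g \<and> has_weak_partial js f g))"

definition sobolev_norm :: "nat \<Rightarrow> (space \<Rightarrow> real) \<Rightarrow> real" where
  "sobolev_norm k f = sqrt (\<Sum>js | length js \<le> k. (l2_norm (weak_partial js f))\<^sup>2)"


section \<open>The Leray projector and the inverse Laplacian\<close>

definition solenoidal :: "(space \<Rightarrow> space) \<Rightarrow> bool" where
  "solenoidal v \<longleftrightarrow> square_integrable v \<and>
     (\<forall>\<psi>. test_function \<psi> \<longrightarrow> (LINT x|lborel. v x \<bullet> gradient \<psi> x) = 0)"

text \<open>
  \<open>leray_projection f g\<close> says that \<open>g\<close> is (a representative of) the orthogonal projection
  of \<open>f\<close> in \<open>L\<^sup>2\<close> onto the divergence-free fields.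
\<close>

definition leray_projection :: "(space \<Rightarrow> space) \<Rightarrow> (space \<Rightarrow> space) \<Rightarrow> bool" where
  "leray_projection f g \<longleftrightarrow> square_integrable f \<and> solenoidal g \<and>
     (\<forall>h. solenoidal h \<longrightarrow> (LINT x|lborel. (f x - g x) \<bullet> h x) = 0)"

text \<open>The operator \<open>(-\<Delta>)\<^sup>-\<^sup>1\<close>, as convolution with the Newtonian kernel in three dimensions.\<close>

definition inv_neg_laplacian :: "(space \<Rightarrow> real) \<Rightarrow> space \<Rightarrow> real" where
  "inv_neg_laplacian f x = (LINT y|lborel. f y / (4 * pi * norm (x - y)))"


section \<open>The Nernst--Planck--Darcy system\<close>

definition charge_density :: "('n::finite \<Rightarrow> real) \<Rightarrow> ('n \<Rightarrow> space \<Rightarrow> real) \<Rightarrow> space \<Rightarrow> real" where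
  "charge_density z c x = (\<Sum>i\<in>UNIV. z i * c i x)"

definition npd_equations ::
  "real \<Rightarrow> ('n::finite \<Rightarrow> real) \<Rightarrow> ('n \<Rightarrow> real \<Rightarrow> space \<Rightarrow> real) \<Rightarrow> (real \<Rightarrow> space \<Rightarrow> space) \<Rightarrow>
     (real \<Rightarrow> space \<Rightarrow> real) \<Rightarrow> (real \<Rightarrow> space \<Rightarrow> real) \<Rightarrow> bool" where
  "npd_equations D z c u p \<phi> \<longleftrightarrow>
     (\<forall>t>0. \<forall>x. let \<rho> = charge_density z (\<lambda>i. c i t) in
        (\<forall>i. deriv (\<lambda>s. c i s x) t + u t x \<bullet> gradient (c i t) x - D * laplacian (c i t) x
               - z i * D * divergence (\<lambda>y. c i t y *\<^sub>R gradient (\<phi> t) y) x = 0) \<and>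
        u t x + gradient (p t) x = - (\<rho> x *\<^sub>R gradient (\<phi> t) x) \<and>
        divergence (u t) x = 0 \<and>
        - laplacian (\<phi> t) x = \<rho> x)"

definition npd_decay ::
  "('n::finite \<Rightarrow> real) \<Rightarrow> ('n \<Rightarrow> real \<Rightarrow> space \<Rightarrow> real) \<Rightarrow> (real \<Rightarrow> space \<Rightarrow> space) \<Rightarrow>
     (real \<Rightarrow> space \<Rightarrow> real) \<Rightarrow> bool" where
  "npd_decay z c u \<phi> \<longleftrightarrow>
     (\<forall>t>0. let \<rho> = charge_density z (\<lambda>i. c i t) in
        \<phi> t = inv_neg_laplacian \<rho> \<and>
        leray_projection (\<lambda>x. \<rho> x *\<^sub>R gradient (\<phi> t) x) (\<lambda>x. - u t x))"

text \<open>
  A global smooth solution with initial data \<open>c0\<close>: smooth in space and time for positive times,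
  with concentrations in \<open>C([0,\<infinity>); L\<^sup>1 \<inter> H\<^sup>1)\<close>. The latter is the sense in which the initial
  data are attained, and the class in which the solution is unique.
\<close>

definition npd_solution ::
  "real \<Rightarrow> ('n::finite \<Rightarrow> real) \<Rightarrow> ('n \<Rightarrow> space \<Rightarrow> real) \<Rightarrow> ('n \<Rightarrow> real \<Rightarrow> space \<Rightarrow> real) \<Rightarrow>
     (real \<Rightarrow> space \<Rightarrow> space) \<Rightarrow> (real \<Rightarrow> space \<Rightarrow> real) \<Rightarrow> (real \<Rightarrow> space \<Rightarrow> real) \<Rightarrow> bool" where
  "npd_solution D z c0 c u p \<phi> \<longleftrightarrow>
     (\<forall>i. smooth_on ({0<..} \<times> UNIV) (\<lambda>(t, x). c i t x)) \<and>
     smooth_on ({0<..} \<times> UNIV) (\<lambda>(t, x). u t x) \<and>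
     smooth_on ({0<..} \<times> UNIV) (\<lambda>(t, x). p t x) \<and>
     smooth_on ({0<..} \<times> UNIV) (\<lambda>(t, x). \<phi> t x) \<and>
     npd_equations D z c u p \<phi> \<and>
     npd_decay z c u \<phi> \<and>
     (\<forall>i. \<forall>t\<ge>0. integrable lborel (c i t) \<and> sobolev 1 (c i t)) \<and>
     (\<forall>i. \<forall>s\<ge>0.
        ((\<lambda>t. l1_norm (\<lambda>x. c i t x - c i s x)) \<longlongrightarrow> 0) (at s within {0..}) \<and>
        ((\<lambda>t. sobolev_norm 1 (\<lambda>x. c i t x - c i s x)) \<longlongrightarrow> 0) (at s within {0..})) \<and>
     (\<forall>i. c i 0 = c0 i)"

text \<open>The convention \<open>0 log 0 = 0\<close> is respected, since \<open>0 * ln 0 = 0\<close>.\<close>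

definition entropy :: "('n::finite \<Rightarrow> space \<Rightarrow> real) \<Rightarrow> real" where
  "entropy c = (\<Sum>i\<in>UNIV. LINT x|lborel. c i x * ln (c i x))"

definition admissible_data :: "('n::finite \<Rightarrow> real) \<Rightarrow> ('n \<Rightarrow> space \<Rightarrow> real) \<Rightarrow> bool" where
  "admissible_data z c0 \<longleftrightarrow>
     (\<forall>i. (AE x in lborel. 0 \<le> c0 i x) \<and> sobolev 2 (c0 i) \<and> integrable lborel (c0 i) \<and>
          integrable lborel (\<lambda>x. norm x ^ 6 * (c0 i x)\<^sup>2)) \<and>
     (LINT x|lborel. charge_density z c0 x) = 0"

end

theory Submission
  imports Defs
begin

text \<open>The negative entropy of a density is controlled by its first moment. Put \<open>bracket x = sqrt (1 + x \<bullet> x)\<close>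
  and compare a concentration \<open>c\<close> with the integrable function \<open>g = bracket\<^sup>-\<^sup>4\<close>: from
  \<open>ln (g / c) \<le> g / c - 1\<close> one gets \<open>- c ln c \<le> g + 4 c ln bracket\<close>, and
  \<open>ln bracket \<le> ln R + bracket / R\<close> for every \<open>R\<close>. If the first moment \<open>\<integral> c bracket\<close> is at most
  \<open>C (1 + t)\<close>, the choice \<open>R = 1 + t\<close> bounds the entropy by a constant times \<open>1 + ln (1 + t)\<close>
  (\<open>entropy_bound\<close>). Since all constants are free, this is the claim: replacing \<open>1 + t\<close> by
  \<open>t powr (15 / 16)\<close> inside the logarithm costs only a factor (\<open>log_growth\<close>).

  The first moment grows linearly (\<open>first_moment\<close>) for the following reason. Each concentration solves
  \<open>\<partial>\<^sub>t c = div (D \<nabla>c + c V)\<close> with drift \<open>V = z D \<nabla>\<phi> - u\<close>, so its moment changes at a rate at most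
  proportional to the flux \<open>\<integral> \<bar>c\<bar> (D + \<bar>V\<bar>)\<close>. Hardy's inequality bounds \<open>\<nabla>\<phi>\<close> pointwise by
  \<open>1 + \<parallel>\<rho>\<parallel>\<^sub>1 + \<parallel>\<rho>\<parallel>\<^sub>2\<^sup>2 + \<parallel>\<nabla>\<rho>\<parallel>\<^sub>2\<^sup>2\<close> up to a constant (\<open>field_pointwise_bound\<close>), and because the Leray
  projection is a contraction, \<open>\<parallel>u\<parallel>\<^sub>2\<close> is at most \<open>\<parallel>\<rho> \<nabla>\<phi>\<parallel>\<^sub>2\<close>. Once the \<open>L\<^sup>1\<close> and \<open>L\<^sup>2\<close> norms of the
  concentrations are bounded uniformly in time, the flux is therefore at most a constant times
  \<open>1 + \<parallel>\<nabla>\<rho>\<parallel>\<^sub>2\<^sup>2\<close> (\<open>flux_bound\<close>), and what remains is to bound \<open>\<integral> \<parallel>\<nabla>\<rho>\<parallel>\<^sub>2\<^sup>2 dt\<close>.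

  All a priori bounds come from one balance law (\<open>balance\<close>): the time derivative of
  \<open>\<integral> \<beta>(c) \<psi>\<close> consists of a transport term carried by the derivatives of the weight \<open>\<psi>\<close>, a dissipation
  term with \<open>\<beta>''\<close>, and a compression term with the factor \<open>s \<beta>'(s) - \<beta>(s)\<close>. The weights have compact
  support in a ball of radius \<open>R\<close> and slopes of order \<open>1 / R\<close>; for \<open>\<beta>\<close> of linear growth the transport
  term is at most a constant times the flux over \<open>R\<close> and vanishes as \<open>R\<close> tends to infinity. Smoothed
  absolute values \<open>sqrt (s\<^sup>2 + a\<^sup>2) - a\<close> with small \<open>a\<close> give nonnegativity (\<open>nonneg\<close>), the
  identity gives the bound on the mass (\<open>mass_le\<close>), and the same functions with large \<open>a\<close>, scaled to
  resemble \<open>s\<^sup>2\<close>, give the \<open>L\<^sup>2\<close> bound and the dissipation (\<open>energy_inequality\<close>). In the last step the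
  equal absolute values of the valences enter: all cations together, with density \<open>P\<close>, and all anions
  together, with density \<open>N\<close>, solve two equations of the same kind, with \<open>\<rho> = z (P - N)\<close>, and the
  two compression terms add up to
  \<open>- z\<^sup>2 D \<integral> (G(P) - G(N)) (P - N) \<psi>\<close> with \<open>G\<close> increasing on the nonnegative numbers.

  The initial data enter through the continuity of the solution at time zero in \<open>L\<^sup>1\<close> and \<open>L\<^sup>2\<close>. To
  read \<open>L\<^sup>2\<close> information off the Sobolev norms, whose derivatives are chosen arbitrarily among all
  weak derivatives, uniqueness of weak derivatives is needed, that is, enough test functions
  (\<open>fundamental_lemma\<close>).\<close>

section \<open>Test functions\<close>

text \<open>For \<open>q = 1\<close> and \<open>k = 0\<close> this is the standard smooth bump on the interval from \<open>a\<close> to \<open>b\<close>. The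
  polynomial \<open>q\<close> and the exponent \<open>k\<close> make the family closed under differentiation
  (\<open>bump_deriv\<close>), which yields derivatives of all orders at once.\<close>

definition bump :: "real poly \<Rightarrow> nat \<Rightarrow> real \<Rightarrow> real \<Rightarrow> real \<Rightarrow> real \<Rightarrow> real" where
  "bump q k l a b s = (if a < s \<and> s < b
     then poly q s / ((s - a) * (b - s)) ^ k * exp (- l / ((s - a) * (b - s))) else 0)"

lemma exp_inverse_le_power:
  fixes l y :: real
  assumes "0 < l" "0 < y"
  shows "exp (- l / y) \<le> (real (Suc n) * y / l) ^ Suc n"
proof -
  let ?x = "l / y / real (Suc n)"
  have x: "0 < ?x" using assms by simp
  have "?x \<le> exp ?x" using exp_ge_add_one_self[of ?x] by linarith
  hence "?x ^ Suc n \<le> exp ?x ^ Suc n" using x by (intro power_mono) auto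
  also have "\<dots> = exp (l / y)" by (subst exp_of_nat_mult[symmetric]) simp
  finally have "inverse (exp (l / y)) \<le> inverse (?x ^ Suc n)"
    using x by (intro le_imp_inverse_le zero_less_power)
  moreover have "inverse ?x = real (Suc n) * y / l" using assms by (simp add: field_simps)
  ultimately show ?thesis by (simp only: exp_minus minus_divide_left[symmetric] power_inverse[symmetric])
qed

text \<open>The exponential beats every power of the distance to the end points; the second order decay makes
  the derivative at the end points exist and vanish.\<close>

lemma bump_flat:
  assumes l: "0 < l" and ab: "a < b"
  obtains C where "0 \<le> C" "\<And>s. \<bar>bump q k l a b s\<bar> \<le> C * ((s - a) * (b - s))\<^sup>2"
proof -
  have "bounded ((\<lambda>s. poly q s) ` {a..b})"
    by (intro compact_imp_bounded compact_continuous_image continuous_intros compact_Icc)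
  then obtain K where "\<forall>y\<in>(\<lambda>s. poly q s) ` {a..b}. norm y \<le> K"
    unfolding bounded_iff by blast
  hence K: "\<And>s. s \<in> {a..b} \<Longrightarrow> \<bar>poly q s\<bar> \<le> K" by auto
  have K0: "0 \<le> K" using K[of a] ab by force
  let ?C = "K * (real (Suc (Suc k)) / l) ^ Suc (Suc k)"
  have "\<bar>bump q k l a b s\<bar> \<le> ?C * ((s - a) * (b - s))\<^sup>2" for s
  proof (cases "a < s \<and> s < b")
    case True
    let ?y = "(s - a) * (b - s)"
    have y: "0 < ?y" using True by simp
    have "\<bar>bump q k l a b s\<bar> = \<bar>poly q s\<bar> / ?y ^ k * exp (- l / ?y)"
      using True y by (simp add: bump_def abs_mult)
    also have "\<dots> \<le> K / ?y ^ k * (real (Suc (Suc k)) * ?y / l) ^ Suc (Suc k)"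
      using True y K[of s] K0 exp_inverse_le_power[OF l y, of "Suc k"]
      by (intro mult_mono divide_right_mono) auto
    also have "\<dots> = ?C * (?y ^ Suc (Suc k) / ?y ^ k)"
      by (simp add: power_mult_distrib power_divide del: power_Suc) (simp add: mult.commute)
    also have "?y ^ Suc (Suc k) / ?y ^ k = ?y\<^sup>2"
      using y by (simp add: power2_eq_square)
    finally show ?thesis .
  qed (use K0 l in \<open>auto simp: bump_def\<close>)
  moreover have "0 \<le> ?C" using K0 l by simp
  ultimately show ?thesis using that by blast
qed

lemma has_field_derivative_zeroI:
  fixes f :: "real \<Rightarrow> real"
  assumes "f c = 0" "0 < d" and le: "\<And>s. \<bar>s - c\<bar> < d \<Longrightarrow> \<bar>f s\<bar> \<le> C * (s - c)\<^sup>2"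
  shows "(f has_real_derivative 0) (at c)"
proof -
  have "((\<lambda>s. (f s - f c) / (s - c)) \<longlongrightarrow> 0) (at c)"
  proof (rule Lim_null_comparison)
    show "\<forall>\<^sub>F s in at c. norm ((f s - f c) / (s - c)) \<le> C * \<bar>s - c\<bar>"
      unfolding eventually_at
    proof (intro exI[of _ d] conjI ballI impI)
      fix s assume s: "s \<noteq> c \<and> dist s c < d"
      hence "\<bar>f s\<bar> \<le> C * (s - c)\<^sup>2" by (intro le) (auto simp: dist_real_def)
      also have "\<dots> = C * \<bar>s - c\<bar> * \<bar>s - c\<bar>" by (simp add: power2_eq_square abs_mult[symmetric])
      finally show "norm ((f s - f c) / (s - c)) \<le> C * \<bar>s - c\<bar>"
        using s assms(1) by (simp add: divide_simps)
    qed (use assms in auto)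
    have "((\<lambda>s. C * \<bar>s - c\<bar>) \<longlongrightarrow> C * \<bar>c - c\<bar>) (at c)" by (intro tendsto_intros)
    thus "((\<lambda>s. C * \<bar>s - c\<bar>) \<longlongrightarrow> 0) (at c)" by simp
  qed
  thus ?thesis by (simp add: has_field_derivative_iff)
qed

lemma bump_deriv:
  assumes l: "0 < l" and ab: "a < b"
  obtains q' k' where "\<And>s. (bump q k l a b has_real_derivative bump q' k' l a b s) (at s)"
proof -
  define Y where "Y = [:- a * b, a + b, -1:]"
  define Y' where "Y' = [:a + b, -2:]"
  let ?q = "pderiv q * Y * Y - smult (real k) (q * Y' * Y) + smult l (q * Y')"
  have Y: "poly Y s = (s - a) * (b - s)" "poly Y' s = a + b - 2 * s" for s
    by (simp_all add: algebra_simps Y_def Y'_def)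
  have "(bump q k l a b has_real_derivative bump ?q (k + 2) l a b s) (at s)" for s
  proof (cases "a < s \<and> s < b")
    case True
    let ?y = "(s - a) * (b - s)"
    have y: "?y \<noteq> 0" using True by simp
    have ev: "\<forall>\<^sub>F x in nhds s. x \<in> {a<..<b}"
      using True by (intro eventually_nhds_in_open) auto
    let ?f = "\<lambda>s. poly q s / ((s - a) * (b - s)) ^ k * exp (- l / ((s - a) * (b - s)))"
    have d1: "((\<lambda>s. ((s - a) * (b - s))) has_real_derivative (a + b - 2 * s)) (at s)"
      by (auto intro!: derivative_eq_intros simp: algebra_simps)
    have d2: "((\<lambda>s. ((s - a) * (b - s)) ^ k) has_real_derivative
       (real k * ?y ^ k / ?y) * (a + b - 2 * s)) (at s)"
    proof (cases k)
      case 0 then show ?thesis by simp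
    next
      case (Suc m)
      have "real (Suc m) * (w * Y ^ m) = real (Suc m) * Y ^ Suc m / Y * w" if "Y \<noteq> 0" for w Y :: real
        using that by simp
      from this[OF y, of "a + b - 2 * s"] show ?thesis unfolding Suc
        by (intro DERIV_power[OF d1, of "Suc m", THEN DERIV_cong]) (simp only: diff_Suc_1 mult.commute[of "a + b - 2 * s"] diff_Suc_Suc minus_nat.diff_0)
    qed
    have d3: "((\<lambda>s. exp (- l / ((s - a) * (b - s)))) has_real_derivative
       exp (- l / ?y) * (l * (a + b - 2 * s) / ?y\<^sup>2)) (at s)"
    proof -
      have "((\<lambda>s. - l / ((s - a) * (b - s))) has_real_derivative
          (0 * ?y - (- l) * (a + b - 2 * s)) / (?y * ?y)) (at s)"
        by (rule DERIV_divide[OF DERIV_const d1 y])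
      from DERIV_exp[THEN DERIV_chain2, OF this] show ?thesis
        by (simp add: power2_eq_square)
    qed
    have "(?f has_real_derivative
        (poly (pderiv q) s * ?y ^ k - poly q s * (real k * ?y ^ k / ?y * (a + b - 2 * s))) / (?y ^ k * ?y ^ k) * exp (- l / ?y)
          + (exp (- l / ?y) * (l * (a + b - 2 * s) / ?y\<^sup>2)) * (poly q s / ?y ^ k)) (at s)"
      by (intro DERIV_mult DERIV_divide poly_DERIV d2 d3) (use y in simp)
    also have "(poly (pderiv q) s * ?y ^ k - poly q s * (real k * ?y ^ k / ?y * (a + b - 2 * s))) / (?y ^ k * ?y ^ k) * exp (- l / ?y)
          + (exp (- l / ?y) * (l * (a + b - 2 * s) / ?y\<^sup>2)) * (poly q s / ?y ^ k)
        = bump ?q (k + 2) l a b s"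
    proof -
      have "\<And>Y K A B e w :: real. Y \<noteq> 0 \<Longrightarrow> K \<noteq> 0 \<Longrightarrow>
         (A * K - B * (real k * K / Y * w)) / (K * K) * e + (e * (l * w / Y\<^sup>2)) * (B / K)
         = (A * Y * Y - real k * (B * w * Y) + l * (B * w)) / (K * Y\<^sup>2) * e"
        by (simp add: field_simps power2_eq_square)
      from this[of ?y "?y ^ k"] y True show ?thesis
        by (simp add: bump_def power_add Y power2_eq_square)
    qed
    finally have "(?f has_real_derivative bump ?q (k + 2) l a b s) (at s)" .
    thus ?thesis
      by (subst has_field_derivative_cong_ev[OF refl, of _ _ ?f])
         (use ev True in \<open>auto simp: bump_def elim!: eventually_mono\<close>)
  next
    case False
    hence z: "bump ?q (k + 2) l a b s = 0" "bump q k l a b s = 0" by (auto simp: bump_def)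
    obtain C where C: "0 \<le> C" "\<And>s. \<bar>bump q k l a b s\<bar> \<le> C * ((s - a) * (b - s))\<^sup>2"
      using bump_flat[OF l ab] by blast
    show ?thesis unfolding z
    proof (rule has_field_derivative_zeroI)
      fix x assume "\<bar>x - s\<bar> < b - a"
      show "\<bar>bump q k l a b x\<bar> \<le> C * (b - a)\<^sup>2 * (x - s)\<^sup>2"
      proof (cases "a < x \<and> x < b")
        case True
        have "(x - a) * (b - x) \<le> (b - a) * \<bar>x - s\<bar>"
        proof (cases "s \<le> a")
          case True
          with \<open>a < x \<and> x < b\<close> have "(x - a) * (b - x) \<le> \<bar>x - s\<bar> * (b - a)"
            by (intro mult_mono) auto
          thus ?thesis by (simp add: mult.commute)
        next
          case False
          with \<open>\<not> (a < s \<and> s < b)\<close> have "b \<le> s" by auto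
          with \<open>a < x \<and> x < b\<close> show ?thesis by (intro mult_mono) auto
        qed
        hence "((x - a) * (b - x))\<^sup>2 \<le> ((b - a) * \<bar>x - s\<bar>)\<^sup>2"
          using True by (intro power_mono) auto
        hence "C * ((x - a) * (b - x))\<^sup>2 \<le> C * ((b - a) * \<bar>x - s\<bar>)\<^sup>2"
          using C by (intro mult_left_mono) auto
        thus ?thesis using C(2)[of x] by (simp add: power_mult_distrib mult.assoc)
      qed (use C ab in \<open>auto simp: bump_def\<close>)
    qed (use ab z in auto)
  qed
  thus ?thesis using that by blast
qed

definition bump_box :: "real \<Rightarrow> space \<Rightarrow> space \<Rightarrow> space \<Rightarrow> real" where
  "bump_box l a b x = (\<Prod>j\<in>UNIV. bump 1 0 l (a $ j) (b $ j) (x $ j))"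

text \<open>A class of functions on the line that is closed under differentiation gives a class of
  functions on space, products of three of them, that is closed under partial derivatives.
  Membership then gives smoothness, without any Leibniz rule of higher order.\<close>

lemma smooth_on_product_bumps:
  fixes a b :: space and q :: "3 \<Rightarrow> real poly" and k :: "3 \<Rightarrow> nat"
  assumes l: "0 < l" and ab: "\<And>j. a $ j < b $ j"
  shows "Ck_on n UNIV (\<lambda>x :: space. bump (q 1) (k 1) l (a $ 1) (b $ 1) (x $ 1)
     * bump (q 2) (k 2) l (a $ 2) (b $ 2) (x $ 2) * bump (q 3) (k 3) l (a $ 3) (b $ 3) (x $ 3))"
proof (induction n arbitrary: q k)
  case (0 q k)
  have "continuous_on UNIV (bump (q j) (k j) l (a $ j) (b $ j))" for j :: 3
    using bump_deriv[OF l ab] by (metis DERIV_isCont continuous_at_imp_continuous_on)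
  hence "continuous_on UNIV (\<lambda>x :: space. bump (q j) (k j) l (a $ j) (b $ j) (x $ j))" for j :: 3
    by (rule continuous_on_compose2) (auto intro!: continuous_intros)
  thus ?case by (auto intro!: continuous_intros)
next
  case (Suc n q k)
  have "\<forall>j. \<exists>p. \<forall>s. (bump (q j) (k j) l (a $ j) (b $ j) has_real_derivative
      bump (fst p) (snd p) l (a $ j) (b $ j) s) (at s)"
  proof
    fix j
    obtain q' k' where "\<And>s. (bump (q j) (k j) l (a $ j) (b $ j) has_real_derivative bump q' k' l (a $ j) (b $ j) s) (at s)"
      using bump_deriv[OF l ab] by blast
    thus "\<exists>p. \<forall>s. (bump (q j) (k j) l (a $ j) (b $ j) has_real_derivative
      bump (fst p) (snd p) l (a $ j) (b $ j) s) (at s)" by (intro exI[of _ "(q', k')"]) simp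
  qed
  from choice[OF this] obtain p where d: "\<forall>j s. (bump (q j) (k j) l (a $ j) (b $ j) has_real_derivative
      bump (fst (p j)) (snd (p j)) l (a $ j) (b $ j) s) (at s)" ..
  define q' where "q' j = fst (p j)" for j
  define k' where "k' j = snd (p j)" for j
  define g where "g j = bump (q j) (k j) l (a $ j) (b $ j)" for j
  define g' where "g' j = bump (q' j) (k' j) l (a $ j) (b $ j)" for j
  have D: "((\<lambda>x :: space. g 1 (x $ 1) * g 2 (x $ 2) * g 3 (x $ 3)) has_derivative
     (\<lambda>h. g' 1 (x $ 1) * h $ 1 * (g 2 (x $ 2) * g 3 (x $ 3)) + g 1 (x $ 1) * (g' 2 (x $ 2) * h $ 2) * g 3 (x $ 3)
          + g 1 (x $ 1) * g 2 (x $ 2) * (g' 3 (x $ 3) * h $ 3))) (at x)" for x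
  proof -
    have c: "((\<lambda>x :: space. g j (x $ j)) has_derivative (\<lambda>h. g' j (x $ j) * h $ j)) (at x)" for j
    proof -
      have "((\<lambda>x :: space. x $ j) has_derivative (\<lambda>h. h $ j)) (at x)"
        by (rule bounded_linear_imp_has_derivative) (rule bounded_linear_vec_nth)
      from has_derivative_compose[OF this, of "g j" "\<lambda>h. g' j (x $ j) * h"] d
      show ?thesis by (simp add: g_def g'_def q'_def k'_def has_field_derivative_def)
    qed
    show ?thesis
      by (rule has_derivative_eq_rhs[OF has_derivative_mult[OF has_derivative_mult[OF c c] c]])
         (simp add: algebra_simps fun_eq_iff)
  qed
  have fd: "frechet_derivative (\<lambda>x :: space. g 1 (x $ 1) * g 2 (x $ 2) * g 3 (x $ 3)) (at x)
    = (\<lambda>h. g' 1 (x $ 1) * h $ 1 * (g 2 (x $ 2) * g 3 (x $ 3)) + g 1 (x $ 1) * (g' 2 (x $ 2) * h $ 2) * g 3 (x $ 3)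
          + g 1 (x $ 1) * g 2 (x $ 2) * (g' 3 (x $ 3) * h $ 3))" for x
    by (rule frechet_derivative_at[OF D, symmetric])
  have "Ck_on n UNIV (\<lambda>x. frechet_derivative (\<lambda>x :: space. g 1 (x $ 1) * g 2 (x $ 2) * g 3 (x $ 3)) (at x) v)"
    if "v \<in> Basis" for v :: space
  proof -
    have "\<exists>j. v = axis j (1 :: real)" using that unfolding Basis_vec_def by auto
    then obtain j where v: "v = axis j (1 :: real)" ..
    define Q where "Q i = (if i = j then q' i else q i)" for i
    define K where "K i = (if i = j then k' i else k i)" for i
    have "(\<lambda>x. frechet_derivative (\<lambda>x :: space. g 1 (x $ 1) * g 2 (x $ 2) * g 3 (x $ 3)) (at x) v)
      = (\<lambda>x. bump (Q 1) (K 1) l (a $ 1) (b $ 1) (x $ 1)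
     * bump (Q 2) (K 2) l (a $ 2) (b $ 2) (x $ 2) * bump (Q 3) (K 3) l (a $ 3) (b $ 3) (x $ 3))"
    proof
      fix x
      have ax: "axis j (1 :: real) $ i = (if i = j then 1 else 0)" for i by (simp add: axis_def)
      consider "j = 1" | "j = 2" | "j = 3" using exhaust_3[of j] by blast
      thus "frechet_derivative (\<lambda>x :: space. g 1 (x $ 1) * g 2 (x $ 2) * g 3 (x $ 3)) (at x) v
        = bump (Q 1) (K 1) l (a $ 1) (b $ 1) (x $ 1)
           * bump (Q 2) (K 2) l (a $ 2) (b $ 2) (x $ 2) * bump (Q 3) (K 3) l (a $ 3) (b $ 3) (x $ 3)"
        unfolding fd v ax by cases (simp_all add: Q_def K_def g_def g'_def)
    qed
    thus ?thesis using Suc[of Q K] by (simp only:)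
  qed
  moreover have "\<forall>x. (\<lambda>x :: space. g 1 (x $ 1) * g 2 (x $ 2) * g 3 (x $ 3)) differentiable (at x)"
    using D by (auto simp: differentiable_def)
  ultimately show ?case by (simp add: g_def)
qed

lemma bump_box_eq_0: "x \<notin> box a b \<Longrightarrow> bump_box l a b x = 0"
proof -
  assume "x \<notin> box a b"
  then obtain j where "\<not> (a $ j < x $ j \<and> x $ j < b $ j)" by (auto simp: mem_box_cart)
  hence "bump 1 0 l (a $ j) (b $ j) (x $ j) = 0" by (simp only: bump_def if_False)
  thus ?thesis unfolding bump_box_def by (intro prod_zero) auto
qed

lemma test_function_bump_box:
  assumes l: "0 < l" and ab: "\<And>j. a $ j < b $ j"
  shows "test_function (bump_box l a b)"
proof -
  have eq: "bump_box l a b = (\<lambda>x. bump 1 0 l (a $ 1) (b $ 1) (x $ 1)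
     * bump 1 0 l (a $ 2) (b $ 2) (x $ 2) * bump 1 0 l (a $ 3) (b $ 3) (x $ 3))"
    unfolding bump_box_def UNIV_3 by (rule ext) (simp add: mult.assoc)
  have "{x. bump_box l a b x \<noteq> 0} \<subseteq> box a b"
    using bump_box_eq_0 by blast
  hence "compact (closure {x. bump_box l a b x \<noteq> 0})"
    unfolding compact_closure by (rule bounded_subset[OF bounded_box])
  thus ?thesis
    using smooth_on_product_bumps[OF l ab, of _ "\<lambda>_. 1" "\<lambda>_. 0"]
    unfolding test_function_def smooth_on_def eq by blast
qed

lemma bump_box_range: assumes "0 < l" shows "0 \<le> bump_box l a b x" "bump_box l a b x \<le> 1"
proof -
  have "0 \<le> bump 1 0 l c d s" "bump 1 0 l c d s \<le> 1" for c d s :: real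
    using assms by (auto simp: bump_def divide_le_0_iff)
  thus "0 \<le> bump_box l a b x" "bump_box l a b x \<le> 1"
    unfolding bump_box_def by (simp_all add: prod_nonneg prod_le_1)
qed

text \<open>Letting the parameter tend to zero flattens the bumps to the indicator of the open box, so that
  testing against all \<open>bump_box\<close> functions determines the integrals over all boxes.\<close>

lemma bump_box_tendsto_indicator:
  "(\<lambda>n. bump_box (inverse (real (Suc n))) a b x) \<longlonglongrightarrow> indicator (box a b) x"
proof -
  have "(\<lambda>n. bump 1 0 (inverse (real (Suc n))) c d s) \<longlonglongrightarrow> (if c < s \<and> s < d then 1 else 0)" for c d s :: real
  proof (cases "c < s \<and> s < d")
    case True
    have "(\<lambda>n. exp (- inverse (real (Suc n)) / ((s - c) * (d - s)))) \<longlonglongrightarrow> exp (- 0 / ((s - c) * (d - s)))"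
      using True by (intro tendsto_intros LIMSEQ_inverse_real_of_nat) auto
    thus ?thesis using True by (simp add: bump_def)
  qed (auto simp: bump_def)
  hence "(\<lambda>n. bump_box (inverse (real (Suc n))) a b x) \<longlonglongrightarrow> (\<Prod>j\<in>UNIV. if a $ j < x $ j \<and> x $ j < b $ j then 1 else 0)"
    unfolding bump_box_def by (intro tendsto_prod)
  also have "(\<Prod>j\<in>UNIV. if a $ j < x $ j \<and> x $ j < b $ j then 1 else 0) = (indicator (box a b) x :: real)"
  proof (cases "x \<in> box a b")
    case False
    then obtain j where "\<not> (a $ j < x $ j \<and> x $ j < b $ j)" by (auto simp: mem_box_cart)
    hence "(\<Prod>j\<in>UNIV. if a $ j < x $ j \<and> x $ j < b $ j then 1 else 0) = (0 :: real)"
      by (intro prod_zero) auto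
    thus ?thesis using False by simp
  qed (simp add: mem_box_cart)
  finally show ?thesis .
qed

section \<open>The fundamental lemma of the calculus of variations\<close>

definition locally_integrable :: "(space \<Rightarrow> real) \<Rightarrow> bool" where
  "locally_integrable f \<longleftrightarrow> f \<in> borel_measurable borel \<and>
     (\<forall>R. integrable lborel (\<lambda>x. indicator (cball 0 R) x * f x))"

text \<open>The positive and the negative part, as densities, define two finite measures that agree on the
  boxes, an intersection stable generator of the Borel sets.\<close>

lemma integrable_zero_on_boxes:
  fixes f :: "space \<Rightarrow> real"
  assumes f[measurable]: "integrable lborel f"
    and box0: "\<And>a b. (LINT x|lborel. f x * indicator (box a b) x) = 0"
  shows "AE x in lborel. f x = 0"
proof -
  define M where "M = density lborel (\<lambda>x. ennreal (max 0 (f x)))"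
  define N where "N = density lborel (\<lambda>x. ennreal (max 0 (- f x)))"
  have mf[measurable]: "f \<in> borel_measurable lborel" using f by (rule borel_measurable_integrable)
  have int: "integrable lborel (\<lambda>x. max 0 (f x) * indicator (box a b) x)"
    "integrable lborel (\<lambda>x. max 0 (- f x) * indicator (box a b) x)" for a b :: space
    by (rule Bochner_Integration.integrable_bound[OF f]; auto simp: indicator_def)+
  have em: "emeasure M (box a b) = ennreal (LINT x|lborel. max 0 (f x) * indicator (box a b) x)"
    "emeasure N (box a b) = ennreal (LINT x|lborel. max 0 (- f x) * indicator (box a b) x)" for a b :: space
    unfolding M_def N_def
    by (subst emeasure_density; auto simp: nn_integral_eq_integral[OF int(1), symmetric] nn_integral_eq_integral[OF int(2), symmetric] ennreal_mult ennreal_indicator intro!: nn_integral_cong)+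
  have eq: "emeasure M (box a b) = emeasure N (box a b)" for a b :: space
  proof -
    have "(LINT x|lborel. max 0 (f x) * indicator (box a b) x) - (LINT x|lborel. max 0 (- f x) * indicator (box a b) x)
       = (LINT x|lborel. f x * indicator (box a b) x)"
      by (subst Bochner_Integration.integral_diff[OF int, symmetric])
         (auto intro!: Bochner_Integration.integral_cong simp: max_def algebra_simps)
    thus ?thesis using box0[of a b] by (simp add: em)
  qed
  have "M = N"
  proof (rule measure_eqI_generator_eq)
    let ?E = "range (\<lambda>(a, b). box a b::space set)"
    let ?A = "\<lambda>n::nat. box (- (real n *\<^sub>R One)) (real n *\<^sub>R One) :: space set"
    show "Int_stable ?E"
      by (auto simp: Int_stable_def box_Int_box)
    show "?E \<subseteq> Pow UNIV" "sets M = sigma_sets UNIV ?E" "sets N = sigma_sets UNIV ?E"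
      by (simp_all add: borel_eq_box M_def N_def)
    show "range ?A \<subseteq> ?E" "(\<Union>i. ?A i) = UNIV"
      unfolding UN_box_eq_UNIV by auto
    show "emeasure M (?A i) \<noteq> \<infinity>" for i by (simp add: em)
    show "emeasure M X = emeasure N X" if "X \<in> ?E" for X
      using that eq by auto
  qed
  hence "AE x in lborel. ennreal (max 0 (f x)) = ennreal (max 0 (- f x))"
    unfolding M_def N_def by (intro sigma_finite_measure.density_unique[OF lborel.sigma_finite_measure_axioms]) auto
  thus ?thesis by eventually_elim (auto simp: max_def split: if_splits)
qed

text \<open>Dominated convergence along the bumps shows that \<open>f\<close> integrates to zero over every box; on each
  of the exhausting boxes \<open>f\<close> is integrable and the previous lemma applies.\<close>

theorem fundamental_lemma:
  assumes f: "locally_integrable f"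
    and test: "\<And>\<psi>. test_function \<psi> \<Longrightarrow> (LINT x|lborel. f x * \<psi> x) = 0"
  shows "AE x in lborel. f x = 0"
proof -
  have [measurable]: "f \<in> borel_measurable borel" using f by (simp add: locally_integrable_def)
  have sub: "\<exists>R. box a b \<subseteq> cball 0 R" for a b :: space
  proof -
    obtain r where "box a b \<subseteq> ball 0 r" using bounded_subset_ballD[OF bounded_box] by blast
    thus ?thesis using ball_subset_cball subset_trans by blast
  qed
  have int: "integrable lborel (\<lambda>x. \<bar>f x\<bar> * indicator (cball 0 R) x)" for R
    using f integrable_abs[of lborel "\<lambda>x. indicator (cball 0 R) x * f x"]
    by (simp add: locally_integrable_def abs_mult mult.commute)
  have box0: "(LINT x|lborel. f x * indicator (box a b) x) = 0" for a b
  proof (cases "\<forall>j. a $ j < b $ j")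
    case True
    obtain R where R: "box a b \<subseteq> cball 0 R" using sub by blast
    have "(\<lambda>n. LINT x|lborel. f x * bump_box (inverse (real (Suc n))) a b x)
      \<longlonglongrightarrow> (LINT x|lborel. f x * indicator (box a b) x)"
    proof (rule integral_dominated_convergence[where w = "\<lambda>x. \<bar>f x\<bar> * indicator (cball 0 R) x"])
      have "continuous_on UNIV (bump_box (inverse (real (Suc n))) a b)" for n
        using test_function_bump_box[of "inverse (real (Suc n))" a b] True
        by (simp add: test_function_def smooth_on_def) (meson Ck_on.simps(1))
      hence [measurable]: "bump_box (inverse (real (Suc n))) a b \<in> borel_measurable borel" for n
        by (rule borel_measurable_continuous_onI)
      show "(\<lambda>x. f x * bump_box (inverse (real (Suc n))) a b x) \<in> borel_measurable lborel" for n
        by measurable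
      show "AE x in lborel. norm (f x * bump_box (inverse (real (Suc n))) a b x) \<le> \<bar>f x\<bar> * indicator (cball 0 R) x" for n
      proof (rule AE_I2)
        fix x
        have "\<bar>bump_box (inverse (real (Suc n))) a b x\<bar> \<le> indicator (cball 0 R) x"
          using bump_box_range[of "inverse (real (Suc n))" a b x] bump_box_eq_0[of x a b "inverse (real (Suc n))"] R
          by (cases "x \<in> box a b") (auto simp: indicator_def)
        thus "norm (f x * bump_box (inverse (real (Suc n))) a b x) \<le> \<bar>f x\<bar> * indicator (cball 0 R) x"
          by (simp add: abs_mult mult_left_mono)
      qed
      show "AE x in lborel. (\<lambda>n. f x * bump_box (inverse (real (Suc n))) a b x) \<longlonglongrightarrow> f x * indicator (box a b) x"
        by (intro AE_I2 tendsto_mult tendsto_const bump_box_tendsto_indicator)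
    qed (auto intro: int)
    moreover have "(LINT x|lborel. f x * bump_box (inverse (real (Suc n))) a b x) = 0" for n
      by (rule test[OF test_function_bump_box]) (use True in auto)
    ultimately show ?thesis by (simp add: LIMSEQ_const_iff)
  next
    case False
    then obtain j where "\<not> a $ j < b $ j" by blast
    hence "x \<notin> box a b" for x
      using mem_box_cart(1)[of x a b] less_trans[of "a $ j" "x $ j" "b $ j"] by blast
    hence "box a b = {}" by blast
    thus ?thesis by simp
  qed
  have "AE x in lborel. f x * indicator (box (- (real n *\<^sub>R One)) (real n *\<^sub>R One)) x = 0" for n :: nat
  proof (rule integrable_zero_on_boxes)
    let ?Q = "box (- (real n *\<^sub>R One)) (real n *\<^sub>R One) :: space set"
    obtain R where R: "?Q \<subseteq> cball 0 R" using sub by blast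
    show "integrable lborel (\<lambda>x. f x * indicator ?Q x)"
      by (rule Bochner_Integration.integrable_bound[OF int[of R]])
         (use R in \<open>auto simp: indicator_def intro!: AE_I2\<close>)
    show "(LINT x|lborel. f x * indicator ?Q x * indicator (box a b) x) = 0" for a b
    proof -
      have "(LINT x|lborel. f x * indicator ?Q x * indicator (box a b) x)
          = (LINT x|lborel. f x * indicator (?Q \<inter> box a b) x)"
        by (simp only: indicator_inter_arith mult.assoc)
      also have "\<dots> = 0" unfolding box_Int_box by (rule box0)
      finally show ?thesis .
    qed
  qed
  hence "AE x in lborel. \<forall>n :: nat. f x * indicator (box (- (real n *\<^sub>R One)) (real n *\<^sub>R One)) x = 0"
    unfolding AE_all_countable by blast
  thus ?thesis
  proof eventually_elim
    case (elim x)
    have "x \<in> (\<Union>n::nat. box (- (real n *\<^sub>R One)) (real n *\<^sub>R One))" unfolding UN_box_eq_UNIV by simp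
    then obtain n :: nat where "x \<in> box (- (real n *\<^sub>R One)) (real n *\<^sub>R One)" by blast
    with elim show ?case by (metis indicator_simps(1) mult.right_neutral)
  qed
qed

section \<open>Continuous functions of compact support\<close>

lemma integrable_indicator_cball: "integrable lborel (indicator (cball (a :: space) R) :: space \<Rightarrow> real)"
  by (rule integrable_real_indicator)
     (use emeasure_lborel_cball_finite[of a R] in \<open>simp_all add: infinity_ennreal_def\<close>)

lemma integrable_continuous_compact_support:
  fixes f :: "space \<Rightarrow> real"
  assumes f: "continuous_on UNIV f" and 0: "\<And>x. R < norm x \<Longrightarrow> f x = 0"
  shows "integrable lborel f"
proof -
  have "integrable lborel (\<lambda>x. indicator (cball 0 R) x *\<^sub>R f x)"
    using f by (intro borel_integrable_compact continuous_on_subset[OF f]) auto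
  also have "(\<lambda>x. indicator (cball 0 R) x *\<^sub>R f x) = f"
    using 0 by (auto simp: indicator_def fun_eq_iff)
  finally show ?thesis .
qed

lemma locally_integrable_continuous:
  fixes f :: "space \<Rightarrow> real"
  assumes f: "continuous_on UNIV f"
  shows "locally_integrable f"
  unfolding locally_integrable_def
proof safe
  show "f \<in> borel_measurable borel" using f by (rule borel_measurable_continuous_onI)
  have "integrable lborel (\<lambda>x. indicator (cball 0 R) x *\<^sub>R f x)" for R
    using f by (intro borel_integrable_compact continuous_on_subset[OF f]) auto
  thus "integrable lborel (\<lambda>x. indicator (cball 0 R) x * f x)" for R by simp
qed

lemma locally_integrable_diff:
  assumes "locally_integrable f" "locally_integrable g"
  shows "locally_integrable (\<lambda>x. f x - g x)"
  using assms unfolding locally_integrable_def by (auto simp: right_diff_distrib)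

lemma locally_integrable_square_integrable:
  fixes f :: "space \<Rightarrow> real"
  assumes "square_integrable f"
  shows "locally_integrable f"
proof -
  have [measurable]: "f \<in> borel_measurable borel" and i: "integrable lborel (\<lambda>x. (f x)\<^sup>2)"
    using assms by (auto simp: square_integrable_def)
  have "integrable lborel (\<lambda>x. indicator (cball 0 R) x * f x)" for R
  proof (rule Bochner_Integration.integrable_bound)
    have "integrable lborel (\<lambda>x::space. indicator (cball 0 R) x * (1::real))"
      by (intro integrable_mult_left integrable_indicator_cball)
    with i show "integrable lborel (\<lambda>x. indicator (cball 0 R) x * 1 + (f x)\<^sup>2)"
      by (intro Bochner_Integration.integrable_add)
    have "\<bar>t\<bar> \<le> 1 + t\<^sup>2" for t :: real
      using zero_le_power2[of "\<bar>t\<bar> - 1"] zero_le_power2[of t] by (simp add: power2_diff)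
    thus "AE x in lborel. norm (indicator (cball 0 R) x * f x) \<le> norm (indicator (cball 0 R) x * 1 + (f x)\<^sup>2)"
      by (auto simp: indicator_def)
    show "(\<lambda>x. indicator (cball 0 R) x * f x) \<in> borel_measurable lborel"
      by (intro borel_measurable_times borel_measurable_indicator) auto
  qed
  thus ?thesis by (simp add: locally_integrable_def)
qed

lemma integrable_locally_integrable_mult:
  assumes f: "locally_integrable f" and g: "continuous_on UNIV g"
    and 0: "\<And>x. R < norm x \<Longrightarrow> g x = 0"
  shows "integrable lborel (\<lambda>x. f x * g x)"
proof -
  have [measurable]: "f \<in> borel_measurable borel" using f by (simp add: locally_integrable_def)
  have [measurable]: "g \<in> borel_measurable borel" using g by (rule borel_measurable_continuous_onI)
  have "bounded (g ` cball 0 R)"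
    by (intro compact_imp_bounded compact_continuous_image continuous_on_subset[OF g]) auto
  then obtain K where K: "\<forall>y\<in>g ` cball 0 R. norm y \<le> K" unfolding bounded_iff by blast
  show ?thesis
  proof (rule Bochner_Integration.integrable_bound)
    show "integrable lborel (\<lambda>x. K * (indicator (cball 0 R) x * f x))"
      using f by (intro integrable_mult_right) (simp add: locally_integrable_def)
    show "AE x in lborel. norm (f x * g x) \<le> norm (K * (indicator (cball 0 R) x * f x))"
    proof (rule AE_I2)
      fix x
      show "norm (f x * g x) \<le> norm (K * (indicator (cball 0 R) x * f x))"
      proof (cases "norm x \<le> R")
        case True
        hence "\<bar>g x\<bar> \<le> K" using K by auto
        hence "\<bar>g x\<bar> \<le> \<bar>K\<bar>" by linarith
        from mult_right_mono[OF this, of "\<bar>f x\<bar>"] show ?thesis using True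
          by (simp add: abs_mult mult.commute)
      qed (use 0[of x] in simp)
    qed
  qed measurable
qed

lemma lborel_integral_translate:
  fixes f :: "space \<Rightarrow> real"
  assumes [measurable]: "f \<in> borel_measurable borel"
  shows "(LINT x|lborel. f (c + x)) = (LINT x|lborel. f x)"
proof -
  have "(LINT x|distr lborel borel ((+) c). f x) = (LINT x|lborel. f (c + x))"
    by (rule integral_distr) auto
  thus ?thesis by (simp add: lborel_distr_plus)
qed

lemma lborel_integrable_translate:
  fixes f :: "space \<Rightarrow> real"
  assumes f: "integrable lborel f"
  shows "integrable lborel (\<lambda>x. f (c + x))"
proof -
  have "integrable (distr lborel borel ((+) c)) f" using f by (simp add: lborel_distr_plus)
  thus ?thesis by (subst (asm) integrable_distr_eq) (use f in auto)
qed

section \<open>Directional derivatives and integration by parts\<close>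

text \<open>A derivative along a coordinate line is an ordinary one-variable derivative, so that the product
  and chain rules are inherited directly, and no differentiability in the sense of Frechet has to be
  carried along.\<close>

definition has_partial :: "3 \<Rightarrow> (space \<Rightarrow> real) \<Rightarrow> real \<Rightarrow> space \<Rightarrow> bool" where
  "has_partial j f d x \<longleftrightarrow> ((\<lambda>h. f (x + h *\<^sub>R axis j 1)) has_real_derivative d) (at 0)"

lemma has_partial_shift:
  assumes "has_partial j f d (x + s *\<^sub>R axis j 1)"
  shows "((\<lambda>h. f (x + h *\<^sub>R axis j 1)) has_real_derivative d) (at s)"
proof -
  have "((\<lambda>h. f (x + (h + s) *\<^sub>R axis j 1)) has_real_derivative d) (at 0)"
    using assms by (simp add: has_partial_def algebra_simps)
  thus ?thesis using DERIV_shift[of "\<lambda>h. f (x + h *\<^sub>R axis j 1)" d 0 s] by simp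
qed

lemma has_partial_mult:
  "has_partial j f d x \<Longrightarrow> has_partial j g e x \<Longrightarrow> has_partial j (\<lambda>y. f y * g y) (d * g x + e * f x) x"
  unfolding has_partial_def by (auto dest: DERIV_mult)

lemma has_partial_add:
  "has_partial j f d x \<Longrightarrow> has_partial j g e x \<Longrightarrow> has_partial j (\<lambda>y. f y + g y) (d + e) x"
  unfolding has_partial_def by (auto dest: DERIV_add)

lemma has_partial_diff:
  "has_partial j f d x \<Longrightarrow> has_partial j g e x \<Longrightarrow> has_partial j (\<lambda>y. f y - g y) (d - e) x"
  unfolding has_partial_def by (auto dest: DERIV_diff)

lemma has_partial_cmult:
  "has_partial j f d x \<Longrightarrow> has_partial j (\<lambda>y. c * f y) (c * d) x"
  unfolding has_partial_def by (auto dest: DERIV_cmult)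

lemma has_partial_sum:
  "(\<And>i. i \<in> I \<Longrightarrow> has_partial j (f i) (d i) x) \<Longrightarrow> has_partial j (\<lambda>y. \<Sum>i\<in>I. f i y) (\<Sum>i\<in>I. d i) x"
  unfolding has_partial_def by (auto intro: DERIV_sum)

lemma has_partial_compose:
  "(g has_real_derivative e) (at (f x)) \<Longrightarrow> has_partial j f d x \<Longrightarrow> has_partial j (\<lambda>y. g (f y)) (e * d) x"
  unfolding has_partial_def using DERIV_chain2[of g e "\<lambda>h. f (x + h *\<^sub>R axis j 1)" 0] by simp

lemma has_partial_translate:
  "has_partial j f d (a + x) \<Longrightarrow> has_partial j (\<lambda>y. f (a + y)) d x"
  unfolding has_partial_def by (simp add: add.assoc)

lemma has_derivative_imp_has_partial:
  assumes "(f has_derivative f') (at x)"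
  shows "has_partial j f (f' (axis j 1)) x"
proof -
  have 1: "((\<lambda>h. x + h *\<^sub>R axis j 1) has_derivative (\<lambda>h. h *\<^sub>R axis j 1)) (at (0 :: real))"
    by (auto intro!: derivative_eq_intros)
  have "((\<lambda>h. f (x + h *\<^sub>R axis j 1)) has_derivative (\<lambda>h. f' (h *\<^sub>R axis j 1))) (at 0)"
    using has_derivative_compose[OF 1, of f f'] assms by simp
  moreover have "(\<lambda>h. f' (h *\<^sub>R axis j 1)) = (*) (f' (axis j 1))"
    using linear_scale[OF has_derivative_linear[OF assms]] by (auto simp: fun_eq_iff)
  ultimately show ?thesis by (simp add: has_partial_def has_field_derivative_def)
qed

lemma has_partial_partial: "f differentiable (at x) \<Longrightarrow> has_partial j f (partial j f x) x"
  unfolding partial_def by (intro has_derivative_imp_has_partial) (simp add: frechet_derivative_works[symmetric])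

lemma has_partial_unique: "has_partial j f d x \<Longrightarrow> has_partial j f e x \<Longrightarrow> d = e"
  unfolding has_partial_def by (rule DERIV_unique)

text \<open>The integral of \<open>f (x + h e\<^sub>j)\<close> does not depend on \<open>h\<close>, by translation invariance; differentiating
  at \<open>h = 0\<close> under the integral gives the claim. The mean value theorem provides the dominating
  function. Applied to products, this is integration by parts.\<close>

theorem integral_has_partial_eq_0:
  assumes f: "continuous_on UNIV f" and f': "continuous_on UNIV f'"
    and d: "\<And>x. has_partial j f (f' x) x" and 0: "\<And>x. R < norm x \<Longrightarrow> f x = 0"
  shows "(LINT x|lborel. f' x) = 0"
proof -
  have [measurable]: "f \<in> borel_measurable borel" "f' \<in> borel_measurable borel"
    using f f' by (auto intro: borel_measurable_continuous_onI)
  have "bounded (f' ` cball 0 (R + 2))"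
    by (intro compact_imp_bounded compact_continuous_image continuous_on_subset[OF f']) auto
  then obtain K where K: "\<forall>y\<in>f' ` cball 0 (R + 2). norm y \<le> K" unfolding bounded_iff by blast
  define h where "h n = inverse (real (Suc n))" for n
  have h: "0 < h n" "h n \<le> 1" for n by (auto simp: h_def field_simps)
  have hlim: "h \<longlonglongrightarrow> 0" unfolding h_def by (rule LIMSEQ_inverse_real_of_nat)
  let ?q = "\<lambda>n x. (f (x + h n *\<^sub>R axis j 1) - f x) / h n"
  have i: "integrable lborel f" by (rule integrable_continuous_compact_support[OF f 0])
  have q0: "(LINT x|lborel. ?q n x) = 0" for n
    using lborel_integral_translate[of f "h n *\<^sub>R axis j 1"] lborel_integrable_translate[OF i, of "h n *\<^sub>R axis j 1"] i
    by (simp add: add.commute)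
  have "(\<lambda>n. LINT x|lborel. ?q n x) \<longlonglongrightarrow> (LINT x|lborel. f' x)"
  proof (rule integral_dominated_convergence[where w = "\<lambda>x. K * indicator (cball 0 (R + 1)) x"])
    show "integrable lborel (\<lambda>x. K * indicator (cball (0 :: space) (R + 1)) x)"
      by (intro integrable_mult_right integrable_indicator_cball)
    show "AE x in lborel. (\<lambda>n. ?q n x) \<longlonglongrightarrow> f' x"
    proof (rule AE_I2)
      fix x
      have "((\<lambda>h. (f (x + h *\<^sub>R axis j 1) - f x) / h) \<longlongrightarrow> f' x) (at 0)"
        using d[of x] by (simp add: has_partial_def has_field_derivative_iff)
      moreover have "filterlim h (at 0) sequentially"
        using hlim h(1) by (auto simp: filterlim_at less_imp_neq[symmetric])
      ultimately show "(\<lambda>n. ?q n x) \<longlonglongrightarrow> f' x" by (rule filterlim_compose)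
    qed
    show "AE x in lborel. norm (?q n x) \<le> K * indicator (cball 0 (R + 1)) x" for n
    proof (rule AE_I2)
      fix x
      show "norm (?q n x) \<le> K * indicator (cball 0 (R + 1)) x"
      proof (cases "norm x \<le> R + 1")
        case True
        have "\<exists>z. 0 < z \<and> z < h n \<and> f (x + h n *\<^sub>R axis j 1) - f (x + 0 *\<^sub>R axis j 1) = (h n - 0) * f' (x + z *\<^sub>R axis j 1)"
          by (rule MVT2) (use h in \<open>auto intro: has_partial_shift d\<close>)
        then obtain z where z: "0 < z" "z < h n" "f (x + h n *\<^sub>R axis j 1) - f x = h n * f' (x + z *\<^sub>R axis j 1)"
          by auto
        have "norm (x + z *\<^sub>R axis j 1) \<le> norm x + norm (z *\<^sub>R axis j (1::real) :: space)" by (rule norm_triangle_ineq)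
        also have "\<dots> \<le> R + 2" using True z h(2)[of n] by simp
        finally have "norm (f' (x + z *\<^sub>R axis j 1)) \<le> K" using K by auto
        thus ?thesis using z h(1)[of n] True by simp
      next
        case False
        have "norm (x + h n *\<^sub>R axis j 1) \<ge> norm x - norm (h n *\<^sub>R axis j (1::real) :: space)"
          by (rule norm_diff_ineq)
        hence "norm (x + h n *\<^sub>R axis j 1) > R" using False h[of n] by simp
        thus ?thesis using 0[of "x + h n *\<^sub>R axis j 1"] 0[of x] False by simp
      qed
    qed
  qed measurable
  thus ?thesis unfolding q0 by (simp add: LIMSEQ_const_iff)
qed

section \<open>Weak derivatives\<close>

lemma test_function_continuous: "test_function \<psi> \<Longrightarrow> continuous_on UNIV \<psi>"
  unfolding test_function_def smooth_on_def by (metis Ck_on.simps(1))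

lemma test_function_differentiable: "test_function \<psi> \<Longrightarrow> \<psi> differentiable (at x)"
  unfolding test_function_def smooth_on_def by (metis Ck_on.simps(2) UNIV_I)

lemma test_function_support:
  assumes "test_function \<psi>" obtains R where "\<And>x. R < norm x \<Longrightarrow> \<psi> x = 0"
proof -
  have "bounded {x. \<psi> x \<noteq> 0}" using assms
    by (simp add: test_function_def)
  then obtain R where "\<forall>x\<in>{x. \<psi> x \<noteq> 0}. norm x \<le> R" unfolding bounded_iff by blast
  hence "\<psi> x = 0" if "R < norm x" for x using that by force
  thus ?thesis using that by blast
qed

lemma test_function_partial:
  assumes "test_function \<psi>" shows "test_function (partial j \<psi>)"
  unfolding test_function_def
proof
  have "Ck_on (Suc k) UNIV \<psi>" for k using assms by (simp add: test_function_def smooth_on_def)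
  moreover have "axis j (1 :: real) \<in> Basis" by (simp add: axis_in_Basis_iff)
  ultimately have "Ck_on k UNIV (\<lambda>x. frechet_derivative \<psi> (at x) (axis j 1))" for k
    unfolding Ck_on.simps(2) by blast
  thus "smooth_on UNIV (partial j \<psi>)" by (simp add: smooth_on_def partial_def[abs_def])
  have "partial j \<psi> x = 0" if x: "x \<notin> closure {x. \<psi> x \<noteq> 0}" for x
  proof -
    have "((\<lambda>_. 0 :: real) has_derivative (\<lambda>_. 0)) (at x)" by simp
    hence "(\<psi> has_derivative (\<lambda>_. 0)) (at x)"
    proof (rule has_derivative_transform_within_open)
      show "open (- closure {x. \<psi> x \<noteq> 0})" by (rule open_Compl[OF closed_closure])
      show "x \<in> - closure {x. \<psi> x \<noteq> 0}" using x by simp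
      show "0 = \<psi> y" if "y \<in> - closure {x. \<psi> x \<noteq> 0}" for y
        using that closure_subset[of "{x. \<psi> x \<noteq> 0}"] by auto
    qed
    from fun_cong[OF frechet_derivative_at[OF this], of "axis j 1"] show ?thesis
      by (simp add: partial_def)
  qed
  hence "{x. partial j \<psi> x \<noteq> 0} \<subseteq> closure {x. \<psi> x \<noteq> 0}" by blast
  hence "closure {x. partial j \<psi> x \<noteq> 0} \<subseteq> closure {x. \<psi> x \<noteq> 0}"
    by (rule closure_minimal) simp
  moreover have "compact (closure {x. \<psi> x \<noteq> 0})" using assms by (simp add: test_function_def)
  ultimately show "compact (closure {x. partial j \<psi> x \<noteq> 0})"
    by (metis closed_closure compact_Int_closed inf.absorb_iff2)
qed

lemma test_function_iter_partial: "test_function \<psi> \<Longrightarrow> test_function (iter_partial js \<psi>)"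
  by (induction js) (auto simp: iter_partial_def test_function_partial)

lemma integrable_mult_test_function:
  assumes "locally_integrable f" "test_function \<psi>"
  shows "integrable lborel (\<lambda>x. f x * \<psi> x)"
proof -
  obtain R where "\<And>x. R < norm x \<Longrightarrow> \<psi> x = 0" using test_function_support[OF assms(2)] by blast
  thus ?thesis
    using integrable_locally_integrable_mult[OF assms(1) test_function_continuous[OF assms(2)]] by blast
qed

text \<open>This makes the arbitrary choice in \<^const>\<open>weak_partial\<close> harmless.\<close>

lemma weak_partial_unique:
  assumes "has_weak_partial js f g1" "has_weak_partial js f g2"
    and "locally_integrable g1" "locally_integrable g2"
  shows "AE x in lborel. g1 x = g2 x"
proof -
  have "AE x in lborel. g1 x - g2 x = 0"
  proof (rule fundamental_lemma)
    show "locally_integrable (\<lambda>x. g1 x - g2 x)" using assms by (intro locally_integrable_diff)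
    fix \<psi> assume t: "test_function \<psi>"
    have "(- 1) ^ length js * (LINT x|lborel. g1 x * \<psi> x) = (- 1) ^ length js * (LINT x|lborel. g2 x * \<psi> x)"
      using assms(1,2) t unfolding has_weak_partial_def by metis
    hence "(LINT x|lborel. g1 x * \<psi> x) = (LINT x|lborel. g2 x * \<psi> x)"
      by (simp add: power_eq_0_iff)
    thus "(LINT x|lborel. (g1 x - g2 x) * \<psi> x) = 0"
      using assms(3,4) t by (simp add: left_diff_distrib integrable_mult_test_function)
  qed
  thus ?thesis by simp
qed

lemma has_weak_partial_diff:
  assumes "has_weak_partial js f1 g1" "has_weak_partial js f2 g2"
    and "locally_integrable f1" "locally_integrable f2" "locally_integrable g1" "locally_integrable g2"
  shows "has_weak_partial js (\<lambda>x. f1 x - f2 x) (\<lambda>x. g1 x - g2 x)"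
  using assms
  by (simp add: has_weak_partial_def left_diff_distrib right_diff_distrib integrable_mult_test_function test_function_iter_partial)

lemma square_integrable_diff:
  fixes f g :: "space \<Rightarrow> real"
  assumes "square_integrable f" "square_integrable g"
  shows "square_integrable (\<lambda>x. f x - g x)"
proof -
  have [measurable]: "f \<in> borel_measurable borel" "g \<in> borel_measurable borel"
    and i: "integrable lborel (\<lambda>x. 2 * (f x)\<^sup>2 + 2 * (g x)\<^sup>2)"
    using assms by (auto simp: square_integrable_def)
  have "(s - t)\<^sup>2 \<le> 2 * s\<^sup>2 + 2 * t\<^sup>2" for s t :: real
    using zero_le_power2[of "s + t"] by (simp add: power2_diff power2_sum)
  hence "integrable lborel (\<lambda>x. (f x - g x)\<^sup>2)"
    by (intro Bochner_Integration.integrable_bound[OF i]) auto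
  thus ?thesis by (simp add: square_integrable_def)
qed

lemma weak_partial_sobolev:
  assumes "sobolev k f" "length js \<le> k"
  shows "square_integrable (weak_partial js f)" "has_weak_partial js f (weak_partial js f)"
proof -
  have "\<exists>g. square_integrable g \<and> has_weak_partial js f g" using assms by (auto simp: sobolev_def)
  from someI_ex[OF this] show "square_integrable (weak_partial js f)" "has_weak_partial js f (weak_partial js f)"
    by (auto simp: weak_partial_def)
qed

lemma sobolev_square_integrable: "sobolev k f \<Longrightarrow> square_integrable f"
  by (simp add: sobolev_def)

lemma sobolev_diff:
  assumes "sobolev k f" "sobolev k g" shows "sobolev k (\<lambda>x. f x - g x)"
  unfolding sobolev_def
proof (intro conjI allI impI)
  show "square_integrable (\<lambda>x. f x - g x)" using assms by (simp add: sobolev_def square_integrable_diff)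
  fix js :: "3 list" assume l: "length js \<le> k"
  note f = weak_partial_sobolev[OF assms(1) l] and g = weak_partial_sobolev[OF assms(2) l]
  have "has_weak_partial js (\<lambda>x. f x - g x) (\<lambda>x. weak_partial js f x - weak_partial js g x)"
    using assms f g by (intro has_weak_partial_diff) (auto intro: locally_integrable_square_integrable simp: sobolev_def)
  thus "\<exists>h. square_integrable h \<and> has_weak_partial js (\<lambda>x. f x - g x) h"
    using square_integrable_diff[OF f(1) g(1)] by blast
qed

lemma weak_partial_diff:
  assumes "sobolev k f" "sobolev k g" and l: "length js \<le> k"
  shows "AE x in lborel. weak_partial js (\<lambda>x. f x - g x) x = weak_partial js f x - weak_partial js g x"
proof (rule weak_partial_unique)
  note f = weak_partial_sobolev[OF assms(1) l] and g = weak_partial_sobolev[OF assms(2) l]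
    and d = weak_partial_sobolev[OF sobolev_diff[OF assms(1,2)] l]
  show "has_weak_partial js (\<lambda>x. f x - g x) (\<lambda>x. weak_partial js f x - weak_partial js g x)"
    using assms f g by (intro has_weak_partial_diff) (auto intro: locally_integrable_square_integrable simp: sobolev_def)
  show "has_weak_partial js (\<lambda>x. f x - g x) (weak_partial js (\<lambda>x. f x - g x))" by (rule d)
  show "locally_integrable (weak_partial js (\<lambda>x. f x - g x))"
    "locally_integrable (\<lambda>x. weak_partial js f x - weak_partial js g x)"
    using f(1) g(1) d(1) by (auto intro: locally_integrable_square_integrable square_integrable_diff)
qed

lemma weak_partial_Nil:
  assumes "sobolev k f" shows "AE x in lborel. weak_partial [] f x = f x"
proof (rule weak_partial_unique)
  show "has_weak_partial [] f (weak_partial [] f)" by (rule weak_partial_sobolev[OF assms]) simp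
  show "has_weak_partial [] f f" by (simp add: has_weak_partial_def iter_partial_def)
  show "locally_integrable (weak_partial [] f)"
    by (intro locally_integrable_square_integrable weak_partial_sobolev(1)[OF assms]) simp
  show "locally_integrable f" using assms by (simp add: sobolev_def locally_integrable_square_integrable)
qed

text \<open>Squares of norms are used throughout in place of norms: the inequality
  \<open>s\<^sup>2 \<le> 2 (s - t)\<^sup>2 + 2 t\<^sup>2\<close> then plays the role of the triangle inequality.\<close>

definition weak_energy :: "3 list \<Rightarrow> (space \<Rightarrow> real) \<Rightarrow> real" where
  "weak_energy js f = (LINT x|lborel. (weak_partial js f x)\<^sup>2)"

lemma weak_energy_le_sobolev_norm:
  assumes "length js \<le> k" shows "weak_energy js f \<le> (sobolev_norm k f)\<^sup>2"
proof -
  have l2: "weak_energy js f = (l2_norm (weak_partial js f))\<^sup>2"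
    by (simp add: weak_energy_def l2_norm_def)
  have fin: "finite {js :: 3 list. length js \<le> k}"
    using finite_lists_length_le[of "UNIV :: 3 set" k] by simp
  have "(l2_norm (weak_partial js f))\<^sup>2 \<le> (\<Sum>js | length js \<le> k. (l2_norm (weak_partial js f))\<^sup>2)"
    by (rule member_le_sum) (use assms fin in auto)
  also have "\<dots> = (sobolev_norm k f)\<^sup>2"
    by (simp add: sobolev_norm_def sum_nonneg)
  finally show ?thesis by (simp add: l2)
qed

lemma weak_energy_Nil: "sobolev k f \<Longrightarrow> weak_energy [] f = (LINT x|lborel. (f x)\<^sup>2)"
proof -
  assume s: "sobolev k f"
  have [measurable]: "f \<in> borel_measurable borel" "weak_partial [] f \<in> borel_measurable borel"
    using sobolev_square_integrable[OF s] weak_partial_sobolev(1)[OF s, of "[]"] by (auto simp: square_integrable_def)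
  show ?thesis unfolding weak_energy_def
    by (intro integral_cong_AE) (use weak_partial_Nil[OF s] in \<open>auto elim: eventually_mono\<close>)
qed

lemma weak_energy_triangle:
  assumes f: "sobolev k f" and g: "sobolev k g" and l: "length js \<le> k"
  shows "weak_energy js f \<le> 2 * (sobolev_norm k (\<lambda>x. f x - g x))\<^sup>2 + 2 * weak_energy js g"
proof -
  let ?d = "\<lambda>x. f x - g x"
  have i: "integrable lborel (\<lambda>x. (weak_partial js h x)\<^sup>2)" if "sobolev k h" for h
    using weak_partial_sobolev(1)[OF that l] by (simp add: square_integrable_def)
  note d = sobolev_diff[OF f g]
  have "weak_energy js f \<le> (LINT x|lborel. 2 * (weak_partial js ?d x)\<^sup>2 + 2 * (weak_partial js g x)\<^sup>2)"
    unfolding weak_energy_def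
  proof (rule integral_mono_AE)
    show "integrable lborel (\<lambda>x. 2 * (weak_partial js ?d x)\<^sup>2 + 2 * (weak_partial js g x)\<^sup>2)"
      using i[OF d] i[OF g] by simp
    have *: "s\<^sup>2 \<le> 2 * (s - t)\<^sup>2 + 2 * t\<^sup>2" for s t :: real
      using zero_le_power2[of "s - 2 * t"] by (simp add: power2_diff power_mult_distrib)
    show "AE x in lborel. (weak_partial js f x)\<^sup>2 \<le> 2 * (weak_partial js ?d x)\<^sup>2 + 2 * (weak_partial js g x)\<^sup>2"
      by (rule AE_mp[OF weak_partial_diff[OF f g l]]) (auto intro!: AE_I2 *)
  qed (rule i[OF f])
  also have "\<dots> = 2 * weak_energy js ?d + 2 * weak_energy js g"
    using i[OF d] i[OF g] by (simp add: weak_energy_def)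
  also have "\<dots> \<le> 2 * (sobolev_norm k ?d)\<^sup>2 + 2 * weak_energy js g"
    using weak_energy_le_sobolev_norm[OF l, of ?d] by simp
  finally show ?thesis .
qed

text \<open>For positive times the concentrations are smooth, and their classical derivatives inherit square
  integrability from membership in the Sobolev space.\<close>

lemma classical_partial_eq_weak:
  assumes f: "continuous_on UNIV f" and f': "continuous_on UNIV f'"
    and d: "\<And>x. has_partial j f (f' x) x" and s: "sobolev 1 f"
  shows "integrable lborel (\<lambda>x. (f' x)\<^sup>2)" "(LINT x|lborel. (f' x)\<^sup>2) = weak_energy [j] f"
proof -
  note w = weak_partial_sobolev[OF s, of "[j]", simplified]
  have m[measurable]: "f' \<in> borel_measurable borel" "weak_partial [j] f \<in> borel_measurable borel"
    using f' w by (auto intro: borel_measurable_continuous_onI simp: square_integrable_def)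
  have "has_weak_partial [j] f f'"
    unfolding has_weak_partial_def
  proof (intro allI impI)
    fix \<psi> assume t: "test_function \<psi>"
    obtain R where R: "\<And>x. R < norm x \<Longrightarrow> \<psi> x = 0" using test_function_support[OF t] by blast
    note c = test_function_continuous[OF t] test_function_continuous[OF test_function_partial[OF t]]
    have "(LINT x|lborel. f' x * \<psi> x + partial j \<psi> x * f x) = 0"
      by (rule integral_has_partial_eq_0[of "\<lambda>x. f x * \<psi> x" _ j R])
         (auto intro!: continuous_intros f f' c has_partial_mult d has_partial_partial test_function_differentiable t R)
    moreover have "integrable lborel (\<lambda>x. f' x * \<psi> x)" "integrable lborel (\<lambda>x. f x * partial j \<psi> x)"
      using f f' t by (auto intro!: integrable_mult_test_function locally_integrable_continuous test_function_partial)
    ultimately show "(LINT x|lborel. f x * iter_partial [j] \<psi> x) = (- 1) ^ length [j] * (LINT x|lborel. f' x * \<psi> x)"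
      by (simp add: iter_partial_def mult.commute[of "partial j \<psi> _"])
  qed
  hence ae: "AE x in lborel. f' x = weak_partial [j] f x"
    using w by (intro weak_partial_unique[of "[j]" f]) (auto intro: locally_integrable_continuous f' locally_integrable_square_integrable)
  have "integrable lborel (\<lambda>x. (weak_partial [j] f x)\<^sup>2)" using w by (simp add: square_integrable_def)
  thus "integrable lborel (\<lambda>x. (f' x)\<^sup>2)"
    by (rule integrable_cong_AE_imp) (use ae in \<open>auto elim: eventually_mono\<close>)
  show "(LINT x|lborel. (f' x)\<^sup>2) = weak_energy [j] f"
    unfolding weak_energy_def by (rule integral_cong_AE) (use ae in \<open>auto elim: eventually_mono\<close>)
qed

section \<open>Functions of time and space\<close>

text \<open>Continuity is required at positive times only, where the solution is smooth; at time zero the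
  solution is controlled in integral norms alone.\<close>

definition jcont :: "(real \<Rightarrow> space \<Rightarrow> 'b::topological_space) \<Rightarrow> bool" where
  "jcont f \<longleftrightarrow> continuous_on ({0<..} \<times> UNIV) (\<lambda>p. f (fst p) (snd p))"

named_theorems jcont_intros

lemma jcont_space: "continuous_on UNIV \<psi> \<Longrightarrow> jcont (\<lambda>t x. \<psi> x)"
  unfolding jcont_def by (rule continuous_on_compose2[of UNIV \<psi>]) (auto intro!: continuous_intros)

lemma jcont_const [jcont_intros]: "jcont (\<lambda>t x. k)"
  unfolding jcont_def by (intro continuous_intros)

lemma jcont_compose: "continuous_on UNIV \<beta> \<Longrightarrow> jcont f \<Longrightarrow> jcont (\<lambda>t x. \<beta> (f t x))"
  unfolding jcont_def by (rule continuous_on_compose2[of UNIV \<beta>]) auto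

lemma jcont_arith [jcont_intros]:
  fixes f g :: "real \<Rightarrow> space \<Rightarrow> real"
  assumes "jcont f" "jcont g"
  shows "jcont (\<lambda>t x. f t x * g t x)" "jcont (\<lambda>t x. f t x + g t x)" "jcont (\<lambda>t x. f t x - g t x)"
  using assms unfolding jcont_def by (auto intro!: continuous_intros)

lemma jcont_unary [jcont_intros]:
  fixes f :: "real \<Rightarrow> space \<Rightarrow> real"
  assumes "jcont f"
  shows "jcont (\<lambda>t x. - f t x)" "jcont (\<lambda>t x. \<bar>f t x\<bar>)" "jcont (\<lambda>t x. (f t x) ^ n)"
  using assms unfolding jcont_def by (auto intro!: continuous_intros)

lemma jcont_sum [jcont_intros]:
  fixes f :: "'i \<Rightarrow> real \<Rightarrow> space \<Rightarrow> real"
  shows "(\<And>i. i \<in> I \<Longrightarrow> jcont (f i)) \<Longrightarrow> jcont (\<lambda>t x. \<Sum>i\<in>I. f i t x)"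
  unfolding jcont_def by (auto intro!: continuous_intros)

lemma jcont_vec [jcont_intros]: "jcont (V :: real \<Rightarrow> space \<Rightarrow> space) \<Longrightarrow> jcont (\<lambda>t x. V t x $ j)"
  unfolding jcont_def by (auto intro!: continuous_intros)

lemma jcont_slice:
  assumes "jcont f" "0 < t" shows "continuous_on UNIV (f t)"
proof -
  have "continuous_on UNIV ((\<lambda>p. f (fst p) (snd p)) \<circ> Pair t)"
    using assms unfolding jcont_def
    by (intro continuous_on_compose continuous_intros) (auto elim!: continuous_on_subset)
  thus ?thesis by (simp add: o_def)
qed

lemma jcont_integrable:
  fixes f :: "real \<Rightarrow> space \<Rightarrow> real"
  assumes "jcont f" "0 < t" "\<And>x. R < norm x \<Longrightarrow> f t x = 0"
  shows "integrable lborel (f t)"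
  using integrable_continuous_compact_support[OF jcont_slice[OF assms(1,2)] assms(3)] .

lemma integral_lborel_eq_integral_cbox:
  fixes f :: "space \<Rightarrow> real"
  assumes f: "continuous_on UNIV f" and 0: "\<And>x. R < norm x \<Longrightarrow> f x = 0" and R: "cball 0 R \<subseteq> cbox a b"
  shows "(LINT x|lborel. f x) = integral (cbox a b) f"
proof -
  have "(LINT x|lborel. f x) = integral UNIV f"
    using integral_lborel[OF integrable_continuous_compact_support[OF f 0]] by simp
  also have "integral UNIV f = integral UNIV (\<lambda>x. if x \<in> cbox a b then f x else 0)"
  proof (rule integral_cong)
    fix x show "f x = (if x \<in> cbox a b then f x else 0)"
    proof (cases "x \<in> cbox a b")
      case False
      hence "x \<notin> cball 0 R" using R by blast
      thus ?thesis using 0[of x] by simp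
    qed simp
  qed
  also have "\<dots> = integral (cbox a b) f" by (rule integral_restrict_UNIV)
  finally show ?thesis .
qed

lemma cball_subset_cbox_ex: "\<exists>a b. cball (0 :: space) R \<subseteq> cbox a b"
  using bounded_subset_cbox_symmetric[OF bounded_cball[of "0 :: space" R]] by blast

lemma jcont_integral_continuous:
  fixes f :: "real \<Rightarrow> space \<Rightarrow> real"
  assumes f: "jcont f" and 0: "\<And>t x. 0 < t \<Longrightarrow> R < norm x \<Longrightarrow> f t x = 0"
  shows "continuous_on {0<..} (\<lambda>t. LINT x|lborel. f t x)"
proof -
  obtain a b :: space where ab: "cball 0 R \<subseteq> cbox a b" using cball_subset_cbox_ex by blast
  have "continuous_on {0<..} (\<lambda>t. integral (cbox a b) (f t))"
    by (rule integral_continuous_on_param)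
       (use f in \<open>auto simp: jcont_def split_beta elim!: continuous_on_subset\<close>)
  moreover have "(LINT x|lborel. f t x) = integral (cbox a b) (f t)" if "0 < t" for t
    using integral_lborel_eq_integral_cbox[OF jcont_slice[OF f that] 0[OF that] ab] .
  ultimately show ?thesis by (subst continuous_on_cong[OF refl, of _ _ "\<lambda>t. integral (cbox a b) (f t)"]) auto
qed

lemma integral_time_derivative:
  fixes f g :: "real \<Rightarrow> space \<Rightarrow> real"
  assumes f: "jcont f" and g: "jcont g"
    and d: "\<And>t x. 0 < t \<Longrightarrow> ((\<lambda>s. f s x) has_real_derivative g t x) (at t)"
    and 0: "\<And>t x. 0 < t \<Longrightarrow> R < norm x \<Longrightarrow> f t x = 0" "\<And>t x. 0 < t \<Longrightarrow> R < norm x \<Longrightarrow> g t x = 0"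
    and t: "0 < t"
  shows "((\<lambda>t. LINT x|lborel. f t x) has_real_derivative (LINT x|lborel. g t x)) (at t)"
proof -
  obtain a b :: space where ab: "cball 0 R \<subseteq> cbox a b" using cball_subset_cbox_ex by blast
  have ef: "(LINT x|lborel. f t x) = integral (cbox a b) (f t)" if "0 < t" for t
    using integral_lborel_eq_integral_cbox[OF jcont_slice[OF f that] 0(1)[OF that] ab] .
  have eg: "(LINT x|lborel. g t x) = integral (cbox a b) (g t)" if "0 < t" for t
    using integral_lborel_eq_integral_cbox[OF jcont_slice[OF g that] 0(2)[OF that] ab] .
  have "((\<lambda>t. integral (cbox a b) (f t)) has_real_derivative integral (cbox a b) (g t)) (at t within {0<..})"
  proof (rule leibniz_rule_field_derivative)
    show "((\<lambda>s. f s x) has_real_derivative g s x) (at s within {0<..})" if "s \<in> {0<..}" for s x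
      using d that by (auto intro: has_field_derivative_at_within)
    show "f s integrable_on cbox a b" if "s \<in> {0<..}" for s
      using jcont_slice[OF f] that by (auto intro: integrable_continuous continuous_on_subset)
    show "continuous_on ({0<..} \<times> cbox a b) (\<lambda>(t, x). g t x)"
      using g by (auto simp: jcont_def split_beta elim!: continuous_on_subset)
  qed (use t in auto)
  hence "((\<lambda>t. integral (cbox a b) (f t)) has_real_derivative integral (cbox a b) (g t)) (at t)"
    using t at_within_open[of t "{0<..}"] by simp
  thus ?thesis unfolding eg[OF t]
    by (rule has_field_derivative_transform_within_open[where S = "{0<..}"]) (use t ef in auto)
qed

lemma smooth_on_imp_differentiable: "smooth_on S f \<Longrightarrow> p \<in> S \<Longrightarrow> f differentiable (at p)"
  unfolding smooth_on_def by (metis Ck_on.simps(2))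

lemma smooth_on_imp_continuous: "smooth_on S f \<Longrightarrow> continuous_on S f"
  unfolding smooth_on_def by (metis Ck_on.simps(1))

lemma smooth_on_frechet: "smooth_on S f \<Longrightarrow> b \<in> Basis \<Longrightarrow> smooth_on S (\<lambda>p. frechet_derivative f (at p) b)"
  unfolding smooth_on_def by (metis Ck_on.simps(2))

abbreviation spacetime :: "(real \<times> space) set" where "spacetime \<equiv> {0<..} \<times> UNIV"

text \<open>Derivatives along one space direction and along time, read off the Frechet derivative in
  space-time, which is what smoothness provides.\<close>

definition sp_deriv :: "3 \<Rightarrow> (real \<times> space \<Rightarrow> 'b::real_normed_vector) \<Rightarrow> real \<times> space \<Rightarrow> 'b" where
  "sp_deriv j F p = frechet_derivative F (at p) (0, axis j 1)"

definition tm_deriv :: "(real \<times> space \<Rightarrow> real) \<Rightarrow> real \<times> space \<Rightarrow> real" where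
  "tm_deriv F p = frechet_derivative F (at p) (1, 0)"

lemma smooth_sp_deriv: "smooth_on S F \<Longrightarrow> smooth_on S (sp_deriv j F)"
  unfolding sp_deriv_def[abs_def] by (rule smooth_on_frechet) (auto simp: Basis_prod_def axis_in_Basis_iff)

lemma smooth_tm_deriv: "smooth_on S F \<Longrightarrow> smooth_on S (tm_deriv F)"
  unfolding tm_deriv_def[abs_def] by (rule smooth_on_frechet) (auto simp: Basis_prod_def)

lemma jcont_smooth: "smooth_on spacetime F \<Longrightarrow> jcont (\<lambda>t x. F (t, x))"
  unfolding jcont_def by (auto dest: smooth_on_imp_continuous)

lemma has_derivative_slice:
  assumes "smooth_on spacetime F" "0 < t"
  shows "((\<lambda>x. F (t, x)) has_derivative (\<lambda>h. frechet_derivative F (at (t, x)) (0, h))) (at x)"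
proof -
  have "(F has_derivative frechet_derivative F (at (t, x))) (at (t, x))"
    using smooth_on_imp_differentiable[OF assms(1), of "(t, x)"] assms(2) by (simp add: frechet_derivative_works)
  moreover have "(Pair t has_derivative (\<lambda>h. (0, h))) (at x)"
    by (auto intro!: derivative_eq_intros)
  ultimately show ?thesis using has_derivative_compose[of "Pair t" _ x UNIV F] by simp
qed

lemma has_partial_slice:
  assumes "smooth_on spacetime F" "0 < t"
  shows "has_partial j (\<lambda>x. F (t, x)) (sp_deriv j F (t, x)) x"
  using has_derivative_imp_has_partial[OF has_derivative_slice[OF assms]] by (simp add: sp_deriv_def)

lemma partial_slice:
  assumes "smooth_on spacetime F" "0 < t"
  shows "partial j (\<lambda>x. F (t, x)) = (\<lambda>x. sp_deriv j F (t, x))"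
proof
  fix x
  have "(\<lambda>x. F (t, x)) differentiable (at x)" using has_derivative_slice[OF assms] by (rule differentiableI)
  from has_partial_unique[OF has_partial_partial[OF this] has_partial_slice[OF assms]]
  show "partial j (\<lambda>x. F (t, x)) x = sp_deriv j F (t, x)" .
qed

lemma has_partial_slice_vec:
  fixes F :: "real \<times> space \<Rightarrow> space"
  assumes "smooth_on spacetime F" "0 < t"
  shows "has_partial j (\<lambda>x. F (t, x) $ k) (sp_deriv j F (t, x) $ k) x"
proof -
  have "((\<lambda>x. F (t, x) $ k) has_derivative (\<lambda>h. frechet_derivative F (at (t, x)) (0, h) $ k)) (at x)"
    by (rule bounded_linear.has_derivative[OF bounded_linear_vec_nth has_derivative_slice[OF assms]])
  from has_derivative_imp_has_partial[OF this] show ?thesis by (simp add: sp_deriv_def)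
qed

lemma partial_slice_vec:
  fixes F :: "real \<times> space \<Rightarrow> space"
  assumes "smooth_on spacetime F" "0 < t"
  shows "partial j (\<lambda>x. F (t, x) $ k) x = sp_deriv j F (t, x) $ k"
proof -
  have "((\<lambda>x. F (t, x) $ k) has_derivative (\<lambda>h. frechet_derivative F (at (t, x)) (0, h) $ k)) (at x)"
    by (rule bounded_linear.has_derivative[OF bounded_linear_vec_nth has_derivative_slice[OF assms]])
  hence "(\<lambda>x. F (t, x) $ k) differentiable (at x)" by (rule differentiableI)
  from has_partial_unique[OF has_partial_partial[OF this] has_partial_slice_vec[OF assms]] show ?thesis .
qed

lemma has_tm_deriv:
  assumes "smooth_on spacetime F" "0 < t"
  shows "((\<lambda>s. F (s, x)) has_real_derivative tm_deriv F (t, x)) (at t)"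
proof -
  have F: "(F has_derivative frechet_derivative F (at (t, x))) (at (t, x))"
    using smooth_on_imp_differentiable[OF assms(1), of "(t, x)"] assms(2) by (simp add: frechet_derivative_works)
  have "((\<lambda>s. (s, x)) has_derivative (\<lambda>h. (h, 0))) (at t)"
    by (auto intro!: derivative_eq_intros)
  from has_derivative_compose[OF this, of F] F
  have "((\<lambda>s. F (s, x)) has_derivative (\<lambda>h. frechet_derivative F (at (t, x)) (h, 0))) (at t)"
    by simp
  moreover have "(\<lambda>h. frechet_derivative F (at (t, x)) (h, 0)) = (*) (tm_deriv F (t, x))"
  proof
    fix h
    have "frechet_derivative F (at (t, x)) (h *\<^sub>R (1, 0)) = h *\<^sub>R frechet_derivative F (at (t, x)) (1, 0)"
      by (rule linear_scale[OF has_derivative_linear[OF F]])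
    thus "frechet_derivative F (at (t, x)) (h, 0) = tm_deriv F (t, x) * h" by (simp add: tm_deriv_def)
  qed
  ultimately show ?thesis by (simp add: has_field_derivative_def)
qed

section \<open>The weighted balance law\<close>

locale weight =
  fixes \<psi> :: "space \<Rightarrow> real" and d\<psi> dd\<psi> :: "3 \<Rightarrow> space \<Rightarrow> real" and R :: real
  assumes weight_cont: "continuous_on UNIV \<psi>" "\<And>j. continuous_on UNIV (d\<psi> j)" "\<And>j. continuous_on UNIV (dd\<psi> j)"
    and weight_partial: "\<And>j x. has_partial j \<psi> (d\<psi> j x) x" "\<And>j x. has_partial j (d\<psi> j) (dd\<psi> j x) x"
    and weight_support: "\<And>x. R < norm x \<Longrightarrow> \<psi> x = 0" "\<And>j x. R < norm x \<Longrightarrow> d\<psi> j x = 0"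
      "\<And>j x. R < norm x \<Longrightarrow> dd\<psi> j x = 0"

text \<open>The equation \<open>\<partial>\<^sub>t c = div (D \<nabla>c + c V)\<close> for a prescribed drift \<open>V\<close>. It is linear in \<open>c\<close>, so that solutions with
  the same drift can be added.\<close>

locale drift_diffusion =
  fixes D :: real and c ct :: "real \<Rightarrow> space \<Rightarrow> real" and dc ddc :: "3 \<Rightarrow> real \<Rightarrow> space \<Rightarrow> real"
    and V :: "real \<Rightarrow> space \<Rightarrow> space" and dV :: "3 \<Rightarrow> real \<Rightarrow> space \<Rightarrow> real"
  assumes cont: "jcont c" "jcont ct" "\<And>j. jcont (dc j)" "\<And>j. jcont (ddc j)" "jcont V" "\<And>j. jcont (dV j)"
    and time_deriv: "\<And>t x. 0 < t \<Longrightarrow> ((\<lambda>s. c s x) has_real_derivative ct t x) (at t)"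
    and space_deriv: "\<And>j t x. 0 < t \<Longrightarrow> has_partial j (c t) (dc j t x) x"
      "\<And>j t x. 0 < t \<Longrightarrow> has_partial j (dc j t) (ddc j t x) x"
      "\<And>j t x. 0 < t \<Longrightarrow> has_partial j (\<lambda>y. V t y $ j) (dV j t x) x"
    and equation: "\<And>t x. 0 < t \<Longrightarrow>
      ct t x = (\<Sum>j\<in>UNIV. D * ddc j t x + V t x $ j * dc j t x + c t x * dV j t x)"

locale weighted_drift_diffusion = drift_diffusion + weight +
  fixes \<beta> \<beta>1 \<beta>2 :: "real \<Rightarrow> real"
  assumes \<beta>: "\<And>s. (\<beta> has_real_derivative \<beta>1 s) (at s)" "\<And>s. (\<beta>1 has_real_derivative \<beta>2 s) (at s)"
    "continuous_on UNIV \<beta>2"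
begin

lemma \<beta>_cont: "continuous_on UNIV \<beta>" "continuous_on UNIV \<beta>1"
  by (rule continuous_at_imp_continuous_on, use \<beta>(1,2) DERIV_isCont in blast)+

lemmas conts = \<beta>_cont[THEN jcont_compose] \<beta>(3)[THEN jcont_compose] cont weight_cont[THEN jcont_space]

definition transport :: "real \<Rightarrow> space \<Rightarrow> real" where
  "transport t x = \<beta> (c t x) * (\<Sum>j\<in>UNIV. D * dd\<psi> j x - V t x $ j * d\<psi> j x)"

definition dissipation :: "real \<Rightarrow> space \<Rightarrow> real" where
  "dissipation t x = D * (\<beta>2 (c t x) * (\<Sum>j\<in>UNIV. (dc j t x)\<^sup>2)) * \<psi> x"

definition compression :: "real \<Rightarrow> space \<Rightarrow> real" where
  "compression t x = (c t x * \<beta>1 (c t x) - \<beta> (c t x)) * (\<Sum>j\<in>UNIV. dV j t x) * \<psi> x"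

lemma jcont_terms: "jcont transport" "jcont dissipation" "jcont compression"
  unfolding transport_def[abs_def] dissipation_def[abs_def] compression_def[abs_def]
  by (intro jcont_intros conts)+

lemma support_terms:
  assumes "R < norm x"
  shows "transport t x = 0" "dissipation t x = 0" "compression t x = 0"
  using assms by (simp_all add: transport_def dissipation_def compression_def weight_support)

lemma integrable_terms:
  assumes "0 < t"
  shows "integrable lborel (transport t)" "integrable lborel (dissipation t)" "integrable lborel (compression t)"
  using jcont_terms support_terms assms by (blast intro: jcont_integrable)+

text \<open>Testing the equation with \<open>\<beta>'(c) \<psi>\<close>. The left hand side differs from the three terms on the right
  by the divergence of a field of compact support, whose components are called \<open>W\<close> in the proof.\<close>

theorem balance:
  assumes t: "0 < t"
  shows "((\<lambda>t. LINT x|lborel. \<beta> (c t x) * \<psi> x) has_real_derivative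
     (LINT x|lborel. transport t x) - (LINT x|lborel. dissipation t x) + (LINT x|lborel. compression t x)) (at t)"
proof -
  let ?g = "\<lambda>t x. \<beta>1 (c t x) * ct t x * \<psi> x"
  have jg: "jcont ?g" by (intro jcont_intros conts)
  have 1: "((\<lambda>t. LINT x|lborel. \<beta> (c t x) * \<psi> x) has_real_derivative (LINT x|lborel. ?g t x)) (at t)"
  proof (rule integral_time_derivative[where R = R])
    show "jcont (\<lambda>t x. \<beta> (c t x) * \<psi> x)" by (intro jcont_intros conts)
    show "((\<lambda>s. \<beta> (c s x) * \<psi> x) has_real_derivative ?g t x) (at t)" if "0 < t" for t x
      using DERIV_cmult_right[OF DERIV_chain2[OF \<beta>(1) time_deriv[OF that]]] .
  qed (use t jg weight_support in auto)
  \<comment> \<open>The components of the field that accounts for the integration by parts.\<close>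
  define W where "W j x = D * (\<psi> x * (\<beta>1 (c t x) * dc j t x) - \<beta> (c t x) * d\<psi> j x)
      + \<beta> (c t x) * (V t x $ j * \<psi> x)" for j x
  define W' where "W' j x = D * (d\<psi> j x * (\<beta>1 (c t x) * dc j t x)
        + (\<beta>2 (c t x) * dc j t x * dc j t x + ddc j t x * \<beta>1 (c t x)) * \<psi> x
        - (\<beta>1 (c t x) * dc j t x * d\<psi> j x + dd\<psi> j x * \<beta> (c t x)))
      + (\<beta>1 (c t x) * dc j t x * (V t x $ j * \<psi> x) + (dV j t x * \<psi> x + d\<psi> j x * V t x $ j) * \<beta> (c t x))" for j x
  have cW: "continuous_on UNIV (W j)" "continuous_on UNIV (W' j)" for j
    unfolding W_def[abs_def] W'_def[abs_def]
    by (rule jcont_slice[OF _ t, of "\<lambda>t x. D * (\<psi> x * (\<beta>1 (c t x) * dc j t x) - \<beta> (c t x) * d\<psi> j x)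
      + \<beta> (c t x) * (V t x $ j * \<psi> x)"], intro jcont_intros conts)
       (rule jcont_slice[OF _ t, of "\<lambda>t x. D * (d\<psi> j x * (\<beta>1 (c t x) * dc j t x)
        + (\<beta>2 (c t x) * dc j t x * dc j t x + ddc j t x * \<beta>1 (c t x)) * \<psi> x
        - (\<beta>1 (c t x) * dc j t x * d\<psi> j x + dd\<psi> j x * \<beta> (c t x)))
      + (\<beta>1 (c t x) * dc j t x * (V t x $ j * \<psi> x) + (dV j t x * \<psi> x + d\<psi> j x * V t x $ j) * \<beta> (c t x))"],
        intro jcont_intros conts)
  have dW: "has_partial j (W j) (W' j x) x" for j x
    unfolding W_def[abs_def] W'_def
    by (intro has_partial_add has_partial_cmult has_partial_diff has_partial_mult has_partial_compose[OF \<beta>(1)]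
        has_partial_compose[OF \<beta>(2)] space_deriv weight_partial t)
  have W0: "(LINT x|lborel. W' j x) = 0" for j
    by (rule integral_has_partial_eq_0[OF cW dW, where R = R]) (simp add: W_def weight_support)
  have iW: "integrable lborel (W' j)" for j
    by (rule integrable_continuous_compact_support[OF cW(2), where R = R]) (simp add: W'_def weight_support)
  have eq: "?g t x = (\<Sum>j\<in>UNIV. W' j x) + (transport t x - dissipation t x + compression t x)" for x
  proof -
    have "?g t x = (\<Sum>j\<in>UNIV. \<beta>1 (c t x) * (D * ddc j t x + V t x $ j * dc j t x + c t x * dV j t x) * \<psi> x)"
      by (simp only: equation[OF t] sum_distrib_left sum_distrib_right)
    also have "\<dots> = (\<Sum>j\<in>UNIV. W' j x + (\<beta> (c t x) * (D * dd\<psi> j x - V t x $ j * d\<psi> j x)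
        - D * (\<beta>2 (c t x) * (dc j t x)\<^sup>2) * \<psi> x + (c t x * \<beta>1 (c t x) - \<beta> (c t x)) * dV j t x * \<psi> x))"
      by (rule sum.cong) (auto simp: W'_def algebra_simps power2_eq_square)
    also have "\<dots> = (\<Sum>j\<in>UNIV. W' j x) + (transport t x - dissipation t x + compression t x)"
      unfolding transport_def dissipation_def compression_def
      by (simp only: sum.distrib sum_subtractf sum_distrib_left sum_distrib_right right_diff_distrib)
    finally show ?thesis .
  qed
  have "(LINT x|lborel. ?g t x) = (\<Sum>j\<in>UNIV. LINT x|lborel. W' j x)
      + ((LINT x|lborel. transport t x) - (LINT x|lborel. dissipation t x) + (LINT x|lborel. compression t x))"
    unfolding eq using iW integrable_terms[OF t] by (simp add: Bochner_Integration.integral_sum)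
  with 1 show ?thesis by (simp add: W0)
qed

end

section \<open>Radial weights\<close>

lemma has_partial_inner_self: "has_partial j (\<lambda>x. x \<bullet> x) (2 * x $ j) x"
proof -
  have "((\<lambda>x :: space. x \<bullet> x) has_derivative (\<lambda>h. x \<bullet> h + h \<bullet> x)) (at x)"
    by (auto intro!: derivative_eq_intros)
  from has_derivative_imp_has_partial[OF this, of j] show ?thesis
    by (simp add: inner_axis inner_commute[of "axis j 1"])
qed

lemma has_partial_component: "has_partial j (\<lambda>x. x $ k) (if j = k then 1 else 0) x"
  using has_derivative_imp_has_partial[OF bounded_linear_imp_has_derivative[OF bounded_linear_vec_nth], of j k x]
  by (cases "j = k") (simp_all add: axis_def)

text \<open>Weights \<open>h (\<bar>x\<bar>\<^sup>2)\<close>. With \<open>s = \<bar>x\<bar>\<^sup>2\<close> the gradient has length \<open>2 \<bar>h'(s)\<bar> sqrt s\<close> and the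
  Laplacian is \<open>6 h'(s) + 4 s h''(s)\<close>; the number \<open>\<kappa>\<close> bounds both.\<close>

locale radial_weight =
  fixes h h1 h2 :: "real \<Rightarrow> real" and R \<kappa> :: real
  assumes radial_deriv: "\<And>s. 0 \<le> s \<Longrightarrow> (h has_real_derivative h1 s) (at s)"
      "\<And>s. 0 \<le> s \<Longrightarrow> (h1 has_real_derivative h2 s) (at s)"
    and radial_cont: "continuous_on {0..} h2"
    and radial_support: "\<And>s. R\<^sup>2 < s \<Longrightarrow> h s = 0" "\<And>s. R\<^sup>2 < s \<Longrightarrow> h1 s = 0" "\<And>s. R\<^sup>2 < s \<Longrightarrow> h2 s = 0"
    and radius: "0 \<le> R"
    and radial_grad: "\<And>s. 0 \<le> s \<Longrightarrow> 2 * \<bar>h1 s\<bar> * sqrt s \<le> \<kappa>"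
    and radial_lap: "\<And>s. 0 \<le> s \<Longrightarrow> \<bar>6 * h1 s + 4 * s * h2 s\<bar> \<le> \<kappa>"
begin

definition w :: "space \<Rightarrow> real" where "w x = h (x \<bullet> x)"
definition dw :: "3 \<Rightarrow> space \<Rightarrow> real" where "dw j x = h1 (x \<bullet> x) * (2 * x $ j)"
definition ddw :: "3 \<Rightarrow> space \<Rightarrow> real" where
  "ddw j x = h2 (x \<bullet> x) * (2 * x $ j) * (2 * x $ j) + (2 * 1) * h1 (x \<bullet> x)"

lemma radial_cont': "continuous_on {0..} h" "continuous_on {0..} h1"
  by (rule continuous_at_imp_continuous_on, use radial_deriv DERIV_isCont in fastforce)+

lemma continuous_radial: "continuous_on {0..} g \<Longrightarrow> continuous_on UNIV (\<lambda>x :: space. g (x \<bullet> x))"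
  by (rule continuous_on_compose2[of "{0..}" g]) (auto intro!: continuous_intros)

sublocale weight w dw ddw R
proof
  show "continuous_on UNIV w" "continuous_on UNIV (dw j)" "continuous_on UNIV (ddw j)" for j
    unfolding w_def[abs_def] dw_def[abs_def] ddw_def[abs_def]
    by (intro continuous_intros continuous_radial radial_cont radial_cont')+
  show "has_partial j w (dw j x) x" for j x
    unfolding w_def[abs_def] dw_def
    by (rule has_partial_compose[OF radial_deriv(1) has_partial_inner_self]) simp
  have "has_partial j (\<lambda>x. 2 * x $ j) (2 * 1) x" for j x
    using has_partial_cmult[OF has_partial_component[of j j x], of 2] by simp
  thus "has_partial j (dw j) (ddw j x) x" for j x
    unfolding dw_def[abs_def] ddw_def
    by (intro has_partial_mult has_partial_compose[OF radial_deriv(2) has_partial_inner_self]) simp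
  have "R\<^sup>2 < x \<bullet> x" if "R < norm x" for x :: space
    using that radius by (simp add: power2_norm_eq_inner[symmetric] power_strict_mono)
  thus "R < norm x \<Longrightarrow> w x = 0" "R < norm x \<Longrightarrow> dw j x = 0" "R < norm x \<Longrightarrow> ddw j x = 0" for x j
    by (simp_all add: w_def dw_def ddw_def radial_support)
qed

lemma inner_self_eq_sum: "x \<bullet> x = (\<Sum>j\<in>UNIV. (x $ j)\<^sup>2)" for x :: space
  by (simp add: inner_vec_def power2_eq_square)

lemma kappa_nonneg: "0 \<le> \<kappa>"
  using radial_lap[of 0] by linarith

lemma transport_bound:
  assumes "0 \<le> D"
  shows "\<bar>\<Sum>j\<in>UNIV. D * ddw j x - v $ j * dw j x\<bar> \<le> \<kappa> * (D + norm v)"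
proof -
  have lap: "(\<Sum>j\<in>UNIV. ddw j x) = 6 * h1 (x \<bullet> x) + 4 * (x \<bullet> x) * h2 (x \<bullet> x)"
  proof -
    have "(\<Sum>j\<in>UNIV. ddw j x) = (\<Sum>j\<in>UNIV. 4 * h2 (x \<bullet> x) * (x $ j)\<^sup>2 + 2 * h1 (x \<bullet> x))"
      by (rule sum.cong) (auto simp: ddw_def power2_eq_square)
    also have "\<dots> = 4 * h2 (x \<bullet> x) * (x \<bullet> x) + 6 * h1 (x \<bullet> x)"
      by (simp add: sum.distrib sum_distrib_left[symmetric] inner_self_eq_sum)
    finally show ?thesis by simp
  qed
  have grad: "(\<Sum>j\<in>UNIV. v $ j * dw j x) = 2 * h1 (x \<bullet> x) * (v \<bullet> x)"
  proof -
    have "(\<Sum>j\<in>UNIV. v $ j * dw j x) = (\<Sum>j\<in>UNIV. 2 * h1 (x \<bullet> x) * (v $ j * x $ j))"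
      by (simp add: dw_def mult_ac)
    thus ?thesis by (simp add: inner_vec_def[of v x] sum_distrib_left)
  qed
  have "\<bar>\<Sum>j\<in>UNIV. D * ddw j x - v $ j * dw j x\<bar>
      = \<bar>D * (6 * h1 (x \<bullet> x) + 4 * (x \<bullet> x) * h2 (x \<bullet> x)) - 2 * h1 (x \<bullet> x) * (v \<bullet> x)\<bar>"
    by (simp only: sum_subtractf sum_distrib_left[symmetric] lap grad)
  also have "\<dots> \<le> D * \<bar>6 * h1 (x \<bullet> x) + 4 * (x \<bullet> x) * h2 (x \<bullet> x)\<bar> + 2 * \<bar>h1 (x \<bullet> x)\<bar> * \<bar>v \<bullet> x\<bar>"
    using assms by (intro order_trans[OF abs_triangle_ineq4]) (simp add: abs_mult)
  also have "\<dots> \<le> D * \<kappa> + 2 * \<bar>h1 (x \<bullet> x)\<bar> * (norm v * norm x)"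
    using assms by (intro add_mono mult_left_mono radial_lap Cauchy_Schwarz_ineq2) auto
  also have "2 * \<bar>h1 (x \<bullet> x)\<bar> * (norm v * norm x) = (2 * \<bar>h1 (x \<bullet> x)\<bar> * sqrt (x \<bullet> x)) * norm v"
    by (simp add: norm_eq_sqrt_inner)
  also have "D * \<kappa> + \<dots> \<le> D * \<kappa> + \<kappa> * norm v"
    by (intro add_mono mult_right_mono radial_grad) (auto simp: kappa_nonneg)
  finally show ?thesis by (simp add: algebra_simps)
qed

end

text \<open>The exponent 3 is the smallest that makes the cutoff twice continuously differentiable.\<close>

definition cutoff :: "real \<Rightarrow> real \<Rightarrow> real" where "cutoff R s = (max 0 (1 - s / R\<^sup>2)) ^ 3"
definition cutoff1 :: "real \<Rightarrow> real \<Rightarrow> real" where "cutoff1 R s = - (3 / R\<^sup>2) * (max 0 (1 - s / R\<^sup>2))\<^sup>2"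
definition cutoff2 :: "real \<Rightarrow> real \<Rightarrow> real" where "cutoff2 R s = 6 / (R\<^sup>2)\<^sup>2 * max 0 (1 - s / R\<^sup>2)"

lemma DERIV_max_power:
  "((\<lambda>s. (max 0 s) ^ Suc (Suc n)) has_real_derivative real (Suc (Suc n)) * (max 0 s) ^ Suc n) (at s)"
proof (cases s "0 :: real" rule: linorder_cases)
  case less
  have "((\<lambda>_. 0) has_real_derivative 0) (at s)" by simp
  hence "((\<lambda>s. (max 0 s) ^ Suc (Suc n)) has_real_derivative 0) (at s)"
    by (rule has_field_derivative_transform_within_open[where S = "{..<0}"]) (use less in auto)
  thus ?thesis using less by simp
next
  case greater
  have "((\<lambda>s. s ^ Suc (Suc n)) has_real_derivative real (Suc (Suc n)) * s ^ Suc n) (at s)"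
    using DERIV_pow[of "Suc (Suc n)" s] by simp
  hence "((\<lambda>s. (max 0 s) ^ Suc (Suc n)) has_real_derivative real (Suc (Suc n)) * s ^ Suc n) (at s)"
    by (rule has_field_derivative_transform_within_open[where S = "{0<..}"]) (use greater in auto)
  thus ?thesis using greater by simp
next
  case equal
  have "((\<lambda>s. (max 0 s) ^ Suc (Suc n)) has_real_derivative 0) (at 0)"
  proof (rule has_field_derivative_zeroI[where d = 1 and C = 1])
    fix s :: real assume s: "\<bar>s - 0\<bar> < 1"
    show "\<bar>(max 0 s) ^ Suc (Suc n)\<bar> \<le> 1 * (s - 0)\<^sup>2"
    proof (cases "0 \<le> s")
      case True
      have "s ^ Suc (Suc n) \<le> s\<^sup>2" using True s by (intro power_decreasing) auto
      thus ?thesis using True by simp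
    qed simp
  qed auto
  thus ?thesis using equal by simp
qed

lemma DERIV_cutoff:
  assumes R: "0 < R"
  shows "(cutoff R has_real_derivative cutoff1 R s) (at s)" "(cutoff1 R has_real_derivative cutoff2 R s) (at s)"
proof -
  have i: "((\<lambda>s. 1 - s / R\<^sup>2) has_real_derivative - (1 / R\<^sup>2)) (at s)"
    using DERIV_diff[OF DERIV_const DERIV_cdivide[OF DERIV_ident, of "R\<^sup>2"]] by simp
  have "((\<lambda>s. (max 0 (1 - s / R\<^sup>2)) ^ Suc (Suc n)) has_real_derivative
      real (Suc (Suc n)) * (max 0 (1 - s / R\<^sup>2)) ^ Suc n * - (1 / R\<^sup>2)) (at s)" for n
    using DERIV_chain2[OF DERIV_max_power i] .
  note a = this[of 1, simplified] and b = this[of 0, simplified]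
  show "(cutoff R has_real_derivative cutoff1 R s) (at s)"
    unfolding cutoff_def[abs_def] cutoff1_def
    using a by (simp add: eval_nat_numeral mult_ac)
  have "((\<lambda>s. - (3 / R\<^sup>2) * (max 0 (1 - s / R\<^sup>2))\<^sup>2) has_real_derivative
     - (3 / R\<^sup>2) * (2 * max 0 (1 - s / R\<^sup>2) * - (1 / R\<^sup>2))) (at s)"
    using b by (intro DERIV_cmult) (simp add: power2_eq_square mult_ac)
  thus "(cutoff1 R has_real_derivative cutoff2 R s) (at s)"
    unfolding cutoff1_def[abs_def] cutoff2_def by (simp add: power2_eq_square)
qed

lemma continuous_cutoff2: "0 < R \<Longrightarrow> continuous_on A (cutoff2 R)"
  unfolding cutoff2_def[abs_def] by (intro continuous_intros) auto

lemma cutoff_support: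
  assumes "0 < R" "R\<^sup>2 < s" shows "cutoff R s = 0" "cutoff1 R s = 0" "cutoff2 R s = 0"
proof -
  have "1 - s / R\<^sup>2 \<le> 0" using assms by (simp add: field_simps)
  hence "max 0 (1 - s / R\<^sup>2) = 0" by simp
  thus "cutoff R s = 0" "cutoff1 R s = 0" "cutoff2 R s = 0" by (simp_all add: cutoff_def cutoff1_def cutoff2_def)
qed

lemma cutoff_range:
  assumes "0 < R" "0 \<le> s"
  shows "0 \<le> cutoff R s" "cutoff R s \<le> 1" "\<bar>cutoff1 R s\<bar> \<le> 3 / R\<^sup>2" "0 \<le> cutoff2 R s" "cutoff2 R s \<le> 6 / (R\<^sup>2)\<^sup>2"
proof -
  let ?m = "max 0 (1 - s / R\<^sup>2)"
  have m: "0 \<le> ?m" "?m \<le> 1" using assms by auto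
  show "0 \<le> cutoff R s" "cutoff R s \<le> 1" using m by (auto simp: cutoff_def intro: power_le_one)
  have "\<bar>cutoff1 R s\<bar> = 3 / R\<^sup>2 * ?m\<^sup>2" by (simp add: cutoff1_def abs_mult)
  also have "\<dots> \<le> 3 / R\<^sup>2 * 1" using m by (intro mult_left_mono power_le_one) auto
  finally show "\<bar>cutoff1 R s\<bar> \<le> 3 / R\<^sup>2" by simp
  show "0 \<le> cutoff2 R s" using m by (simp add: cutoff2_def)
  have "cutoff2 R s \<le> 6 / (R\<^sup>2)\<^sup>2 * 1" unfolding cutoff2_def using m by (intro mult_left_mono) auto
  thus "cutoff2 R s \<le> 6 / (R\<^sup>2)\<^sup>2" by simp
qed

lemma cutoff_mono: assumes "0 < R" "R \<le> R'" "0 \<le> s" shows "cutoff R s \<le> cutoff R' s"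
proof -
  have "s / R'\<^sup>2 \<le> s / R\<^sup>2" using assms by (intro divide_left_mono power_mono) auto
  thus ?thesis unfolding cutoff_def by (intro power_mono) auto
qed

lemma radial_weight_cutoff:
  assumes R: "1 \<le> R"
  shows "radial_weight (cutoff R) (cutoff1 R) (cutoff2 R) R (42 / R)"
proof
  have R0: "0 < R" using R by simp
  have RR: "R \<le> R\<^sup>2" using R by (simp add: power2_eq_square)
  fix s :: real assume s: "0 \<le> s"
  show "2 * \<bar>cutoff1 R s\<bar> * sqrt s \<le> 42 / R"
  proof (cases "R\<^sup>2 < s")
    case True thus ?thesis using cutoff_support[OF R0] R0 by simp
  next
    case False
    hence "sqrt s \<le> R" using R0 by (simp add: real_le_lsqrt)
    hence "2 * \<bar>cutoff1 R s\<bar> * sqrt s \<le> 2 * (3 / R\<^sup>2) * R"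
      using cutoff_range[OF R0 s] s by (intro mult_mono) auto
    also have "\<dots> = 6 / R" using R0 by (simp add: power2_eq_square)
    also have "\<dots> \<le> 42 / R" using R0 by (intro divide_right_mono) auto
    finally show ?thesis .
  qed
  show "\<bar>6 * cutoff1 R s + 4 * s * cutoff2 R s\<bar> \<le> 42 / R"
  proof (cases "R\<^sup>2 < s")
    case True thus ?thesis using cutoff_support[OF R0] R0 by simp
  next
    case False
    have "4 * s * cutoff2 R s \<le> 4 * R\<^sup>2 * (6 / (R\<^sup>2)\<^sup>2)"
      using cutoff_range[OF R0 s] s False by (intro mult_mono) auto
    also have "\<dots> = 24 / R\<^sup>2" using R0 by (simp add: field_simps eval_nat_numeral)
    finally have "4 * s * cutoff2 R s \<le> 24 / R\<^sup>2" .
    moreover have "0 \<le> 4 * s * cutoff2 R s" using cutoff_range[OF R0 s] s by simp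
    ultimately have "\<bar>6 * cutoff1 R s + 4 * s * cutoff2 R s\<bar> \<le> 6 * (3 / R\<^sup>2) + 24 / R\<^sup>2"
      using cutoff_range(3)[OF R0 s] by linarith
    also have "\<dots> = 42 / R\<^sup>2" by (simp add: add_divide_distrib[symmetric])
    also have "\<dots> \<le> 42 / R" using R0 RR by (intro divide_left_mono) auto
    finally show ?thesis .
  qed
qed (use R DERIV_cutoff continuous_cutoff2 cutoff_support cutoff_range in auto)

text \<open>The weight \<open>sqrt (1 + \<bar>x\<bar>\<^sup>2)\<close> of the first moment, cut off at radius \<open>R\<close>. Its gradient and its
  Laplacian stay bounded as \<open>R\<close> grows, because the slope of the cutoff is of order \<open>1 / R\<close> where the
  weight is of order \<open>R\<close>.\<close>

definition moment_weight :: "real \<Rightarrow> real \<Rightarrow> real" where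
  "moment_weight R s = sqrt (1 + s) * cutoff R s"
definition moment_weight1 :: "real \<Rightarrow> real \<Rightarrow> real" where
  "moment_weight1 R s = inverse (sqrt (1 + s)) / 2 * cutoff R s + cutoff1 R s * sqrt (1 + s)"
definition moment_weight2 :: "real \<Rightarrow> real \<Rightarrow> real" where
  "moment_weight2 R s = (- (inverse (sqrt (1 + s)) ^ 3) / 4) * cutoff R s + cutoff1 R s * (inverse (sqrt (1 + s)) / 2)
     + (cutoff2 R s * sqrt (1 + s) + (inverse (sqrt (1 + s)) / 2) * cutoff1 R s)"

lemma radial_weight_moment:
  assumes R: "1 \<le> R"
  shows "radial_weight (moment_weight R) (moment_weight1 R) (moment_weight2 R) R 100"
proof
  have R0: "0 < R" using R by simp
  have RR: "1 \<le> R\<^sup>2" "R \<le> R\<^sup>2" using R by (auto simp: power2_eq_square intro: mult_mono[of 1 R 1 R, simplified])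
  fix s :: real
  show "moment_weight R s = 0" "moment_weight1 R s = 0" "moment_weight2 R s = 0" if "R\<^sup>2 < s"
    using cutoff_support[OF R0 that] by (simp_all add: moment_weight_def moment_weight1_def moment_weight2_def)
  assume s: "0 \<le> s"
  have i: "((\<lambda>s. 1 + s) has_real_derivative 1) (at s)" by (auto intro!: derivative_eq_intros)
  have d: "((\<lambda>s. sqrt (1 + s)) has_real_derivative inverse (sqrt (1 + s)) / 2) (at s)"
    using DERIV_chain2[OF DERIV_real_sqrt i] s by simp
  have d2: "((\<lambda>s. inverse (sqrt (1 + s)) / 2) has_real_derivative - (inverse (sqrt (1 + s)) ^ 3) / 4) (at s)"
  proof -
    have "((\<lambda>s. inverse (sqrt (1 + s))) has_real_derivative - (inverse (sqrt (1 + s)) * (inverse (sqrt (1 + s)) / 2) * inverse (sqrt (1 + s)))) (at s)"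
      by (rule DERIV_inverse'[OF d]) (use s in simp)
    from DERIV_cdivide[OF this, of 2] show ?thesis by (simp add: power3_eq_cube mult_ac)
  qed
  show "(moment_weight R has_real_derivative moment_weight1 R s) (at s)"
    unfolding moment_weight_def[abs_def] moment_weight1_def by (intro DERIV_mult d DERIV_cutoff R0)
  show "(moment_weight1 R has_real_derivative moment_weight2 R s) (at s)"
    unfolding moment_weight1_def[abs_def] moment_weight2_def by (intro DERIV_add DERIV_mult d d2 DERIV_cutoff R0)
  let ?q = "sqrt (1 + s)"
  have q: "1 \<le> ?q" "inverse ?q \<le> 1" "0 < inverse ?q" using s by (auto simp: inverse_le_1_iff)
  have sq: "sqrt s \<le> ?q" "s \<le> ?q\<^sup>2" "?q\<^sup>2 = 1 + s" using s by auto
  have iq: "inverse ?q * sqrt s \<le> 1" using sq q by (simp add: field_simps)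
  note c = cutoff_range[OF R0 s]
  show "2 * \<bar>moment_weight1 R s\<bar> * sqrt s \<le> 100"
  proof (cases "R\<^sup>2 < s")
    case True thus ?thesis using cutoff_support[OF R0] by (simp add: moment_weight1_def)
  next
    case False
    have s1: "sqrt s \<le> R" using False R0 by (simp add: real_le_lsqrt)
    have "1 + s \<le> (2 * R)\<^sup>2" using False RR by (simp add: power_mult_distrib)
    hence q1: "?q \<le> 2 * R" using R0 by (intro real_le_lsqrt) auto
    have "\<bar>moment_weight1 R s\<bar> \<le> inverse ?q / 2 * 1 + 3 / R\<^sup>2 * ?q"
      unfolding moment_weight1_def using c(1,2) q mult_right_mono[OF c(3), of ?q]
      by (intro order_trans[OF abs_triangle_ineq] add_mono) (auto simp: abs_mult intro!: mult_mono)
    hence "2 * \<bar>moment_weight1 R s\<bar> * sqrt s \<le> 2 * (inverse ?q / 2 * 1 + 3 / R\<^sup>2 * ?q) * sqrt s"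
      using s by (intro mult_right_mono mult_left_mono) auto
    also have "\<dots> = inverse ?q * sqrt s + 6 / R\<^sup>2 * (?q * sqrt s)" by (simp add: algebra_simps)
    also have "\<dots> \<le> 1 + 6 / R\<^sup>2 * (2 * R * R)"
      using s s1 q1 q R0 by (intro add_mono iq mult_left_mono mult_mono) auto
    also have "\<dots> = 13" using R0 by (simp add: power2_eq_square)
    finally show ?thesis by linarith
  qed
  show "\<bar>6 * moment_weight1 R s + 4 * s * moment_weight2 R s\<bar> \<le> 100"
  proof (cases "R\<^sup>2 < s")
    case True thus ?thesis using cutoff_support[OF R0] by (simp add: moment_weight1_def moment_weight2_def)
  next
    case False
    have "1 + s \<le> (2 * R)\<^sup>2" using False RR by (simp add: power_mult_distrib)
    hence q1: "?q \<le> 2 * R" using R0 by (intro real_le_lsqrt) auto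
    have c1: "\<bar>cutoff1 R s\<bar> * R \<le> 3"
    proof -
      have "\<bar>cutoff1 R s\<bar> * R \<le> 3 / R\<^sup>2 * R" using c R0 by (intro mult_right_mono) auto
      also have "\<dots> = 3 / R" using R0 by (simp add: power2_eq_square)
      also have "\<dots> \<le> 3" using R by (simp add: field_simps)
      finally show ?thesis .
    qed
    have a: "\<bar>moment_weight1 R s\<bar> \<le> 1/2 + 6"
    proof -
      have "\<bar>moment_weight1 R s\<bar> \<le> 1 / 2 * 1 + \<bar>cutoff1 R s\<bar> * (2 * R)"
        unfolding moment_weight1_def using c q q1 mult_le_one[of "inverse ?q" "cutoff R s"]
        by (intro order_trans[OF abs_triangle_ineq] add_mono) (auto simp: abs_mult intro!: mult_mono)
      thus ?thesis using c1 by simp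
    qed
    have t1: "s * inverse ?q ^ 3 \<le> 1"
    proof -
      have "s * inverse ?q ^ 3 \<le> ?q\<^sup>2 * inverse ?q ^ 3" using q sq by (intro mult_right_mono) auto
      also have "\<dots> = inverse ?q"
      proof -
        have "p\<^sup>2 * inverse p ^ 3 = inverse p" if "0 < p" for p :: real
          using that by (simp add: power2_eq_square power3_eq_cube field_simps)
        from this[of ?q] show ?thesis using q by linarith
      qed
      finally show ?thesis using q by linarith
    qed
    have t2: "s * (\<bar>cutoff1 R s\<bar> * (inverse ?q / 2)) \<le> 3/2"
    proof -
      have "s * (\<bar>cutoff1 R s\<bar> * (inverse ?q / 2)) \<le> R\<^sup>2 * (3 / R\<^sup>2 * (1 / 2))"
        using c q False s by (intro mult_mono) auto
      thus ?thesis using R0 by simp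
    qed
    have t3: "s * (cutoff2 R s * ?q) \<le> 12"
    proof -
      have "s * (cutoff2 R s * ?q) \<le> R\<^sup>2 * (6 / (R\<^sup>2)\<^sup>2 * (2 * R))"
        using c q q1 False s by (intro mult_mono) auto
      also have "\<dots> = 12 / R" using R0 by (simp add: power2_eq_square)
      also have "\<dots> \<le> 12" using R by (simp add: field_simps)
      finally show ?thesis .
    qed
    have "\<bar>s * moment_weight2 R s\<bar> \<le> 1/4 + 3/2 + 3/2 + 12"
    proof -
      have "s * moment_weight2 R s = - (s * inverse ?q ^ 3 / 4 * cutoff R s)
          + 2 * (s * (cutoff1 R s * (inverse ?q / 2))) + s * (cutoff2 R s * ?q)"
        by (simp add: moment_weight2_def algebra_simps)
      moreover have "\<bar>s * inverse ?q ^ 3 / 4 * cutoff R s\<bar> \<le> 1/4 * 1"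
        using mult_le_one[OF t1 c(1,2)] c q s by (subst abs_of_nonneg) auto
      moreover have "\<bar>s * (cutoff1 R s * (inverse ?q / 2))\<bar> \<le> 3/2"
        using t2 s q by (simp add: abs_mult)
      moreover have "\<bar>s * (cutoff2 R s * ?q)\<bar> \<le> 12"
        using t3 c s q by (subst abs_of_nonneg) auto
      ultimately show ?thesis by linarith
    qed
    thus ?thesis using a by (simp add: mult.assoc)
  qed
next
  have R0: "0 < R" using R by simp
  have "continuous_on {0..} (cutoff R)" "continuous_on {0..} (cutoff1 R)"
    by (rule continuous_at_imp_continuous_on, use DERIV_cutoff[OF R0] DERIV_isCont in blast)+
  thus "continuous_on {0..} (moment_weight2 R)"
    unfolding moment_weight2_def[abs_def] by (intro continuous_intros continuous_cutoff2 R0) auto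
  show "0 \<le> R" using R by simp
qed

section \<open>Hardy's inequality and the Newtonian field\<close>

text \<open>The field \<open>X = x / (\<bar>x\<bar>\<^sup>2 + e)\<close> has divergence at least \<open>1 / (\<bar>x\<bar>\<^sup>2 + e)\<close> and square length at
  most \<open>1 / (\<bar>x\<bar>\<^sup>2 + e)\<close>. Integrating the divergence of \<open>f\<^sup>2 X\<close> and splitting the cross term
  \<open>2 f \<nabla>f \<bullet> X\<close> by Young's inequality absorbs half of the left hand side. The positive \<open>e\<close> keeps
  the field smooth at the origin.\<close>

theorem hardy:
  fixes f :: "space \<Rightarrow> real"
  assumes f: "continuous_on UNIV f" and df: "\<And>j. continuous_on UNIV (df j)"
    and d: "\<And>j x. has_partial j f (df j x) x"
    and 0: "\<And>x. R < norm x \<Longrightarrow> f x = 0" and df0: "\<And>j x. R < norm x \<Longrightarrow> df j x = 0"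
    and e: "0 < e"
  shows "(LINT x|lborel. (f x)\<^sup>2 / (x \<bullet> x + e)) \<le> 4 * (\<Sum>j\<in>UNIV. LINT x|lborel. (df j x)\<^sup>2)"
proof -
  define i where "i x = inverse (x \<bullet> x + e)" for x :: space
  have pos: "0 < x \<bullet> x + e" for x :: space using e inner_ge_zero[of x] by linarith
  have ci: "continuous_on UNIV i" unfolding i_def[abs_def]
    by (intro continuous_intros) (use pos in \<open>auto simp: less_imp_neq[symmetric]\<close>)
  have di: "has_partial j i (- (i x * 1 * i x) * (2 * x $ j)) x" for j x
    unfolding i_def[abs_def]
    by (rule has_partial_compose[OF DERIV_inverse' has_partial_inner_self])
       (use pos[of x] in \<open>auto intro!: derivative_eq_intros\<close>)
  \<comment> \<open>The partial derivatives of the components of \<open>f\<^sup>2 X\<close>.\<close>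
  define W' where "W' j x = (df j x * f x + df j x * f x) * (x $ j * i x)
      + (1 * i x + - (i x * 1 * i x) * (2 * x $ j) * x $ j) * (f x * f x)" for j x
  have W0: "(LINT x|lborel. W' j x) = 0" for j
  proof (rule integral_has_partial_eq_0[of "\<lambda>x. f x * f x * (x $ j * i x)", where R = R and j = j])
    show "continuous_on UNIV (\<lambda>x. f x * f x * (x $ j * i x))" by (intro continuous_intros f ci)
    show "continuous_on UNIV (W' j)" unfolding W'_def[abs_def] by (intro continuous_intros f ci df)
    have "has_partial j (\<lambda>x. x $ j) 1 x" for x using has_partial_component[of j j x] by simp
    thus "has_partial j (\<lambda>x. f x * f x * (x $ j * i x)) (W' j x) x" for x
      unfolding W'_def by (intro has_partial_mult d di)
  qed (simp add: 0)
  have iW: "integrable lborel (W' j)" for j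
    by (rule integrable_continuous_compact_support[where R = R])
       (auto simp: W'_def[abs_def] 0 intro!: continuous_intros f ci df)
  have id: "integrable lborel (\<lambda>x. (df j x)\<^sup>2)" for j
    by (rule integrable_continuous_compact_support[where R = R]) (auto simp: df0 intro!: continuous_intros df)
  have "integrable lborel (\<lambda>x. (f x)\<^sup>2 * i x)"
    by (rule integrable_continuous_compact_support[where R = R]) (auto simp: 0 intro!: continuous_intros f ci)
  moreover have "(f x)\<^sup>2 * i x \<le> 2 * (\<Sum>j\<in>UNIV. W' j x) + 4 * (\<Sum>j\<in>UNIV. (df j x)\<^sup>2)" for x
  proof -
    have i0: "0 < i x" using pos[of x] by (simp add: i_def)
    have si: "(x \<bullet> x) * i x \<le> 1" using pos[of x] e by (simp add: i_def field_simps)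
    have "(\<Sum>j\<in>UNIV. - 2 * (df j x * f x * (x $ j * i x))) \<le> (\<Sum>j\<in>UNIV. (f x)\<^sup>2 * (i x)\<^sup>2 / 2 * (x $ j)\<^sup>2 + 2 * (df j x)\<^sup>2)"
    proof (rule sum_mono)
      fix j
      have "0 \<le> (f x * i x * x $ j + 2 * df j x)\<^sup>2 / 2" by simp
      thus "- 2 * (df j x * f x * (x $ j * i x)) \<le> (f x)\<^sup>2 * (i x)\<^sup>2 / 2 * (x $ j)\<^sup>2 + 2 * (df j x)\<^sup>2"
        by (simp add: power2_sum power_mult_distrib field_simps)
    qed
    also have "\<dots> = (f x)\<^sup>2 * i x / 2 * ((x \<bullet> x) * i x) + 2 * (\<Sum>j\<in>UNIV. (df j x)\<^sup>2)"
      by (simp only: sum.distrib sum_distrib_left[symmetric]) (simp add: inner_vec_def power2_eq_square mult_ac)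
    also have "\<dots> \<le> (f x)\<^sup>2 * i x / 2 * 1 + 2 * (\<Sum>j\<in>UNIV. (df j x)\<^sup>2)"
      using si i0 by (intro add_mono mult_left_mono) auto
    finally have cross: "(\<Sum>j\<in>UNIV. - 2 * (df j x * f x * (x $ j * i x))) \<le> (f x)\<^sup>2 * i x / 2 + 2 * (\<Sum>j\<in>UNIV. (df j x)\<^sup>2)"
      by simp
    have "(\<Sum>j\<in>UNIV. W' j x) = (\<Sum>j\<in>UNIV. (f x)\<^sup>2 * i x - 2 * ((f x)\<^sup>2 * (i x)\<^sup>2) * (x $ j)\<^sup>2 - (- 2 * (df j x * f x * (x $ j * i x))))"
      by (rule sum.cong) (auto simp: W'_def power2_eq_square algebra_simps)
    also have "\<dots> = 3 * ((f x)\<^sup>2 * i x) - 2 * ((f x)\<^sup>2 * i x) * ((x \<bullet> x) * i x) - (\<Sum>j\<in>UNIV. - 2 * (df j x * f x * (x $ j * i x)))"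
      by (simp only: sum_subtractf sum_distrib_left[symmetric]) (simp add: inner_vec_def power2_eq_square mult_ac)
    finally have W: "(\<Sum>j\<in>UNIV. W' j x) = 3 * ((f x)\<^sup>2 * i x) - 2 * ((f x)\<^sup>2 * i x) * ((x \<bullet> x) * i x) - (\<Sum>j\<in>UNIV. - 2 * (df j x * f x * (x $ j * i x)))" .
    have "2 * ((f x)\<^sup>2 * i x) * ((x \<bullet> x) * i x) \<le> 2 * ((f x)\<^sup>2 * i x) * 1"
      using si i0 by (intro mult_left_mono) auto
    thus ?thesis using W cross by linarith
  qed
  ultimately have "(LINT x|lborel. (f x)\<^sup>2 * i x) \<le> (LINT x|lborel. 2 * (\<Sum>j\<in>UNIV. W' j x) + 4 * (\<Sum>j\<in>UNIV. (df j x)\<^sup>2))"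
    using iW id by (intro integral_mono) auto
  also have "\<dots> = 4 * (\<Sum>j\<in>UNIV. LINT x|lborel. (df j x)\<^sup>2)"
    using iW id by (simp add: W0)
  finally show ?thesis by (simp add: i_def divide_inverse)
qed

interpretation unit_cutoff: radial_weight "cutoff 2" "cutoff1 2" "cutoff2 2" 2 "42/2"
  by (rule radial_weight_cutoff) simp

lemma unit_cutoff_dw_bound: "(unit_cutoff.dw j x)\<^sup>2 \<le> 441"
proof -
  have "\<bar>unit_cutoff.dw j x\<bar> = 2 * \<bar>cutoff1 2 (x \<bullet> x)\<bar> * \<bar>x $ j\<bar>" by (simp add: unit_cutoff.dw_def abs_mult)
  also have "\<dots> \<le> 2 * \<bar>cutoff1 2 (x \<bullet> x)\<bar> * sqrt (x \<bullet> x)"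
    using component_le_norm_cart[of x j] by (intro mult_left_mono) (auto simp: norm_eq_sqrt_inner)
  also have "\<dots> \<le> 42/2" by (rule unit_cutoff.radial_grad) simp
  finally have "\<bar>unit_cutoff.dw j x\<bar> \<le> 21" by simp
  hence "\<bar>unit_cutoff.dw j x\<bar>\<^sup>2 \<le> 21\<^sup>2" by (intro power_mono) auto
  thus ?thesis by simp
qed

lemma unit_cutoff_range: "0 \<le> unit_cutoff.w x" "unit_cutoff.w x \<le> 1" "1 - (unit_cutoff.w x)\<^sup>2 \<le> 3/2 * (x \<bullet> x)"
proof -
  show "0 \<le> unit_cutoff.w x" "unit_cutoff.w x \<le> 1"
    using cutoff_range[of 2 "x \<bullet> x"] by (auto simp: unit_cutoff.w_def)
  show "1 - (unit_cutoff.w x)\<^sup>2 \<le> 3/2 * (x \<bullet> x)"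
  proof (cases "x \<bullet> x \<le> 4")
    case True
    have "1 + real 6 * (- (x \<bullet> x) / 4) \<le> (1 + - (x \<bullet> x) / 4) ^ 6"
      by (rule Bernoulli_inequality) (use True in simp)
    moreover have "(unit_cutoff.w x)\<^sup>2 = (1 + - (x \<bullet> x) / 4) ^ 6"
      using True by (simp add: unit_cutoff.w_def cutoff_def max_def)
    ultimately show ?thesis by simp
  next
    case False
    thus ?thesis using zero_le_power2[of "unit_cutoff.w x"] by linarith
  qed
qed

lemma self_le_one_plus_square: "q \<le> 1 + q\<^sup>2" for q :: real
  using zero_le_power2[of "q - 1"] zero_le_power2[of q] by (cases "0 \<le> q") (auto simp: power2_diff intro: order_trans[of q 0])

text \<open>Applied to the cutoff itself, Hardy's inequality bounds the integral of \<open>1 / \<bar>x\<bar>\<^sup>2\<close> near the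
  origin; this is the resulting number.\<close>

definition cutoff_energy :: real where
  "cutoff_energy = 4 * (\<Sum>j\<in>UNIV. LINT x|lborel. (unit_cutoff.dw j x)\<^sup>2)"

text \<open>The coefficient 5292 is \<open>6 \<cdot> 2 \<cdot> 21\<^sup>2\<close>, with 21 a bound for the slope of the unit cutoff. The summand 1 makes the
  bound absorb constants and allows division by it.\<close>

definition field_bound :: "(space \<Rightarrow> real) \<Rightarrow> (3 \<Rightarrow> space \<Rightarrow> real) \<Rightarrow> real" where
  "field_bound \<rho> d\<rho> = 4 * (\<Sum>j\<in>UNIV. LINT x|lborel. (d\<rho> j x)\<^sup>2) + 5292 * (LINT x|lborel. (\<rho> x)\<^sup>2)
     + cutoff_energy + 3/2 * (LINT x|lborel. \<bar>\<rho> x\<bar>) + 1"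

lemma field_bound_ge_1: "1 \<le> field_bound \<rho> d\<rho>"
  unfolding field_bound_def cutoff_energy_def by (simp add: sum_nonneg)

locale charge =
  fixes \<rho> :: "space \<Rightarrow> real" and d\<rho> :: "3 \<Rightarrow> space \<Rightarrow> real"
  assumes \<rho>_cont: "continuous_on UNIV \<rho>" "\<And>j. continuous_on UNIV (d\<rho> j)"
    and \<rho>_deriv: "\<And>j x. has_partial j \<rho> (d\<rho> j x) x"
    and \<rho>_int: "integrable lborel \<rho>" "integrable lborel (\<lambda>x. (\<rho> x)\<^sup>2)" "\<And>j. integrable lborel (\<lambda>x. (d\<rho> j x)\<^sup>2)"
begin

text \<open>Away from the origin the kernel \<open>1 / \<bar>x\<bar>\<^sup>2\<close> is bounded and the \<open>L\<^sup>1\<close> norm suffices. Near the origin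
  \<open>2 \<bar>\<rho>\<bar> \<le> \<rho>\<^sup>2 + 1\<close>, and Hardy's inequality is applied to the localised \<open>\<rho>\<close> and to the cutoff. The split
  is done by the square of the cutoff \<open>\<chi>\<close>, with \<open>1 - \<chi>\<^sup>2 \<le> 3/2 \<bar>x\<bar>\<^sup>2\<close>.\<close>

lemma regularised_kernel_bound:
  assumes e: "0 < e"
  shows "integrable lborel (\<lambda>x. \<bar>\<rho> (z + x)\<bar> / (x \<bullet> x + e))"
    "(LINT x|lborel. \<bar>\<rho> (z + x)\<bar> / (x \<bullet> x + e)) \<le> field_bound \<rho> d\<rho>"
proof -
  let ?\<chi> = "unit_cutoff.w" and ?d\<chi> = "unit_cutoff.dw"
  note c\<chi> = unit_cutoff.weight_cont
  have ct: "continuous_on UNIV (\<lambda>x. \<rho> (z + x))" "\<And>j. continuous_on UNIV (\<lambda>x. d\<rho> j (z + x))"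
    by (rule continuous_on_compose2[OF \<rho>_cont(1)] continuous_on_compose2[OF \<rho>_cont(2)]; auto intro!: continuous_intros)+
  have it: "integrable lborel (\<lambda>x. \<bar>\<rho> (z + x)\<bar>)" "integrable lborel (\<lambda>x. (\<rho> (z + x))\<^sup>2)"
    "\<And>j. integrable lborel (\<lambda>x. (d\<rho> j (z + x))\<^sup>2)"
    using lborel_integrable_translate[OF \<rho>_int(1)] lborel_integrable_translate[OF \<rho>_int(2)]
      lborel_integrable_translate[OF \<rho>_int(3)] by auto
  have tr: "(LINT x|lborel. \<bar>\<rho> (z + x)\<bar>) = (LINT x|lborel. \<bar>\<rho> x\<bar>)"
    "(LINT x|lborel. (\<rho> (z + x))\<^sup>2) = (LINT x|lborel. (\<rho> x)\<^sup>2)"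
    "(LINT x|lborel. (d\<rho> j (z + x))\<^sup>2) = (LINT x|lborel. (d\<rho> j x)\<^sup>2)" for j
    by (rule lborel_integral_translate[of "\<lambda>x. \<bar>\<rho> x\<bar>"] lborel_integral_translate[of "\<lambda>x. (\<rho> x)\<^sup>2"]
        lborel_integral_translate[of "\<lambda>x. (d\<rho> j x)\<^sup>2"];
        intro borel_measurable_continuous_onI continuous_intros \<rho>_cont)+
  let ?f = "\<lambda>x. \<rho> (z + x) * ?\<chi> x" and ?df = "\<lambda>j x. d\<rho> j (z + x) * ?\<chi> x + ?d\<chi> j x * \<rho> (z + x)"
  have h1: "(LINT x|lborel. (?f x)\<^sup>2 / (x \<bullet> x + e)) \<le> 4 * (\<Sum>j\<in>UNIV. LINT x|lborel. (?df j x)\<^sup>2)"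
    by (rule hardy[where R = 2])
       (auto simp: unit_cutoff.weight_support intro!: e has_partial_mult has_partial_translate \<rho>_deriv unit_cutoff.weight_partial
         continuous_intros ct c\<chi>)
  have h2: "(LINT x|lborel. (?\<chi> x)\<^sup>2 / (x \<bullet> x + e)) \<le> cutoff_energy"
    unfolding cutoff_energy_def
    by (rule hardy[where R = 2]) (auto simp: unit_cutoff.weight_support intro!: e unit_cutoff.weight_partial c\<chi>)
  have df: "(LINT x|lborel. (?df j x)\<^sup>2) \<le> 2 * (LINT x|lborel. (d\<rho> j x)\<^sup>2) + 882 * (LINT x|lborel. (\<rho> x)\<^sup>2)" for j
  proof -
    have "(LINT x|lborel. (?df j x)\<^sup>2) \<le> (LINT x|lborel. 2 * (d\<rho> j (z + x))\<^sup>2 + 882 * (\<rho> (z + x))\<^sup>2)"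
    proof (rule integral_mono)
      show "integrable lborel (\<lambda>x. (?df j x)\<^sup>2)"
        by (rule integrable_continuous_compact_support[where R = 2])
           (auto simp: unit_cutoff.weight_support intro!: continuous_intros ct c\<chi>)
      show "integrable lborel (\<lambda>x. 2 * (d\<rho> j (z + x))\<^sup>2 + 882 * (\<rho> (z + x))\<^sup>2)" using it by simp
      fix x
      have "(s + t)\<^sup>2 \<le> 2 * s\<^sup>2 + 2 * t\<^sup>2" for s t :: real
        using zero_le_power2[of "s - t"] by (simp add: power2_diff power2_sum)
      hence "(?df j x)\<^sup>2 \<le> 2 * ((d\<rho> j (z + x))\<^sup>2 * (?\<chi> x)\<^sup>2) + 2 * ((?d\<chi> j x)\<^sup>2 * (\<rho> (z + x))\<^sup>2)"
        by (metis power_mult_distrib)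
      also have "\<dots> \<le> 2 * ((d\<rho> j (z + x))\<^sup>2 * 1) + 2 * (441 * (\<rho> (z + x))\<^sup>2)"
        using unit_cutoff_dw_bound[of j x] unit_cutoff_range(1,2)[of x]
        by (intro add_mono mult_left_mono mult_right_mono power_le_one) auto
      finally show "(?df j x)\<^sup>2 \<le> 2 * (d\<rho> j (z + x))\<^sup>2 + 882 * (\<rho> (z + x))\<^sup>2" by simp
    qed
    also have "\<dots> = 2 * (LINT x|lborel. (d\<rho> j x)\<^sup>2) + 882 * (LINT x|lborel. (\<rho> x)\<^sup>2)"
      using it by (simp add: tr)
    finally show ?thesis .
  qed
  have "(\<Sum>j\<in>UNIV. LINT x|lborel. (?df j x)\<^sup>2) \<le> (\<Sum>j\<in>(UNIV::3 set). 2 * (LINT x|lborel. (d\<rho> j x)\<^sup>2) + 882 * (LINT x|lborel. (\<rho> x)\<^sup>2))"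
    by (rule sum_mono[OF df])
  also have "\<dots> = 2 * (\<Sum>j\<in>UNIV. LINT x|lborel. (d\<rho> j x)\<^sup>2) + 2646 * (LINT x|lborel. (\<rho> x)\<^sup>2)"
    by (simp add: sum.distrib sum_distrib_left)
  finally have h3: "(LINT x|lborel. (?f x)\<^sup>2 / (x \<bullet> x + e)) \<le>
      4 * (2 * (\<Sum>j\<in>UNIV. LINT x|lborel. (d\<rho> j x)\<^sup>2) + 2646 * (LINT x|lborel. (\<rho> x)\<^sup>2))"
    by (intro order_trans[OF h1] mult_left_mono) simp_all
  have pos: "0 < x \<bullet> x + e" for x :: space using e inner_ge_zero[of x] by linarith
  let ?g = "\<lambda>x. 1/2 * ((?f x)\<^sup>2 / (x \<bullet> x + e)) + 1/2 * ((?\<chi> x)\<^sup>2 / (x \<bullet> x + e)) + 3/2 * \<bar>\<rho> (z + x)\<bar>"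
  have ig: "integrable lborel (\<lambda>x. (?f x)\<^sup>2 / (x \<bullet> x + e))" "integrable lborel (\<lambda>x. (?\<chi> x)\<^sup>2 / (x \<bullet> x + e))"
    by (rule integrable_continuous_compact_support[where R = 2];
        use pos in \<open>auto simp: unit_cutoff.weight_support less_imp_neq[symmetric] intro!: continuous_intros ct c\<chi>\<close>)+
  have le: "\<bar>\<rho> (z + x)\<bar> / (x \<bullet> x + e) \<le> ?g x" for x
  proof -
    let ?r = "\<bar>\<rho> (z + x)\<bar>" and ?i = "x \<bullet> x + e" and ?X = "(?\<chi> x)\<^sup>2"
    have "?r * (1 - ?X) \<le> ?r * (3/2 * (x \<bullet> x))" by (intro mult_left_mono unit_cutoff_range(3)) auto
    also have "\<dots> \<le> 3/2 * ?r * ?i" using e by (simp add: algebra_simps)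
    finally have 1: "?r * (1 - ?X) \<le> 3/2 * ?r * ?i" .
    have "2 * ?r \<le> ?r\<^sup>2 + 1" using zero_le_power2[of "?r - 1"] by (simp add: power2_diff)
    hence "2 * ?r * ?X \<le> (?r\<^sup>2 + 1) * ?X" by (intro mult_right_mono) auto
    hence "?r * ?X \<le> 1/2 * (?r\<^sup>2 * ?X) + 1/2 * ?X" by (simp add: distrib_right)
    moreover have "?r = ?r * (1 - ?X) + ?r * ?X" by (simp add: right_diff_distrib)
    ultimately have "?r \<le> 1/2 * (?r\<^sup>2 * ?X) + 1/2 * ?X + 3/2 * ?r * ?i" using 1 by linarith
    hence "?r / ?i \<le> (1/2 * (?r\<^sup>2 * ?X) + 1/2 * ?X + 3/2 * ?r * ?i) / ?i"
      using pos[of x] by (intro divide_right_mono) auto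
    also have "\<dots> = ?g x"
    proof -
      have "(1/2 * A + 1/2 * B + 3/2 * r * i) / i = 1/2 * (A / i) + 1/2 * (B / i) + 3/2 * r"
        if "0 < i" for A B r i :: real
        using that by (simp add: field_simps)
      note * = this
      show ?thesis
        unfolding *[OF pos[of x], of "?r\<^sup>2 * ?X" ?X ?r] by (simp only: power_mult_distrib power2_abs)
    qed
    finally show ?thesis .
  qed
  have i: "integrable lborel ?g"
    by (intro Bochner_Integration.integrable_add integrable_mult_right ig it)
  have gi: "(LINT x|lborel. 1/2 * A x + 1/2 * B x + 3/2 * C x)
      = 1/2 * (LINT x|lborel. A x) + 1/2 * (LINT x|lborel. B x) + 3/2 * (LINT x|lborel. C x)"
    if "integrable lborel A" "integrable lborel B" "integrable lborel C" for A B C :: "space \<Rightarrow> real"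
    using that by simp
  have m[measurable]: "(\<lambda>x. \<bar>\<rho> (z + x)\<bar> / (x \<bullet> x + e)) \<in> borel_measurable borel"
    by (intro borel_measurable_continuous_onI continuous_intros ct) (use pos in \<open>auto simp: less_imp_neq[symmetric]\<close>)
  show int: "integrable lborel (\<lambda>x. \<bar>\<rho> (z + x)\<bar> / (x \<bullet> x + e))"
  proof (rule Bochner_Integration.integrable_bound[OF i])
    show "AE x in lborel. norm (\<bar>\<rho> (z + x)\<bar> / (x \<bullet> x + e)) \<le> norm (?g x)"
    proof (rule AE_I2)
      fix x
      have "norm (\<bar>\<rho> (z + x)\<bar> / (x \<bullet> x + e)) = \<bar>\<rho> (z + x)\<bar> / (x \<bullet> x + e)" using pos[of x] by simp
      also have "\<dots> \<le> norm (?g x)"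
        unfolding real_norm_def by (rule order_trans[OF le abs_ge_self])
      finally show "norm (\<bar>\<rho> (z + x)\<bar> / (x \<bullet> x + e)) \<le> norm (?g x)" .
    qed
  qed simp
  have "(LINT x|lborel. \<bar>\<rho> (z + x)\<bar> / (x \<bullet> x + e)) \<le> (LINT x|lborel. ?g x)"
    by (rule integral_mono[OF int i le])
  also have "\<dots> = 1/2 * (LINT x|lborel. (?f x)\<^sup>2 / (x \<bullet> x + e)) + 1/2 * (LINT x|lborel. (?\<chi> x)\<^sup>2 / (x \<bullet> x + e))
      + 3/2 * (LINT x|lborel. \<bar>\<rho> x\<bar>)"
    by (simp only: gi[OF ig it(1)] tr)
  also have "\<dots> \<le> field_bound \<rho> d\<rho>"
  proof -
    have "0 \<le> cutoff_energy" by (simp add: cutoff_energy_def sum_nonneg)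
    thus ?thesis using h2 h3 by (simp add: field_bound_def)
  qed
  finally show "(LINT x|lborel. \<bar>\<rho> (z + x)\<bar> / (x \<bullet> x + e)) \<le> field_bound \<rho> d\<rho>" .
qed

lemma kernel_bound:
  shows "integrable lborel (\<lambda>y. \<bar>\<rho> y\<bar> / (norm (z - y))\<^sup>2)"
    "(LINT y|lborel. \<bar>\<rho> y\<bar> / (norm (z - y))\<^sup>2) \<le> field_bound \<rho> d\<rho>"
proof -
  define F where "F n x = \<bar>\<rho> (z + x)\<bar> / (x \<bullet> x + inverse (real (Suc n)))" for n x
  have ep: "0 < inverse (real (Suc n))" for n by simp
  have mono: "F m x \<le> F n x" if "m \<le> n" for m n x
    unfolding F_def using that inner_ge_zero[of x] ep[of n] ep[of m]
    by (intro divide_left_mono add_left_mono mult_pos_pos add_nonneg_pos le_imp_inverse_le) auto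
  \<comment> \<open>At the origin the limit has the default value 0, but a single point is negligible.\<close>
  have lim: "AE x in lborel. (\<lambda>n. F n x) \<longlonglongrightarrow> \<bar>\<rho> (z + x)\<bar> / (x \<bullet> x)"
    using AE_lborel_singleton[of 0]
  proof eventually_elim
    case (elim x)
    have "(\<lambda>n. F n x) \<longlonglongrightarrow> \<bar>\<rho> (z + x)\<bar> / (x \<bullet> x + 0)"
      unfolding F_def using elim by (intro tendsto_intros LIMSEQ_inverse_real_of_nat) auto
    thus ?case by simp
  qed
  have bd: "(LINT x|lborel. F n x) \<le> field_bound \<rho> d\<rho>" for n
    unfolding F_def by (rule regularised_kernel_bound[OF ep])
  have iF: "integrable lborel (F n)" for n unfolding F_def by (rule regularised_kernel_bound[OF ep])
  have inc: "incseq (\<lambda>n. LINT x|lborel. F n x)"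
    by (intro incseq_def[THEN iffD2] allI impI integral_mono iF mono)
  obtain l where l: "(\<lambda>n. LINT x|lborel. F n x) \<longlonglongrightarrow> l"
    using incseq_convergent[OF inc] bd by blast
  have m: "(\<lambda>x. \<bar>\<rho> (z + x)\<bar> / (x \<bullet> x)) \<in> borel_measurable lborel"
  proof -
    have [measurable]: "\<rho> \<in> borel_measurable borel" using \<rho>_cont by (intro borel_measurable_continuous_onI)
    show ?thesis by measurable
  qed
  have I: "integrable lborel (\<lambda>x. \<bar>\<rho> (z + x)\<bar> / (x \<bullet> x))" "(LINT x|lborel. \<bar>\<rho> (z + x)\<bar> / (x \<bullet> x)) = l"
    by (rule integrable_monotone_convergence[OF iF _ lim l m] integral_monotone_convergence[OF iF _ lim l m];
        auto intro!: AE_I2 simp: mono_def mono)+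
  let ?G = "\<lambda>y. \<bar>\<rho> y\<bar> / (norm (z - y))\<^sup>2"
  have G: "?G (z + x) = \<bar>\<rho> (z + x)\<bar> / (x \<bullet> x)" for x by (simp add: power2_norm_eq_inner)
  have [measurable]: "?G \<in> borel_measurable borel"
  proof -
    have [measurable]: "\<rho> \<in> borel_measurable borel" using \<rho>_cont by (intro borel_measurable_continuous_onI)
    show ?thesis by measurable
  qed
  show "integrable lborel ?G"
    using lborel_integrable_translate[OF I(1)[folded G], of "- z"] by simp
  have "(LINT y|lborel. ?G y) = l"
    using lborel_integral_translate[of ?G z] I(2) by (simp only: G) simp
  also have "l \<le> field_bound \<rho> d\<rho>" by (rule LIMSEQ_le_const2[OF l]) (use bd in blast)
  finally show "(LINT y|lborel. ?G y) \<le> field_bound \<rho> d\<rho>" .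
qed

text \<open>From \<open>\<bar>1 / a - 1 / b\<bar> \<le> \<bar>a - b\<bar> (1 / a\<^sup>2 + 1 / b\<^sup>2) / 2\<close> the difference quotients of the Newtonian
  potential are controlled by the kernel \<open>1 / \<bar>x\<bar>\<^sup>2\<close>. This bounds the gradient without
  differentiating a singular integral.\<close>

lemma inv_neg_laplacian_lipschitz:
  "\<bar>inv_neg_laplacian \<rho> x - inv_neg_laplacian \<rho> x'\<bar> \<le> field_bound \<rho> d\<rho> * norm (x - x')"
proof -
  have [measurable]: "\<rho> \<in> borel_measurable borel" using \<rho>_cont by (intro borel_measurable_continuous_onI)
  let ?N = "\<lambda>x y. \<rho> y / (4 * pi * norm (x - y))"
  have pi: "1 \<le> 4 * pi" using pi_gt3 by simp
  have iN: "integrable lborel (?N x)" for x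
  proof (rule Bochner_Integration.integrable_bound)
    show "integrable lborel (\<lambda>y. \<bar>\<rho> y\<bar> + \<bar>\<rho> y\<bar> / (norm (x - y))\<^sup>2)"
      using \<rho>_int kernel_bound(1) by simp
    have "1 / (4 * pi * n) \<le> 1 + 1 / n\<^sup>2" if "0 \<le> n" for n :: real
    proof (cases "n = 0")
      case False
      hence n: "0 < n" using that by simp
      have "1 / (4 * pi * n) \<le> 1 / (1 * n)" using n pi by (intro divide_left_mono mult_right_mono) auto
      also have "\<dots> \<le> 1 + (1 / n)\<^sup>2" using self_le_one_plus_square[of "1 / n"] by simp
      finally show ?thesis by (simp add: power_divide)
    qed simp
    from mult_left_mono[OF this, of "norm (x - _)" "\<bar>\<rho> _\<bar>"]
    show "AE y in lborel. norm (?N x y) \<le> norm (\<bar>\<rho> y\<bar> + \<bar>\<rho> y\<bar> / (norm (x - y))\<^sup>2)"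
      by (intro AE_I2) (simp add: abs_mult distrib_left)
  qed simp
  let ?B = "\<lambda>y. norm (x - x') / 2 * (\<bar>\<rho> y\<bar> / (norm (x - y))\<^sup>2 + \<bar>\<rho> y\<bar> / (norm (x' - y))\<^sup>2)"
  have "inv_neg_laplacian \<rho> x - inv_neg_laplacian \<rho> x' = (LINT y|lborel. ?N x y - ?N x' y)"
    unfolding inv_neg_laplacian_def using iN[of x] iN[of x'] by (simp add: Bochner_Integration.integral_diff)
  hence "\<bar>inv_neg_laplacian \<rho> x - inv_neg_laplacian \<rho> x'\<bar> \<le> (LINT y|lborel. \<bar>?N x y - ?N x' y\<bar>)"
    using integral_abs_bound[of lborel "\<lambda>y. ?N x y - ?N x' y"] by simp
  also have "\<dots> \<le> (LINT y|lborel. ?B y)"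
  proof (rule integral_mono_AE)
    show "integrable lborel (\<lambda>y. \<bar>?N x y - ?N x' y\<bar>)" using iN[of x] iN[of x'] by auto
    show "integrable lborel ?B" using kernel_bound(1)[of x] kernel_bound(1)[of x'] by simp
    show "AE y in lborel. \<bar>?N x y - ?N x' y\<bar> \<le> ?B y"
      using AE_lborel_singleton[of x] AE_lborel_singleton[of x']
    proof eventually_elim
      case (elim y)
      let ?a = "norm (x - y)" and ?b = "norm (x' - y)" and ?d = "norm (x - x')"
      have ab: "0 < ?a" "0 < ?b" using elim by auto
      have "\<bar>?b - ?a\<bar> \<le> ?d" using norm_triangle_ineq3[of "x' - y" "x - y"] by (simp add: norm_minus_commute)
      have "\<bar>1 / ?a - 1 / ?b\<bar> = \<bar>?b - ?a\<bar> * (1 / ?a * (1 / ?b))"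
        using ab by (simp add: field_simps abs_if)
      also have "\<dots> \<le> ?d * (((1 / ?a)\<^sup>2 + (1 / ?b)\<^sup>2) / 2)"
        using ab \<open>\<bar>?b - ?a\<bar> \<le> ?d\<close> zero_le_power2[of "1 / ?a - 1 / ?b"]
        by (intro mult_mono) (auto simp: power2_diff)
      finally have 1: "\<bar>1 / ?a - 1 / ?b\<bar> \<le> ?d / 2 * (1 / ?a\<^sup>2 + 1 / ?b\<^sup>2)" by (simp add: power_divide)
      have "\<bar>?N x y - ?N x' y\<bar> = \<bar>\<rho> y\<bar> * (\<bar>1 / ?a - 1 / ?b\<bar> / (4 * pi))"
      proof -
        have "?N x y - ?N x' y = \<rho> y * ((1 / ?a - 1 / ?b) / (4 * pi))"
          using ab by (simp add: field_simps)
        thus ?thesis by (simp add: abs_mult)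
      qed
      also have "\<dots> \<le> \<bar>\<rho> y\<bar> * (\<bar>1 / ?a - 1 / ?b\<bar> / 1)"
        using pi by (intro mult_left_mono divide_left_mono) auto
      also have "\<dots> \<le> \<bar>\<rho> y\<bar> * (?d / 2 * (1 / ?a\<^sup>2 + 1 / ?b\<^sup>2))"
        using 1 by (intro mult_left_mono) auto
      also have "\<dots> = ?B y" by (simp add: algebra_simps)
      finally show ?case .
    qed
  qed
  also have "\<dots> = norm (x - x') / 2 * ((LINT y|lborel. \<bar>\<rho> y\<bar> / (norm (x - y))\<^sup>2) + (LINT y|lborel. \<bar>\<rho> y\<bar> / (norm (x' - y))\<^sup>2))"
    using kernel_bound(1)[of x] kernel_bound(1)[of x'] by simp
  also have "\<dots> \<le> norm (x - x') / 2 * (field_bound \<rho> d\<rho> + field_bound \<rho> d\<rho>)"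
    by (intro mult_left_mono add_mono kernel_bound(2)) simp
  finally show ?thesis by (simp add: mult.commute)
qed

lemma field_pointwise_bound:
  assumes "\<And>j. has_partial j (inv_neg_laplacian \<rho>) (g $ j) x"
  shows "norm g \<le> 3 * field_bound \<rho> d\<rho>"
proof -
  have "\<bar>g $ j\<bar> \<le> field_bound \<rho> d\<rho>" for j
  proof -
    have "((\<lambda>h. (inv_neg_laplacian \<rho> (x + h *\<^sub>R axis j 1) - inv_neg_laplacian \<rho> x) / h) \<longlongrightarrow> g $ j) (at 0)"
      using assms[of j] by (simp add: has_partial_def has_field_derivative_iff)
    hence "((\<lambda>h. \<bar>(inv_neg_laplacian \<rho> (x + h *\<^sub>R axis j 1) - inv_neg_laplacian \<rho> x) / h\<bar>) \<longlongrightarrow> \<bar>g $ j\<bar>) (at 0)"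
      by (rule tendsto_rabs)
    moreover have "\<forall>\<^sub>F h in at 0. \<bar>(inv_neg_laplacian \<rho> (x + h *\<^sub>R axis j 1) - inv_neg_laplacian \<rho> x) / h\<bar> \<le> field_bound \<rho> d\<rho>"
    proof (rule eventually_at_filter[THEN iffD2], rule always_eventually, intro allI impI)
      fix h :: real assume "h \<noteq> 0"
      thus "\<bar>(inv_neg_laplacian \<rho> (x + h *\<^sub>R axis j 1) - inv_neg_laplacian \<rho> x) / h\<bar> \<le> field_bound \<rho> d\<rho>"
        using inv_neg_laplacian_lipschitz[of "x + h *\<^sub>R axis j 1" x] by (simp add: field_simps)
    qed
    ultimately show ?thesis by (rule tendsto_upperbound) simp
  qed
  hence "(\<Sum>j\<in>UNIV. \<bar>g $ j\<bar>) \<le> (\<Sum>j\<in>(UNIV :: 3 set). field_bound \<rho> d\<rho>)" by (intro sum_mono)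
  thus ?thesis using norm_le_l1_cart[of g] by simp
qed

end

text \<open>The projection \<open>g\<close> is itself divergence free, hence orthogonal to \<open>f - g\<close>, and
  \<open>\<integral> \<bar>g\<bar>\<^sup>2 = \<integral> f \<bullet> g\<close>.\<close>

lemma leray_projection_contracts:
  assumes "leray_projection f g"
  shows "integrable lborel (\<lambda>x. (norm (g x))\<^sup>2)" "(LINT x|lborel. (norm (g x))\<^sup>2) \<le> (LINT x|lborel. (norm (f x))\<^sup>2)"
proof -
  have f: "square_integrable f" and g: "solenoidal g" and o: "(LINT x|lborel. (f x - g x) \<bullet> g x) = 0"
    using assms by (auto simp: leray_projection_def)
  have g2: "square_integrable g" using g by (simp add: solenoidal_def)
  have m[measurable]: "f \<in> borel_measurable borel" "g \<in> borel_measurable borel"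
    and i: "integrable lborel (\<lambda>x. (norm (f x))\<^sup>2)" "integrable lborel (\<lambda>x. (norm (g x))\<^sup>2)"
    using f g2 by (auto simp: square_integrable_def)
  show "integrable lborel (\<lambda>x. (norm (g x))\<^sup>2)" by (rule i)
  have le: "\<bar>v \<bullet> w\<bar> \<le> (norm v)\<^sup>2 / 2 + (norm w)\<^sup>2 / 2" for v w :: space
    using Cauchy_Schwarz_ineq2[of v w] zero_le_power2[of "norm v - norm w"] by (simp add: power2_diff)
  have ifg: "integrable lborel (\<lambda>x. f x \<bullet> g x)"
  proof (rule Bochner_Integration.integrable_bound)
    show "integrable lborel (\<lambda>x. (norm (f x))\<^sup>2 / 2 + (norm (g x))\<^sup>2 / 2)" using i by simp
    show "AE x in lborel. norm (f x \<bullet> g x) \<le> norm ((norm (f x))\<^sup>2 / 2 + (norm (g x))\<^sup>2 / 2)"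
      using le by (intro AE_I2) simp
  qed simp
  have "(LINT x|lborel. (f x - g x) \<bullet> g x) = (LINT x|lborel. f x \<bullet> g x) - (LINT x|lborel. (norm (g x))\<^sup>2)"
    using ifg i by (simp add: inner_diff_left power2_norm_eq_inner)
  hence "(LINT x|lborel. (norm (g x))\<^sup>2) = (LINT x|lborel. f x \<bullet> g x)" using o by simp
  also have "\<dots> \<le> (LINT x|lborel. (norm (f x))\<^sup>2 / 2 + (norm (g x))\<^sup>2 / 2)"
    using ifg i le by (intro integral_mono) (auto simp: abs_le_iff)
  also have "\<dots> = (LINT x|lborel. (norm (f x))\<^sup>2) / 2 + (LINT x|lborel. (norm (g x))\<^sup>2) / 2"
    using i by simp
  finally show "(LINT x|lborel. (norm (g x))\<^sup>2) \<le> (LINT x|lborel. (norm (f x))\<^sup>2)" by simp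
qed

section \<open>Convex functions of linear growth\<close>

text \<open>A smooth convex approximation of the absolute value, within distance \<open>a\<close> of it, followed by its
  first and second derivative.\<close>

definition soft_abs :: "real \<Rightarrow> real \<Rightarrow> real" where "soft_abs a s = sqrt (s\<^sup>2 + a\<^sup>2) - a"
definition soft_abs1 :: "real \<Rightarrow> real \<Rightarrow> real" where "soft_abs1 a s = s / sqrt (s\<^sup>2 + a\<^sup>2)"
definition soft_abs2 :: "real \<Rightarrow> real \<Rightarrow> real" where "soft_abs2 a s = a\<^sup>2 / sqrt (s\<^sup>2 + a\<^sup>2) ^ 3"

lemma sqrt_sum_pos: "0 < a \<Longrightarrow> 0 < s\<^sup>2 + a\<^sup>2" for a s :: real
  by (rule add_nonneg_pos) auto

lemma DERIV_soft_abs: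
  assumes a: "0 < a"
  shows "(soft_abs a has_real_derivative soft_abs1 a s) (at s)"
    "(soft_abs1 a has_real_derivative soft_abs2 a s) (at s)"
    "continuous_on UNIV (soft_abs2 a)"
proof -
  note p = sqrt_sum_pos[OF a]
  let ?q = "sqrt (s\<^sup>2 + a\<^sup>2)"
  have q: "0 < ?q" "?q\<^sup>2 = s\<^sup>2 + a\<^sup>2"
    by (rule real_sqrt_gt_zero[OF p], rule real_sqrt_pow2[OF less_imp_le[OF p]])
  have i: "((\<lambda>s. s\<^sup>2 + a\<^sup>2) has_real_derivative 2 * s) (at s)"
    by (rule DERIV_add[OF DERIV_pow DERIV_const, THEN DERIV_cong]) simp
  have d: "((\<lambda>s. sqrt (s\<^sup>2 + a\<^sup>2)) has_real_derivative s / ?q) (at s)"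
  proof -
    have e: "inverse r / 2 * (2 * s) = s / r" for r :: real
      by (cases "r = 0") (simp_all add: field_simps)
    have r: "(sqrt has_real_derivative inverse ?q / 2) (at (s\<^sup>2 + a\<^sup>2))"
      by (rule DERIV_real_sqrt[OF p])
    show ?thesis
      using DERIV_chain2[where f = sqrt and g = "\<lambda>s. s\<^sup>2 + a\<^sup>2" and x = s, OF r i] unfolding e .
  qed
  show "(soft_abs a has_real_derivative soft_abs1 a s) (at s)"
    unfolding soft_abs_def[abs_def] soft_abs1_def using DERIV_diff[OF d DERIV_const, of a] by (simp only: diff_0_right)
  have "((\<lambda>s. s / sqrt (s\<^sup>2 + a\<^sup>2)) has_real_derivative (1 * ?q - s * (s / ?q)) / (?q * ?q)) (at s)"
    by (rule DERIV_divide[OF DERIV_ident d less_imp_neq[OF q(1), symmetric]])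
  also have "(1 * ?q - s * (s / ?q)) / (?q * ?q) = soft_abs2 a s"
  proof -
    have "(1 * p - s * (s / p)) / (p * p) = (p\<^sup>2 - s\<^sup>2) / p ^ 3" if "0 < p" for p
    proof -
      have "1 * p - s * (s / p) = (p\<^sup>2 - s\<^sup>2) / p"
        using that by (simp add: diff_divide_distrib power2_eq_square)
      thus ?thesis by (simp only: divide_divide_eq_left power3_eq_cube mult.assoc)
    qed
    from this[OF q(1)] have "(1 * ?q - s * (s / ?q)) / (?q * ?q) = (?q\<^sup>2 - s\<^sup>2) / ?q ^ 3" .
    also have "?q\<^sup>2 - s\<^sup>2 = a\<^sup>2" unfolding q(2) by (rule add_diff_cancel_left')
    finally show ?thesis by (simp only: soft_abs2_def)
  qed
  finally show "(soft_abs1 a has_real_derivative soft_abs2 a s) (at s)" unfolding soft_abs1_def[abs_def] .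
  show "continuous_on UNIV (soft_abs2 a)" unfolding soft_abs2_def[abs_def]
  proof (rule continuous_on_divide[OF continuous_on_const], rule continuous_on_power,
      rule continuous_on_compose2[OF continuous_on_real_sqrt[OF continuous_on_id, of UNIV]], intro continuous_intros, rule subset_UNIV, rule ballI)
    fix s
    have "sqrt (s\<^sup>2 + a\<^sup>2) \<noteq> 0" by (rule less_imp_neq[OF real_sqrt_gt_zero[OF p], symmetric])
    thus "sqrt (s\<^sup>2 + a\<^sup>2) ^ 3 \<noteq> 0" by (rule power_not_zero)
  qed
qed

lemma soft_abs_bounds:
  assumes a: "0 < a"
  shows "\<bar>s\<bar> - a \<le> soft_abs a s" "0 \<le> soft_abs a s" "soft_abs a s \<le> \<bar>s\<bar>" "0 \<le> soft_abs2 a s"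
proof -
  have "\<bar>s\<bar> \<le> sqrt (s\<^sup>2 + a\<^sup>2)" by (rule real_le_rsqrt) simp
  thus "\<bar>s\<bar> - a \<le> soft_abs a s" by (simp add: soft_abs_def)
  have "a \<le> sqrt (s\<^sup>2 + a\<^sup>2)" by (rule real_le_rsqrt) simp
  thus "0 \<le> soft_abs a s" by (simp add: soft_abs_def)
  have "s\<^sup>2 + a\<^sup>2 \<le> (\<bar>s\<bar> + a)\<^sup>2" using a by (simp add: power2_sum)
  hence "sqrt (s\<^sup>2 + a\<^sup>2) \<le> \<bar>s\<bar> + a" using a by (intro real_le_lsqrt) auto
  thus "soft_abs a s \<le> \<bar>s\<bar>" by (simp add: soft_abs_def)
  show "0 \<le> soft_abs2 a s" by (simp add: soft_abs2_def)
qed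

text \<open>The factor \<open>s \<beta>'(s) - \<beta>(s)\<close> of the compression term is bounded by \<open>a\<close>, so that this term
  disappears with \<open>a\<close>.\<close>

lemma soft_abs_compression:
  assumes a: "0 < a"
  shows "s * soft_abs1 a s - soft_abs a s = a - a\<^sup>2 / sqrt (s\<^sup>2 + a\<^sup>2)"
    "0 \<le> s * soft_abs1 a s - soft_abs a s" "s * soft_abs1 a s - soft_abs a s \<le> a"
proof -
  let ?q = "sqrt (s\<^sup>2 + a\<^sup>2)"
  have q: "0 < ?q" "?q * ?q = s\<^sup>2 + a\<^sup>2" using sqrt_sum_pos[OF a, of s] by auto
  have "s * (s / p) - (p - a) = (s\<^sup>2 - p * p) / p + a" if "0 < p" for p
    using that by (simp add: field_simps power2_eq_square)
  from this[OF q(1)] have "s * (s / ?q) - (?q - a) = (s\<^sup>2 - ?q * ?q) / ?q + a" .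
  thus eq: "s * soft_abs1 a s - soft_abs a s = a - a\<^sup>2 / ?q"
    unfolding q(2) by (simp add: soft_abs1_def soft_abs_def)
  have aq: "a \<le> ?q" by (rule real_le_rsqrt) simp
  have "a\<^sup>2 / ?q \<le> a" using mult_left_mono[OF aq, of a] a q(1) by (simp add: power2_eq_square field_simps)
  thus "0 \<le> s * soft_abs1 a s - soft_abs a s" unfolding eq by simp
  show "s * soft_abs1 a s - soft_abs a s \<le> a" unfolding eq using q(1) by simp
qed

lemma soft_abs_compression_mono:
  assumes a: "0 < a" and st: "0 \<le> s" "0 \<le> t"
  shows "0 \<le> ((s * soft_abs1 a s - soft_abs a s) - (t * soft_abs1 a t - soft_abs a t)) * (s - t)"
proof -
  have mono: "s * soft_abs1 a s - soft_abs a s \<le> t * soft_abs1 a t - soft_abs a t" if "0 \<le> s" "s \<le> t" for s t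
  proof -
    have "sqrt (s\<^sup>2 + a\<^sup>2) \<le> sqrt (t\<^sup>2 + a\<^sup>2)" using that by (simp add: power_mono)
    hence "a\<^sup>2 / sqrt (t\<^sup>2 + a\<^sup>2) \<le> a\<^sup>2 / sqrt (s\<^sup>2 + a\<^sup>2)"
      using sqrt_sum_pos[OF a, of s] by (intro frac_le) auto
    thus ?thesis unfolding soft_abs_compression(1)[OF a] by simp
  qed
  show ?thesis
  proof (cases "s \<le> t")
    case True
    thus ?thesis using mono[OF st(1) True] by (intro mult_nonpos_nonpos) auto
  next
    case False
    thus ?thesis using mono[OF st(2), of s] by (intro mult_nonneg_nonneg) auto
  qed
qed

text \<open>For large \<open>a\<close> the function \<open>2 a soft_abs a\<close> is comparable to the square.\<close>

lemma soft_square_bounds: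
  assumes a: "0 < a"
  shows "2 * a * soft_abs a s \<le> s\<^sup>2"
    "\<bar>s\<bar> \<le> a / 2 \<Longrightarrow> s\<^sup>2 / 2 \<le> 2 * a * soft_abs a s" "\<bar>s\<bar> \<le> a / 2 \<Longrightarrow> 1 \<le> 2 * a * soft_abs2 a s"
proof -
  let ?q = "sqrt (s\<^sup>2 + a\<^sup>2)"
  have q: "0 < ?q" "?q\<^sup>2 = s\<^sup>2 + a\<^sup>2" using sqrt_sum_pos[OF a, of s] by auto
  have aq: "a \<le> ?q" by (rule real_le_rsqrt) simp
  have f: "soft_abs a s * (?q + a) = s\<^sup>2" using q(2) by (simp add: soft_abs_def algebra_simps power2_eq_square)
  have "soft_abs a s * (2 * a) \<le> soft_abs a s * (?q + a)"
    using aq soft_abs_bounds(2)[OF a] by (intro mult_left_mono) auto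
  thus "2 * a * soft_abs a s \<le> s\<^sup>2" unfolding f by (simp add: mult_ac)
  assume s: "\<bar>s\<bar> \<le> a / 2"
  hence "\<bar>s\<bar>\<^sup>2 \<le> (a / 2)\<^sup>2" by (intro power_mono) auto
  hence s2: "s\<^sup>2 \<le> a\<^sup>2 / 4" by (simp add: power_divide)
  have "(5/4 * a)\<^sup>2 = 25/16 * a\<^sup>2" by (simp add: power_mult_distrib power_divide)
  hence "s\<^sup>2 + a\<^sup>2 \<le> (5/4 * a)\<^sup>2" using s2 zero_le_power2[of a] by linarith
  hence qa: "?q \<le> 5/4 * a" using a by (intro real_le_lsqrt) auto
  have "soft_abs a s * (?q + a) \<le> soft_abs a s * (4 * a)"
    using qa a soft_abs_bounds(2)[OF a] by (intro mult_left_mono) auto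
  thus "s\<^sup>2 / 2 \<le> 2 * a * soft_abs a s" unfolding f by (simp add: mult_ac)
  have "?q ^ 3 \<le> (5/4 * a) ^ 3" using qa q(1) by (intro power_mono) auto
  also have "\<dots> \<le> 2 * a * a\<^sup>2" using a by (simp add: power_mult_distrib power_divide power2_eq_square power3_eq_cube)
  finally show "1 \<le> 2 * a * soft_abs2 a s" using q(1) by (simp add: soft_abs2_def)
qed

section \<open>Fluxes against slowly varying weights\<close>

locale radial_drift_diffusion = drift_diffusion + radial_weight +
  fixes \<beta> \<beta>1 \<beta>2 :: "real \<Rightarrow> real"
  assumes \<beta>': "\<And>s. (\<beta> has_real_derivative \<beta>1 s) (at s)" "\<And>s. (\<beta>1 has_real_derivative \<beta>2 s) (at s)"
    "continuous_on UNIV \<beta>2"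
begin

sublocale weighted_drift_diffusion D c ct dc ddc V dV w dw ddw R \<beta> \<beta>1 \<beta>2
  by unfold_locales (rule \<beta>')+

lemma integral_transport_le:
  assumes D: "0 \<le> D" and k: "\<And>s. \<bar>\<beta> s\<bar> \<le> k * \<bar>s\<bar>" "0 \<le> k" and t: "0 < t"
    and i: "integrable lborel (\<lambda>x. \<bar>c t x\<bar> * (D + norm (V t x)))"
    and B: "(LINT x|lborel. \<bar>c t x\<bar> * (D + norm (V t x))) \<le> B"
  shows "\<bar>LINT x|lborel. transport t x\<bar> \<le> k * \<kappa> * B"
proof -
  have "\<bar>LINT x|lborel. transport t x\<bar> \<le> (LINT x|lborel. \<bar>transport t x\<bar>)" by (rule integral_abs_bound)
  also have "\<dots> \<le> (LINT x|lborel. k * \<kappa> * (\<bar>c t x\<bar> * (D + norm (V t x))))"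
  proof (rule integral_mono)
    show "integrable lborel (\<lambda>x. \<bar>transport t x\<bar>)" using integrable_terms(1)[OF t] by simp
    show "integrable lborel (\<lambda>x. k * \<kappa> * (\<bar>c t x\<bar> * (D + norm (V t x))))" using i by simp
    fix x
    have "\<bar>transport t x\<bar> \<le> (k * \<bar>c t x\<bar>) * (\<kappa> * (D + norm (V t x)))"
      unfolding transport_def abs_mult using k(2) D
      by (intro mult_mono k(1) transport_bound) auto
    thus "\<bar>transport t x\<bar> \<le> k * \<kappa> * (\<bar>c t x\<bar> * (D + norm (V t x)))" by (simp add: mult_ac)
  qed
  also have "\<dots> = k * \<kappa> * (LINT x|lborel. \<bar>c t x\<bar> * (D + norm (V t x)))" by simp
  also have "\<dots> \<le> k * \<kappa> * B" using B k(2) kappa_nonneg by (intro mult_left_mono) auto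
  finally show ?thesis .
qed

end

text \<open>The derivative of \<open>F\<close> is only assumed to exist and to be bounded at each time; the fundamental theorem
  of calculus in the sense of Henstock and Kurzweil integrates it without further regularity.\<close>

lemma growth_le_integral:
  fixes F h :: "real \<Rightarrow> real"
  assumes d: "\<And>\<tau>. s \<le> \<tau> \<Longrightarrow> \<tau> \<le> t \<Longrightarrow> \<exists>F'. (F has_real_derivative F') (at \<tau>) \<and> F' \<le> h \<tau>"
    and h: "(h has_integral H) {s..t}" and st: "s \<le> t"
  shows "F t \<le> F s + H"
proof -
  define F' where "F' \<tau> = (SOME y. (F has_real_derivative y) (at \<tau>) \<and> y \<le> h \<tau>)" for \<tau>
  have F': "(F has_real_derivative F' \<tau>) (at \<tau>)" "F' \<tau> \<le> h \<tau>" if "s \<le> \<tau>" "\<tau> \<le> t" for \<tau>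
    using someI_ex[OF d[OF that]] unfolding F'_def by auto
  have "(F' has_integral F t - F s) {s..t}"
    by (rule fundamental_theorem_of_calculus[OF st])
       (use F'(1) in \<open>auto simp: has_real_derivative_iff_has_vector_derivative intro: has_vector_derivative_at_within\<close>)
  from has_integral_le[OF this h] F'(2) have "F t - F s \<le> H" by auto
  thus ?thesis by simp
qed

lemma growth_le:
  fixes F :: "real \<Rightarrow> real"
  assumes "\<And>\<tau>. s \<le> \<tau> \<Longrightarrow> \<tau> \<le> t \<Longrightarrow> \<exists>F'. (F has_real_derivative F') (at \<tau>) \<and> F' \<le> M" and "s \<le> t"
  shows "F t \<le> F s + M * (t - s)"
proof -
  have "((\<lambda>_. M) has_integral M * (t - s)) {s..t}"
    using has_integral_const_real[of M s t] assms(2) by (simp add: mult.commute)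
  thus ?thesis using growth_le_integral[where F = F and h = "\<lambda>_. M", OF assms(1) _ assms(2)] by simp
qed

lemma le_of_le_add_divide:
  fixes X Y C :: real
  assumes "\<And>R. r \<le> R \<Longrightarrow> X \<le> Y + C / R"
  shows "X \<le> Y"
proof (rule tendsto_lowerbound)
  show "((\<lambda>R. Y + C / R) \<longlongrightarrow> Y) at_top"
    using tendsto_add[OF tendsto_const[of Y] tendsto_divide_0[OF tendsto_const filterlim_at_top_imp_at_infinity[OF filterlim_ident]], of C]
    by simp
  show "\<forall>\<^sub>F R in at_top. X \<le> Y + C / R"
    using assms by (auto simp: eventually_at_top_linorder)
qed simp

lemma le_of_le_add_mult:
  fixes X Y C :: real
  assumes "\<And>a. 0 < a \<Longrightarrow> X \<le> Y + a * C"
  shows "X \<le> Y"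
proof (rule le_of_le_add_divide[where r = 1 and C = C])
  fix R :: real assume "1 \<le> R"
  thus "X \<le> Y + C / R" using assms[of "1 / R"] by simp
qed

definition chi :: "real \<Rightarrow> space \<Rightarrow> real" where "chi R x = cutoff R (x \<bullet> x)"

lemma chi_range: "0 < R \<Longrightarrow> 0 \<le> chi R x" "0 < R \<Longrightarrow> chi R x \<le> 1"
  by (simp_all add: chi_def cutoff_range)

lemma chi_mono: "0 < R \<Longrightarrow> R \<le> R' \<Longrightarrow> chi R x \<le> chi R' x"
  by (simp add: chi_def cutoff_mono)

lemma chi_continuous: "continuous_on UNIV (chi R)"
  unfolding chi_def[abs_def] cutoff_def divide_inverse by (intro continuous_intros)

lemma chi_support: "0 < R \<Longrightarrow> R < norm x \<Longrightarrow> chi R x = 0"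
  unfolding chi_def by (rule cutoff_support) (auto simp: power2_norm_eq_inner[symmetric] intro!: power_strict_mono)

lemma chi_tendsto: "(\<lambda>n. chi (real (Suc n)) x) \<longlonglongrightarrow> 1"
proof -
  have "(\<lambda>n. (inverse (real (Suc n)))) \<longlonglongrightarrow> 0" by (rule LIMSEQ_inverse_real_of_nat)
  hence "(\<lambda>n. (max 0 (1 - x \<bullet> x * (inverse (real (Suc n)))\<^sup>2)) ^ 3) \<longlonglongrightarrow> (max 0 (1 - x \<bullet> x * 0\<^sup>2)) ^ 3"
    by (intro tendsto_intros)
  thus ?thesis by (simp add: chi_def cutoff_def divide_inverse power_inverse)
qed

text \<open>Monotone convergence along the cutoffs.\<close>

lemma integrable_chi_limit:
  fixes f :: "space \<Rightarrow> real"
  assumes f: "\<And>x. 0 \<le> f x" and m: "f \<in> borel_measurable borel"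
    and i: "\<And>R. 1 \<le> R \<Longrightarrow> integrable lborel (\<lambda>x. f x * chi R x)"
    and le: "\<And>R. 1 \<le> R \<Longrightarrow> (LINT x|lborel. f x * chi R x) \<le> B"
  shows "integrable lborel f" "(LINT x|lborel. f x) \<le> B"
    "(\<lambda>n. LINT x|lborel. f x * chi (real (Suc n)) x) \<longlonglongrightarrow> (LINT x|lborel. f x)"
proof -
  let ?g = "\<lambda>n x. f x * chi (real (Suc n)) x"
  have mono: "?g m x \<le> ?g n x" if "m \<le> n" for m n x
    using that by (intro mult_left_mono chi_mono f) auto
  have ig: "integrable lborel (?g n)" for n by (rule i) simp
  have bd: "(LINT x|lborel. ?g n x) \<le> B" for n by (rule le) simp
  have inc: "incseq (\<lambda>n. LINT x|lborel. ?g n x)"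
    by (intro incseq_def[THEN iffD2] allI impI integral_mono ig mono)
  obtain l where l: "(\<lambda>n. LINT x|lborel. ?g n x) \<longlonglongrightarrow> l"
    using incseq_convergent[OF inc] bd by blast
  have lim: "AE x in lborel. (\<lambda>n. ?g n x) \<longlonglongrightarrow> f x"
    using tendsto_mult[OF tendsto_const chi_tendsto] by (intro AE_I2) simp
  have mono': "AE x in lborel. mono (\<lambda>n. ?g n x)" by (intro AE_I2 monoI mono)
  have m': "f \<in> borel_measurable lborel" using m by simp
  show I: "integrable lborel f"
    by (rule integrable_monotone_convergence[OF ig mono' lim l m'])
  have L: "(LINT x|lborel. f x) = l"
    by (rule integral_monotone_convergence[OF ig mono' lim l m'])
  show "(LINT x|lborel. f x) \<le> B" unfolding L by (rule LIMSEQ_le_const2[OF l]) (use bd in blast)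
  show "(\<lambda>n. LINT x|lborel. ?g n x) \<longlonglongrightarrow> (LINT x|lborel. f x)" using l L by simp
qed

section \<open>Solutions of the Nernst--Planck--Darcy system\<close>

lemma integrable_sum_square:
  fixes f :: "'i \<Rightarrow> space \<Rightarrow> real"
  assumes fin: "finite I" and m: "\<And>i. i \<in> I \<Longrightarrow> f i \<in> borel_measurable borel"
    and i: "\<And>i. i \<in> I \<Longrightarrow> integrable lborel (\<lambda>x. (f i x)\<^sup>2)"
  shows "integrable lborel (\<lambda>x. (\<Sum>i\<in>I. f i x)\<^sup>2)"
    "(LINT x|lborel. (\<Sum>i\<in>I. f i x)\<^sup>2) \<le> real (card I) * (\<Sum>i\<in>I. LINT x|lborel. (f i x)\<^sup>2)"
proof -
  have le: "(\<Sum>i\<in>I. f i x)\<^sup>2 \<le> (\<Sum>i\<in>I. (f i x)\<^sup>2) * real (card I)" for x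
    using sum_squared_le_sum_of_squares[of "\<lambda>i. f i x" I] fin by simp
  have i': "integrable lborel (\<lambda>x. (\<Sum>i\<in>I. (f i x)\<^sup>2) * real (card I))"
    using i by (intro integrable_mult_left Bochner_Integration.integrable_sum)
  have [measurable]: "(\<lambda>x. (\<Sum>i\<in>I. f i x)) \<in> borel_measurable borel" using m by (intro borel_measurable_sum)
  show I: "integrable lborel (\<lambda>x. (\<Sum>i\<in>I. f i x)\<^sup>2)"
    by (rule Bochner_Integration.integrable_bound[OF i'])
       (use le in \<open>auto intro!: AE_I2 order_trans[OF le abs_ge_self] simp: borel_measurable_sum\<close>)
  have "(LINT x|lborel. (\<Sum>i\<in>I. f i x)\<^sup>2) \<le> (LINT x|lborel. (\<Sum>i\<in>I. (f i x)\<^sup>2) * real (card I))"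
    by (rule integral_mono[OF I i' le])
  also have "\<dots> = real (card I) * (\<Sum>i\<in>I. LINT x|lborel. (f i x)\<^sup>2)"
    using i by (simp add: Bochner_Integration.integral_sum mult.commute)
  finally show "(LINT x|lborel. (\<Sum>i\<in>I. f i x)\<^sup>2) \<le> real (card I) * (\<Sum>i\<in>I. LINT x|lborel. (f i x)\<^sup>2)" .
qed

lemma integral_abs_sum_le:
  fixes f :: "'i \<Rightarrow> space \<Rightarrow> real"
  assumes i: "\<And>i. i \<in> I \<Longrightarrow> integrable lborel (f i)"
  shows "(LINT x|lborel. \<bar>(\<Sum>i\<in>I. f i x)\<bar>) \<le> (\<Sum>i\<in>I. LINT x|lborel. \<bar>f i x\<bar>)"
proof -
  have "(LINT x|lborel. \<bar>(\<Sum>i\<in>I. f i x)\<bar>) \<le> (LINT x|lborel. (\<Sum>i\<in>I. \<bar>f i x\<bar>))"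
    using i by (intro integral_mono sum_abs integrable_abs Bochner_Integration.integrable_sum)
  also have "\<dots> = (\<Sum>i\<in>I. LINT x|lborel. \<bar>f i x\<bar>)" using i by (intro Bochner_Integration.integral_sum integrable_abs)
  finally show ?thesis .
qed

lemma locally_bounded_imp_bounded:
  fixes g :: "real \<Rightarrow> real"
  assumes "\<And>s. 0 \<le> s \<Longrightarrow> \<exists>M. \<forall>\<^sub>F t in at s within {0..}. g t \<le> M"
  shows "\<exists>K. \<forall>t\<in>{0..T}. g t \<le> K"
proof -
  have "\<exists>U M. open U \<and> s \<in> U \<and> (\<forall>t\<in>U \<inter> {0..}. g t \<le> M)" if "s \<in> {0..T}" for s
  proof -
    have "0 \<le> s" using that by simp
    from assms[OF this] obtain M where "\<forall>\<^sub>F t in at s within {0..}. g t \<le> M" by blast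
    then obtain U where U: "open U" "s \<in> U" "\<And>t. t \<in> U \<Longrightarrow> t \<noteq> s \<Longrightarrow> t \<in> {0..} \<Longrightarrow> g t \<le> M"
      unfolding eventually_at_topological by blast
    have "\<forall>t\<in>U \<inter> {0..}. g t \<le> max M (g s)"
    proof
      fix t assume "t \<in> U \<inter> {0..}"
      thus "g t \<le> max M (g s)" using U(3)[of t] by (cases "t = s") (auto simp: le_max_iff_disj)
    qed
    thus ?thesis using U by blast
  qed
  then obtain U M where UM: "\<And>s. s \<in> {0..T} \<Longrightarrow> open (U s)" "\<And>s. s \<in> {0..T} \<Longrightarrow> s \<in> U s"
    "\<And>s t. s \<in> {0..T} \<Longrightarrow> t \<in> U s \<Longrightarrow> t \<in> {0..} \<Longrightarrow> g t \<le> M s"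
    by (metis IntI)
  have "{0..T} \<subseteq> (\<Union>s\<in>{0..T}. U s)" using UM(2) by blast
  then obtain S where S: "S \<subseteq> {0..T}" "finite S" "{0..T} \<subseteq> (\<Union>s\<in>S. U s)"
    using compactE_image[OF compact_Icc, of "{0..T}" U 0 T] UM(1) by metis
  have "g t \<le> (\<Sum>s\<in>S. \<bar>M s\<bar>)" if t: "t \<in> {0..T}" for t
  proof -
    obtain s where s: "s \<in> S" "t \<in> U s" using S(3) t by blast
    have "g t \<le> M s" using UM(3)[of s t] S(1) s t by auto
    also have "\<dots> \<le> \<bar>M s\<bar>" by simp
    also have "\<dots> \<le> (\<Sum>s\<in>S. \<bar>M s\<bar>)" using s S by (intro member_le_sum) auto
    finally show ?thesis .
  qed
  thus ?thesis by blast
qed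

locale npd =
  fixes D zabs :: real and z :: "'n::finite \<Rightarrow> real" and c0 :: "'n \<Rightarrow> space \<Rightarrow> real"
    and c :: "'n \<Rightarrow> real \<Rightarrow> space \<Rightarrow> real" and u :: "real \<Rightarrow> space \<Rightarrow> space" and p \<phi> :: "real \<Rightarrow> space \<Rightarrow> real"
  assumes D: "0 < D" and valence: "\<And>i. \<bar>z i\<bar> = zabs"
    and data: "admissible_data z c0" and sol: "npd_solution D z c0 c u p \<phi>"
begin

lemma zabs_nonneg: "0 \<le> zabs"
  using valence[of undefined] abs_ge_zero by metis

lemma smooth: "smooth_on spacetime (\<lambda>(t, x). c i t x)" "smooth_on spacetime (\<lambda>(t, x). u t x)"
  "smooth_on spacetime (\<lambda>(t, x). \<phi> t x)"
  using sol by (auto simp: npd_solution_def)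

definition ct :: "'n \<Rightarrow> real \<Rightarrow> space \<Rightarrow> real" where
  "ct i t x = tm_deriv (\<lambda>(t, x). c i t x) (t, x)"
definition dc :: "'n \<Rightarrow> 3 \<Rightarrow> real \<Rightarrow> space \<Rightarrow> real" where
  "dc i j t x = sp_deriv j (\<lambda>(t, x). c i t x) (t, x)"
definition ddc :: "'n \<Rightarrow> 3 \<Rightarrow> real \<Rightarrow> space \<Rightarrow> real" where
  "ddc i j t x = sp_deriv j (sp_deriv j (\<lambda>(t, x). c i t x)) (t, x)"
definition E :: "real \<Rightarrow> space \<Rightarrow> space" where
  "E t x = (\<chi> j. sp_deriv j (\<lambda>(t, x). \<phi> t x) (t, x))"
definition dE :: "3 \<Rightarrow> real \<Rightarrow> space \<Rightarrow> real" where
  "dE j t x = sp_deriv j (sp_deriv j (\<lambda>(t, x). \<phi> t x)) (t, x)"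
definition V :: "real \<Rightarrow> real \<Rightarrow> space \<Rightarrow> space" where
  "V k t x = (k * D) *\<^sub>R E t x - u t x"
definition dV :: "real \<Rightarrow> 3 \<Rightarrow> real \<Rightarrow> space \<Rightarrow> real" where
  "dV k j t x = k * D * dE j t x - sp_deriv j (\<lambda>(t, x). u t x) (t, x) $ j"
definition \<rho> :: "real \<Rightarrow> space \<Rightarrow> real" where
  "\<rho> t x = (\<Sum>i\<in>UNIV. z i * c i t x)"
definition d\<rho> :: "3 \<Rightarrow> real \<Rightarrow> space \<Rightarrow> real" where
  "d\<rho> j t x = (\<Sum>i\<in>UNIV. z i * dc i j t x)"

lemma jcont_c: "jcont (c i)" "jcont (ct i)" "jcont (dc i j)" "jcont (ddc i j)"
  unfolding ct_def[abs_def] dc_def[abs_def] ddc_def[abs_def]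
  using jcont_smooth[OF smooth(1)[of i]] jcont_smooth[OF smooth_tm_deriv[OF smooth(1)[of i]]]
    jcont_smooth[OF smooth_sp_deriv[OF smooth(1)[of i]]] jcont_smooth[OF smooth_sp_deriv[OF smooth_sp_deriv[OF smooth(1)[of i]]]]
  by auto

lemma jcont_E: "jcont E" "jcont (dE j)"
proof -
  have "continuous_on spacetime (\<lambda>p. \<chi> j. sp_deriv j (\<lambda>(t, x). \<phi> t x) p)"
    by (intro continuous_on_vec_lambda smooth_on_imp_continuous smooth_sp_deriv smooth)
  thus "jcont E" by (simp add: jcont_def E_def)
  show "jcont (dE j)" unfolding dE_def[abs_def] by (intro jcont_smooth smooth_sp_deriv smooth)
qed

lemma jcont_V: "jcont (V k)" "jcont (dV k j)"
proof -
  have u: "jcont u" using jcont_smooth[OF smooth(2)] by simp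
  thus "jcont (V k)" using jcont_E(1) unfolding V_def[abs_def] jcont_def by (intro continuous_intros)
  have "jcont (\<lambda>t x. sp_deriv j (\<lambda>(t, x). u t x) (t, x))" by (intro jcont_smooth smooth_sp_deriv smooth)
  thus "jcont (dV k j)" unfolding dV_def[abs_def] by (intro jcont_intros jcont_E)
qed

lemma partial_c:
  assumes "0 < t"
  shows "has_partial j (c i t) (dc i j t x) x" "partial j (c i t) = dc i j t"
    "has_partial j (dc i j t) (ddc i j t x) x" "partial j (dc i j t) x = ddc i j t x"
  using has_partial_slice[OF smooth(1)[of i] assms, of j x] partial_slice[OF smooth(1)[of i] assms, of j]
    has_partial_slice[OF smooth_sp_deriv[OF smooth(1)[of i]] assms, of j j x]
    partial_slice[OF smooth_sp_deriv[OF smooth(1)[of i]] assms, of j j]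
  by (auto simp: dc_def[abs_def] ddc_def fun_eq_iff)

lemma partial_\<phi>:
  assumes "0 < t"
  shows "has_partial j (\<phi> t) (E t x $ j) x" "partial j (\<phi> t) = (\<lambda>x. E t x $ j)"
    "has_partial j (\<lambda>x. E t x $ j) (dE j t x) x" "partial j (\<lambda>x. E t x $ j) x = dE j t x"
  using has_partial_slice[OF smooth(3) assms, of j x] partial_slice[OF smooth(3) assms, of j]
    has_partial_slice[OF smooth_sp_deriv[OF smooth(3)] assms, of j j x]
    partial_slice[OF smooth_sp_deriv[OF smooth(3)] assms, of j j]
  by (auto simp: E_def dE_def fun_eq_iff)

lemma gradient_\<phi>: "0 < t \<Longrightarrow> gradient (\<phi> t) x = E t x"
  using partial_\<phi>(2) by (simp add: gradient_def vec_eq_iff)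

text \<open>The drift \<open>V\<close> absorbs the velocity because \<open>u\<close> is divergence free, so that
  \<open>u \<bullet> \<nabla>c = div (c u)\<close>. Its divergence is a multiple of the charge density by the Poisson equation.\<close>

lemma equations:
  assumes t: "0 < t"
  shows "ct i t x = (\<Sum>j\<in>UNIV. D * ddc i j t x + V (z i) t x $ j * dc i j t x + c i t x * dV (z i) j t x)"
    "(\<Sum>j\<in>UNIV. dV k j t x) = - (k * D * \<rho> t x)"
proof -
  have eqs: "deriv (\<lambda>s. c i s x) t + u t x \<bullet> gradient (c i t) x - D * laplacian (c i t) x
               - z i * D * divergence (\<lambda>y. c i t y *\<^sub>R gradient (\<phi> t) y) x = 0"
    "divergence (u t) x = 0" "- laplacian (\<phi> t) x = charge_density z (\<lambda>i. c i t) x"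
    using sol t by (auto simp: npd_solution_def npd_equations_def Let_def)
  have lap: "laplacian (\<phi> t) x = (\<Sum>j\<in>UNIV. dE j t x)" "laplacian (c i t) x = (\<Sum>j\<in>UNIV. ddc i j t x)"
    using partial_\<phi>[OF t] partial_c[OF t] by (simp_all add: laplacian_def)
  have divu: "(\<Sum>j\<in>UNIV. sp_deriv j (\<lambda>(t, x). u t x) (t, x) $ j) = 0"
    using eqs(2) partial_slice_vec[OF smooth(2) t] by (simp add: divergence_def)
  have dt: "deriv (\<lambda>s. c i s x) t = ct i t x"
    using has_tm_deriv[OF smooth(1)[of i] t, of x] by (auto simp: ct_def intro: DERIV_imp_deriv)
  have "partial j (\<lambda>y. (c i t y *\<^sub>R gradient (\<phi> t) y) $ j) x = dc i j t x * E t x $ j + dE j t x * c i t x" for j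
  proof -
    have "(\<lambda>x. c i t x) differentiable (at x)"
      using differentiableI[OF has_derivative_slice[OF smooth(1)[of i] t, of x]] by simp
    moreover have "(\<lambda>x. E t x $ j) differentiable (at x)"
      using differentiableI[OF has_derivative_slice[OF smooth_sp_deriv[OF smooth(3)] t, of j x]] by (simp add: E_def)
    ultimately have "(\<lambda>y. c i t y * E t y $ j) differentiable (at x)" by (intro differentiable_mult)
    from has_partial_unique[OF has_partial_partial[OF this] has_partial_mult[OF partial_c(1)[OF t] partial_\<phi>(3)[OF t]]]
    show ?thesis by (simp add: gradient_\<phi>[OF t])
  qed
  hence div: "divergence (\<lambda>y. c i t y *\<^sub>R gradient (\<phi> t) y) x = (\<Sum>j\<in>UNIV. dc i j t x * E t x $ j + dE j t x * c i t x)"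
    by (simp add: divergence_def)
  have grad: "u t x \<bullet> gradient (c i t) x = (\<Sum>j\<in>UNIV. u t x $ j * dc i j t x)"
    by (simp add: inner_vec_def gradient_def partial_c[OF t])
  have "ct i t x = D * (\<Sum>j\<in>UNIV. ddc i j t x) - (\<Sum>j\<in>UNIV. u t x $ j * dc i j t x)
      + z i * D * (\<Sum>j\<in>UNIV. dc i j t x * E t x $ j + dE j t x * c i t x)
      - c i t x * (\<Sum>j\<in>UNIV. sp_deriv j (\<lambda>(t, x). u t x) (t, x) $ j)"
    using eqs(1) unfolding dt grad lap(2) div divu by simp
  also have "\<dots> = (\<Sum>j\<in>UNIV. D * ddc i j t x - u t x $ j * dc i j t x
      + z i * D * (dc i j t x * E t x $ j + dE j t x * c i t x) - c i t x * sp_deriv j (\<lambda>(t, x). u t x) (t, x) $ j)"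
    by (simp only: sum_distrib_left[symmetric] sum.distrib sum_subtractf)
  also have "\<dots> = (\<Sum>j\<in>UNIV. D * ddc i j t x + V (z i) t x $ j * dc i j t x + c i t x * dV (z i) j t x)"
    by (rule sum.cong) (auto simp: V_def dV_def algebra_simps)
  finally show "ct i t x = (\<Sum>j\<in>UNIV. D * ddc i j t x + V (z i) t x $ j * dc i j t x + c i t x * dV (z i) j t x)" .
  have "(\<Sum>j\<in>UNIV. dV k j t x) = k * D * (\<Sum>j\<in>UNIV. dE j t x)"
    by (simp only: dV_def sum_subtractf divu sum_distrib_left[symmetric] diff_0_right)
  note dVsum = this
  show "(\<Sum>j\<in>UNIV. dV k j t x) = - (k * D * \<rho> t x)"
  proof -
    have "(\<Sum>j\<in>UNIV. dE j t x) = - \<rho> t x"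
      using eqs(3) unfolding lap(1) \<rho>_def charge_density_def by linarith
    thus ?thesis unfolding dVsum by (simp only: mult_minus_right)
  qed
qed

text \<open>Species of equal valence are driven by the same drift, so that their sum solves the same
  linear equation.\<close>

definition pooled :: "'n set \<Rightarrow> real \<Rightarrow> space \<Rightarrow> real" where "pooled I t x = (\<Sum>i\<in>I. c i t x)"
definition pooled_t :: "'n set \<Rightarrow> real \<Rightarrow> space \<Rightarrow> real" where "pooled_t I t x = (\<Sum>i\<in>I. ct i t x)"
definition d_pooled :: "'n set \<Rightarrow> 3 \<Rightarrow> real \<Rightarrow> space \<Rightarrow> real" where "d_pooled I j t x = (\<Sum>i\<in>I. dc i j t x)"
definition dd_pooled :: "'n set \<Rightarrow> 3 \<Rightarrow> real \<Rightarrow> space \<Rightarrow> real" where "dd_pooled I j t x = (\<Sum>i\<in>I. ddc i j t x)"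

lemma pooled_singleton [simp]: "pooled {i} = c i"
  by (simp add: pooled_def fun_eq_iff)

lemma jcont_pooled: "jcont (pooled I)" "jcont (d_pooled I j)" "jcont (pooled_t I)" "jcont (dd_pooled I j)"
  unfolding pooled_def[abs_def] d_pooled_def[abs_def] pooled_t_def[abs_def] dd_pooled_def[abs_def] by (intro jcont_intros jcont_c)+

lemma drift_diffusion_pooled:
  assumes "\<And>i. i \<in> I \<Longrightarrow> z i = k"
  shows "drift_diffusion D (pooled I) (pooled_t I) (d_pooled I) (dd_pooled I) (V k) (dV k)"
proof
  fix t :: real and x :: space and j assume t: "0 < t"
  show "((\<lambda>s. pooled I s x) has_real_derivative pooled_t I t x) (at t)"
    unfolding pooled_def[abs_def] pooled_t_def using has_tm_deriv[OF smooth(1) t, of _ x]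
    by (intro DERIV_sum) (simp add: ct_def)
  show "has_partial j (pooled I t) (d_pooled I j t x) x" unfolding pooled_def[abs_def] d_pooled_def
    by (intro has_partial_sum partial_c t)
  show "has_partial j (d_pooled I j t) (dd_pooled I j t x) x" unfolding d_pooled_def[abs_def] dd_pooled_def
    by (intro has_partial_sum partial_c t)
  show "has_partial j (\<lambda>y. V k t y $ j) (dV k j t x) x"
    unfolding dV_def V_def[abs_def]
    using has_partial_diff[OF has_partial_cmult[OF partial_\<phi>(3)[OF t], where c = "k * D"] has_partial_slice_vec[OF smooth(2) t]]
    by simp
  have "pooled_t I t x = (\<Sum>i\<in>I. \<Sum>j\<in>UNIV. D * ddc i j t x + V k t x $ j * dc i j t x + c i t x * dV k j t x)"
    unfolding pooled_t_def by (rule sum.cong) (simp_all add: equations(1)[OF t] assms)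
  also have "\<dots> = (\<Sum>j\<in>UNIV. \<Sum>i\<in>I. D * ddc i j t x + V k t x $ j * dc i j t x + c i t x * dV k j t x)"
    by (rule sum.swap)
  also have "\<dots> = (\<Sum>j\<in>UNIV. D * dd_pooled I j t x + V k t x $ j * d_pooled I j t x + pooled I t x * dV k j t x)"
    by (rule sum.cong) (simp_all add: dd_pooled_def d_pooled_def pooled_def sum.distrib sum_distrib_left sum_distrib_right)
  finally show "pooled_t I t x = (\<Sum>j\<in>UNIV. D * dd_pooled I j t x + V k t x $ j * d_pooled I j t x + pooled I t x * dV k j t x)" .
qed (rule jcont_pooled jcont_V)+

lemma sobolev_c: "0 \<le> t \<Longrightarrow> integrable lborel (c i t)" "0 \<le> t \<Longrightarrow> sobolev 1 (c i t)"
  using sol by (auto simp: npd_solution_def)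

lemma c_at_0: "c i 0 = c0 i"
  using sol by (auto simp: npd_solution_def)

lemma measurable_c: "0 \<le> t \<Longrightarrow> c i t \<in> borel_measurable borel"
  using borel_measurable_integrable[OF sobolev_c(1)[of t i]] by simp

lemma c_square: "0 \<le> t \<Longrightarrow> integrable lborel (\<lambda>x. (c i t x)\<^sup>2)"
  "0 \<le> t \<Longrightarrow> (LINT x|lborel. (c i t x)\<^sup>2) = weak_energy [] (c i t)"
  using sobolev_square_integrable[OF sobolev_c(2)] weak_energy_Nil[OF sobolev_c(2)] by (auto simp: square_integrable_def)

lemma dc_square:
  assumes t: "0 < t"
  shows "integrable lborel (\<lambda>x. (dc i j t x)\<^sup>2)" "(LINT x|lborel. (dc i j t x)\<^sup>2) = weak_energy [j] (c i t)"
  using t by (auto intro!: classical_partial_eq_weak[OF jcont_slice[OF jcont_c(1) t] jcont_slice[OF jcont_c(3) t] partial_c(1)[OF t]]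
      sobolev_c(2))

text \<open>The sum of the squares and masses that the class of solutions makes finite at each time. It is only
  used to see that the flux is bounded on each compact time interval, which is what makes the error
  terms vanish for large radii.\<close>

definition solution_size :: "real \<Rightarrow> real" where
  "solution_size t = (\<Sum>i\<in>UNIV. l1_norm (c i t)) + (\<Sum>i\<in>UNIV. weak_energy [] (c i t)) + (\<Sum>i\<in>UNIV. \<Sum>j\<in>UNIV. weak_energy [j] (c i t))"

lemma solution_size_bounded: "\<exists>K\<ge>1. \<forall>t\<in>{0..T}. solution_size t \<le> K"
proof -
  have "\<exists>K. \<forall>t\<in>{0..T}. solution_size t \<le> K"
  proof (rule locally_bounded_imp_bounded)
    fix s :: real assume s: "0 \<le> s"
    define M where "M = (\<Sum>i\<in>(UNIV::'n set). 1 + l1_norm (c i s)) + (\<Sum>i\<in>UNIV. 2 + 2 * weak_energy [] (c i s))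
        + (\<Sum>i\<in>UNIV. \<Sum>j\<in>UNIV. 2 + 2 * weak_energy [j] (c i s))"
    have lim: "((\<lambda>t. l1_norm (\<lambda>x. c i t x - c i s x)) \<longlongrightarrow> 0) (at s within {0..})"
      "((\<lambda>t. sobolev_norm 1 (\<lambda>x. c i t x - c i s x)) \<longlongrightarrow> 0) (at s within {0..})" for i
      using sol s by (auto simp: npd_solution_def)
    have "\<forall>\<^sub>F t in at s within {0..}. \<forall>i. l1_norm (\<lambda>x. c i t x - c i s x) < 1 \<and> sobolev_norm 1 (\<lambda>x. c i t x - c i s x) < 1"
      by (intro eventually_all_finite allI eventually_conj order_tendstoD(2)[OF lim(1)] order_tendstoD(2)[OF lim(2)]) auto
    moreover have "\<forall>\<^sub>F t in at s within {0..}. 0 \<le> t" by (auto simp: eventually_at_filter)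
    ultimately have "\<forall>\<^sub>F t in at s within {0..}. solution_size t \<le> M"
    proof eventually_elim
      case (elim t)
      have 1: "l1_norm (c i t) \<le> 1 + l1_norm (c i s)" for i
      proof -
        have it: "integrable lborel (\<lambda>x. \<bar>c i t x\<bar>)" "integrable lborel (\<lambda>x. \<bar>c i s x\<bar>)"
          "integrable lborel (\<lambda>x. \<bar>c i t x - c i s x\<bar>)"
          by (intro integrable_abs Bochner_Integration.integrable_diff sobolev_c elim(2) s)+
        have "l1_norm (c i t) \<le> (LINT x|lborel. \<bar>c i t x - c i s x\<bar> + \<bar>c i s x\<bar>)"
          unfolding l1_norm_def by (intro integral_mono it Bochner_Integration.integrable_add) linarith
        also have "\<dots> = l1_norm (\<lambda>x. c i t x - c i s x) + l1_norm (c i s)"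
          unfolding l1_norm_def by (intro Bochner_Integration.integral_add it)
        also have "\<dots> \<le> 1 + l1_norm (c i s)" using elim(1) by (intro add_right_mono) (simp add: less_imp_le)
        finally show ?thesis .
      qed
      have 2: "weak_energy js (c i t) \<le> 2 + 2 * weak_energy js (c i s)" if "length js \<le> 1" for i js
      proof -
        have n: "0 \<le> sobolev_norm 1 (\<lambda>x. c i t x - c i s x)" by (simp add: sobolev_norm_def sum_nonneg)
        have "(sobolev_norm 1 (\<lambda>x. c i t x - c i s x))\<^sup>2 \<le> 1"
          using elim(1) n by (intro power_le_one) (auto simp: less_imp_le)
        thus ?thesis using weak_energy_triangle[OF sobolev_c(2)[OF elim(2)] sobolev_c(2)[OF s] that, of i i] by linarith
      qed
      show ?case unfolding solution_size_def M_def by (intro add_mono sum_mono 1 2) auto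
    qed
    thus "\<exists>M. \<forall>\<^sub>F t in at s within {0..}. solution_size t \<le> M" by blast
  qed
  then obtain K where "\<forall>t\<in>{0..T}. solution_size t \<le> K" by blast
  thus ?thesis by (intro exI[of _ "max 1 K"]) (auto simp: le_max_iff_disj)
qed

lemma solution_size_parts:
  shows "(\<Sum>i\<in>I. LINT x|lborel. \<bar>c i t x\<bar>) \<le> solution_size t"
    "0 \<le> t \<Longrightarrow> (\<Sum>i\<in>I. LINT x|lborel. (c i t x)\<^sup>2) \<le> solution_size t"
    "0 < t \<Longrightarrow> (\<Sum>i\<in>I. \<Sum>j\<in>UNIV. LINT x|lborel. (dc i j t x)\<^sup>2) \<le> solution_size t"
proof -
  have n: "0 \<le> (\<Sum>i\<in>J. l1_norm (c i t))" "0 \<le> (\<Sum>i\<in>J. weak_energy [] (c i t))"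
    "0 \<le> (\<Sum>i\<in>J. \<Sum>j\<in>UNIV. weak_energy [j] (c i t))" for J
    by (auto simp: l1_norm_def weak_energy_def intro!: sum_nonneg)
  have m: "(\<Sum>i\<in>I. l1_norm (c i t)) \<le> (\<Sum>i\<in>UNIV. l1_norm (c i t))"
    "(\<Sum>i\<in>I. weak_energy [] (c i t)) \<le> (\<Sum>i\<in>UNIV. weak_energy [] (c i t))"
    "(\<Sum>i\<in>I. \<Sum>j\<in>UNIV. weak_energy [j] (c i t)) \<le> (\<Sum>i\<in>UNIV. \<Sum>j\<in>UNIV. weak_energy [j] (c i t))"
    by (rule sum_mono2; auto simp: l1_norm_def weak_energy_def intro!: sum_nonneg)+
  show "(\<Sum>i\<in>I. LINT x|lborel. \<bar>c i t x\<bar>) \<le> solution_size t"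
    using m(1) n[of UNIV] by (simp add: solution_size_def l1_norm_def)
  show "(\<Sum>i\<in>I. LINT x|lborel. (c i t x)\<^sup>2) \<le> solution_size t" if "0 \<le> t"
    using m(2) n[of UNIV] that by (simp add: solution_size_def c_square)
  show "(\<Sum>i\<in>I. \<Sum>j\<in>UNIV. LINT x|lborel. (dc i j t x)\<^sup>2) \<le> solution_size t" if "0 < t"
    using m(3) n[of UNIV] that by (simp add: solution_size_def dc_square)
qed

lemma pooled_integrable:
  assumes "0 < t"
  shows "integrable lborel (pooled I t)" "integrable lborel (\<lambda>x. (pooled I t x)\<^sup>2)" "integrable lborel (\<lambda>x. (d_pooled I j t x)\<^sup>2)"
proof -
  have t: "0 \<le> t" using assms by simp
  show "integrable lborel (pooled I t)" unfolding pooled_def[abs_def]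
    using sobolev_c(1)[OF t] by (intro Bochner_Integration.integrable_sum)
  show "integrable lborel (\<lambda>x. (pooled I t x)\<^sup>2)" unfolding pooled_def
    by (intro integrable_sum_square(1) measurable_c c_square t) auto
  show "integrable lborel (\<lambda>x. (d_pooled I j t x)\<^sup>2)" unfolding d_pooled_def
    by (intro integrable_sum_square(1) dc_square borel_measurable_continuous_onI jcont_slice[OF jcont_c(3)] assms) auto
qed

lemma pooled_bounds:
  assumes "0 < t"
  shows "(LINT x|lborel. \<bar>pooled I t x\<bar>) \<le> solution_size t"
    "(LINT x|lborel. (pooled I t x)\<^sup>2) \<le> real (card (UNIV :: 'n set)) * solution_size t"
proof -
  have t: "0 \<le> t" using assms by simp
  have "(LINT x|lborel. \<bar>pooled I t x\<bar>) \<le> (\<Sum>i\<in>I. LINT x|lborel. \<bar>c i t x\<bar>)"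
    unfolding pooled_def by (rule integral_abs_sum_le) (rule sobolev_c(1)[OF t])
  also have "\<dots> \<le> solution_size t" by (rule solution_size_parts)
  finally show "(LINT x|lborel. \<bar>pooled I t x\<bar>) \<le> solution_size t" .
  have "(LINT x|lborel. (pooled I t x)\<^sup>2) \<le> real (card I) * (\<Sum>i\<in>I. LINT x|lborel. (c i t x)\<^sup>2)"
    unfolding pooled_def by (intro integrable_sum_square(2) measurable_c c_square t) auto
  also have "\<dots> \<le> real (card (UNIV :: 'n set)) * solution_size t"
    by (intro mult_mono solution_size_parts t) (auto intro!: card_mono sum_nonneg)
  finally show "(LINT x|lborel. (pooled I t x)\<^sup>2) \<le> real (card (UNIV :: 'n set)) * solution_size t" .
qed

definition cations :: "'n set" where "cations = {i. z i = zabs}"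

lemma valence_cations: "i \<in> cations \<Longrightarrow> z i = zabs" "i \<in> - cations \<Longrightarrow> z i = - zabs"
  using valence[of i] by (auto simp: cations_def)

lemma \<rho>_eq: "\<rho> t x = zabs * (pooled cations t x - pooled (- cations) t x)" "d\<rho> j t x = zabs * (d_pooled cations j t x - d_pooled (- cations) j t x)"
proof -
  have *: "(\<Sum>i\<in>UNIV. z i * f i) = zabs * ((\<Sum>i\<in>cations. f i) - (\<Sum>i\<in>- cations. f i))" for f :: "'n \<Rightarrow> real"
  proof -
    have "(\<Sum>i\<in>UNIV. z i * f i) = (\<Sum>i\<in>cations. z i * f i) + (\<Sum>i\<in>- cations. z i * f i)"
      using sum.union_disjoint[of cations "- cations" "\<lambda>i. z i * f i"] by simp
    also have "\<dots> = (\<Sum>i\<in>cations. zabs * f i) + (\<Sum>i\<in>- cations. - zabs * f i)"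
      by (intro arg_cong2[of _ _ _ _ "(+)"] sum.cong) (auto simp: valence_cations)
    finally show ?thesis by (simp add: sum_distrib_left[symmetric] sum_negf right_diff_distrib)
  qed
  show "\<rho> t x = zabs * (pooled cations t x - pooled (- cations) t x)" "d\<rho> j t x = zabs * (d_pooled cations j t x - d_pooled (- cations) j t x)"
    unfolding \<rho>_def d\<rho>_def pooled_def d_pooled_def * by (rule refl)+
qed

lemma square_diff_le: "(k * (s - t))\<^sup>2 \<le> 2 * k\<^sup>2 * (s\<^sup>2 + t\<^sup>2)" for s t k :: real
proof -
  have "(s - t)\<^sup>2 \<le> 2 * (s\<^sup>2 + t\<^sup>2)" using zero_le_power2[of "s + t"] by (simp add: power2_diff power2_sum)
  from mult_left_mono[OF this zero_le_power2[of k]] show ?thesis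
    by (simp only: power_mult_distrib mult.assoc mult.left_commute[of 2])
qed

lemma square_diff_integral:
  fixes f g :: "space \<Rightarrow> real"
  assumes "f \<in> borel_measurable borel" "g \<in> borel_measurable borel"
    and i: "integrable lborel (\<lambda>x. (f x)\<^sup>2)" "integrable lborel (\<lambda>x. (g x)\<^sup>2)"
  shows "integrable lborel (\<lambda>x. (k * (f x - g x))\<^sup>2)"
    "(LINT x|lborel. (k * (f x - g x))\<^sup>2) \<le> 2 * k\<^sup>2 * ((LINT x|lborel. (f x)\<^sup>2) + (LINT x|lborel. (g x)\<^sup>2))"
proof -
  have [measurable]: "f \<in> borel_measurable borel" "g \<in> borel_measurable borel" by fact+
  have i': "integrable lborel (\<lambda>x. 2 * k\<^sup>2 * ((f x)\<^sup>2 + (g x)\<^sup>2))" using i by (intro integrable_mult_right Bochner_Integration.integrable_add)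
  show I: "integrable lborel (\<lambda>x. (k * (f x - g x))\<^sup>2)"
  proof (rule Bochner_Integration.integrable_bound[OF i'])
    show "AE x in lborel. norm ((k * (f x - g x))\<^sup>2) \<le> norm (2 * k\<^sup>2 * ((f x)\<^sup>2 + (g x)\<^sup>2))"
      unfolding real_norm_def abs_power2 by (rule AE_I2) (rule order_trans[OF square_diff_le abs_ge_self])
  qed simp
  have "(LINT x|lborel. (k * (f x - g x))\<^sup>2) \<le> (LINT x|lborel. 2 * k\<^sup>2 * ((f x)\<^sup>2 + (g x)\<^sup>2))"
    by (rule integral_mono[OF I i' square_diff_le])
  also have "\<dots> = 2 * k\<^sup>2 * ((LINT x|lborel. (f x)\<^sup>2) + (LINT x|lborel. (g x)\<^sup>2))"
    using i by simp
  finally show "(LINT x|lborel. (k * (f x - g x))\<^sup>2) \<le> 2 * k\<^sup>2 * ((LINT x|lborel. (f x)\<^sup>2) + (LINT x|lborel. (g x)\<^sup>2))" .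
qed

lemma measurable_pooled:
  assumes "0 < t" shows "pooled I t \<in> borel_measurable borel" "d_pooled I j t \<in> borel_measurable borel"
  using assms by (auto intro!: borel_measurable_continuous_onI jcont_slice[OF jcont_pooled(1)] jcont_slice[OF jcont_pooled(2)])

definition pooled_square :: "real \<Rightarrow> real" where
  "pooled_square t = (LINT x|lborel. (pooled cations t x)\<^sup>2) + (LINT x|lborel. (pooled (- cations) t x)\<^sup>2)"
definition energy :: "real \<Rightarrow> real" where
  "energy t = (\<Sum>j\<in>UNIV. (LINT x|lborel. (d_pooled cations j t x)\<^sup>2) + (LINT x|lborel. (d_pooled (- cations) j t x)\<^sup>2))"

lemma \<rho>_bounds:
  assumes t: "0 < t"
  shows "integrable lborel (\<rho> t)" "integrable lborel (\<lambda>x. (\<rho> t x)\<^sup>2)" "integrable lborel (\<lambda>x. (d\<rho> j t x)\<^sup>2)"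
    "(LINT x|lborel. \<bar>\<rho> t x\<bar>) \<le> zabs * (\<Sum>i\<in>UNIV. LINT x|lborel. \<bar>c i t x\<bar>)"
    "(LINT x|lborel. (\<rho> t x)\<^sup>2) \<le> 2 * zabs\<^sup>2 * pooled_square t"
    "(\<Sum>j\<in>UNIV. LINT x|lborel. (d\<rho> j t x)\<^sup>2) \<le> 2 * zabs\<^sup>2 * energy t"
proof -
  note m = measurable_pooled[OF t] and i = pooled_integrable[OF t]
  show "integrable lborel (\<rho> t)" unfolding \<rho>_def[abs_def]
    using sobolev_c(1) t by (intro Bochner_Integration.integrable_sum integrable_mult_right) auto
  show "integrable lborel (\<lambda>x. (\<rho> t x)\<^sup>2)" unfolding \<rho>_eq by (rule square_diff_integral(1)[OF m(1) m(1) i(2) i(2)])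
  show "integrable lborel (\<lambda>x. (d\<rho> j t x)\<^sup>2)" unfolding \<rho>_eq by (rule square_diff_integral(1)[OF m(2) m(2) i(3) i(3)])
  have "(LINT x|lborel. \<bar>\<rho> t x\<bar>) \<le> (\<Sum>i\<in>UNIV. LINT x|lborel. \<bar>z i * c i t x\<bar>)"
    unfolding \<rho>_def using sobolev_c(1) t by (intro integral_abs_sum_le integrable_mult_right) auto
  thus "(LINT x|lborel. \<bar>\<rho> t x\<bar>) \<le> zabs * (\<Sum>i\<in>UNIV. LINT x|lborel. \<bar>c i t x\<bar>)"
    by (simp add: abs_mult valence sum_distrib_left)
  show "(LINT x|lborel. (\<rho> t x)\<^sup>2) \<le> 2 * zabs\<^sup>2 * pooled_square t"
    unfolding \<rho>_eq pooled_square_def by (rule square_diff_integral(2)[OF m(1) m(1) i(2) i(2)])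
  show "(\<Sum>j\<in>UNIV. LINT x|lborel. (d\<rho> j t x)\<^sup>2) \<le> 2 * zabs\<^sup>2 * energy t"
    unfolding \<rho>_eq energy_def sum_distrib_left
    by (rule sum_mono) (rule square_diff_integral(2)[OF m(2) m(2) i(3) i(3)])
qed

definition field_size :: "real \<Rightarrow> real" where "field_size t = field_bound (\<rho> t) (\<lambda>j. d\<rho> j t)"

lemma field_size_ge_1: "1 \<le> field_size t"
  unfolding field_size_def by (rule field_bound_ge_1)

lemma field_size_le:
  assumes "0 < t"
  shows "field_size t \<le> 8 * zabs\<^sup>2 * energy t + 10584 * zabs\<^sup>2 * pooled_square t + cutoff_energy
     + 3/2 * zabs * (\<Sum>i\<in>UNIV. LINT x|lborel. \<bar>c i t x\<bar>) + 1"
  unfolding field_size_def field_bound_def using \<rho>_bounds(4-6)[OF assms] by simp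

lemma jcont_\<rho>: "jcont \<rho>" "jcont (d\<rho> j)"
  unfolding \<rho>_def[abs_def] d\<rho>_def[abs_def] by (intro jcont_intros jcont_c)+

lemma field_bounds:
  assumes t: "0 < t"
  shows "norm (E t x) \<le> 3 * field_size t"
    "integrable lborel (\<lambda>x. (norm (u t x))\<^sup>2)" "(LINT x|lborel. (norm (u t x))\<^sup>2) \<le> 9 * (field_size t)\<^sup>2 * (LINT x|lborel. (\<rho> t x)\<^sup>2)"
proof -
  interpret charge "\<rho> t" "\<lambda>j. d\<rho> j t"
  proof
    show "has_partial j (\<rho> t) (d\<rho> j t x) x" for j x
      unfolding \<rho>_def[abs_def] d\<rho>_def by (intro has_partial_sum has_partial_cmult partial_c t)
  qed (use \<rho>_bounds[OF t] jcont_slice[OF jcont_\<rho>(1) t] jcont_slice[OF jcont_\<rho>(2) t] in auto)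
  have dec: "\<phi> t = inv_neg_laplacian (\<rho> t)" "leray_projection (\<lambda>x. \<rho> t x *\<^sub>R gradient (\<phi> t) x) (\<lambda>x. - u t x)"
    using sol t by (auto simp: npd_solution_def npd_decay_def Let_def \<rho>_def[abs_def] charge_density_def[abs_def])
  show E: "norm (E t x) \<le> 3 * field_size t" for x
    unfolding field_size_def using partial_\<phi>(1)[OF t] by (intro field_pointwise_bound) (simp add: dec(1))
  have lp: "leray_projection (\<lambda>x. \<rho> t x *\<^sub>R E t x) (\<lambda>x. - u t x)" using dec(2) by (simp add: gradient_\<phi>[OF t])
  show "integrable lborel (\<lambda>x. (norm (u t x))\<^sup>2)" using leray_projection_contracts(1)[OF lp] by simp
  have "(LINT x|lborel. (norm (u t x))\<^sup>2) \<le> (LINT x|lborel. (norm (\<rho> t x *\<^sub>R E t x))\<^sup>2)"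
    using leray_projection_contracts(2)[OF lp] by simp
  also have "\<dots> \<le> (LINT x|lborel. 9 * (field_size t)\<^sup>2 * (\<rho> t x)\<^sup>2)"
  proof (rule integral_mono)
    show "integrable lborel (\<lambda>x. (norm (\<rho> t x *\<^sub>R E t x))\<^sup>2)"
      using lp by (simp add: leray_projection_def square_integrable_def)
    show "integrable lborel (\<lambda>x. 9 * (field_size t)\<^sup>2 * (\<rho> t x)\<^sup>2)" using \<rho>_int(2) by simp
    fix x
    have "(norm (E t x))\<^sup>2 \<le> (3 * field_size t)\<^sup>2" using E by (intro power_mono) auto
    thus "(norm (\<rho> t x *\<^sub>R E t x))\<^sup>2 \<le> 9 * (field_size t)\<^sup>2 * (\<rho> t x)\<^sup>2"
      using mult_right_mono[of "(norm (E t x))\<^sup>2" "9 * (field_size t)\<^sup>2" "(\<rho> t x)\<^sup>2"] by (simp add: power_mult_distrib mult.commute)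
  qed
  also have "\<dots> = 9 * (field_size t)\<^sup>2 * (LINT x|lborel. (\<rho> t x)\<^sup>2)" by simp
  finally show "(LINT x|lborel. (norm (u t x))\<^sup>2) \<le> 9 * (field_size t)\<^sup>2 * (LINT x|lborel. (\<rho> t x)\<^sup>2)" .
qed

text \<open>The velocity term is split as \<open>\<bar>c\<bar> \<bar>u\<bar> \<le> 3/2 l c\<^sup>2 + \<bar>u\<bar>\<^sup>2 / (6 l)\<close> with \<open>l\<close> the field bound. As
  \<open>\<parallel>u\<parallel>\<^sub>2\<^sup>2 \<le> 9 l\<^sup>2 \<parallel>\<rho>\<parallel>\<^sub>2\<^sup>2\<close>, this weighting keeps the total linear in \<open>l\<close>, hence integrable in time.\<close>

lemma flux_bound:
  assumes t: "0 < t" and k: "\<bar>k\<bar> = zabs"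
  shows "integrable lborel (\<lambda>x. \<bar>pooled I t x\<bar> * (D + norm (V k t x)))"
    "(LINT x|lborel. \<bar>pooled I t x\<bar> * (D + norm (V k t x))) \<le>
       field_size t * ((D + 3 * zabs * D) * (LINT x|lborel. \<bar>pooled I t x\<bar>) + 3/2 * ((LINT x|lborel. (pooled I t x)\<^sup>2) + (LINT x|lborel. (\<rho> t x)\<^sup>2)))"
proof -
  have field_size: "1 \<le> field_size t" by (rule field_size_ge_1)
  let ?f = "\<lambda>x. \<bar>pooled I t x\<bar>"
  note i = pooled_integrable(1,2)[OF t, of I] and u2 = field_bounds(2)[OF t] and r2 = \<rho>_bounds(2)[OF t]
  let ?g = "\<lambda>x. (D + 3 * zabs * D * field_size t) * ?f x + (3/2 * field_size t * (pooled I t x)\<^sup>2 + 1 / (6 * field_size t) * (norm (u t x))\<^sup>2)"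
  have ig: "integrable lborel ?g" using i u2 by (intro Bochner_Integration.integrable_add integrable_mult_right integrable_abs)
  have le: "?f x * (D + norm (V k t x)) \<le> ?g x" for x
  proof -
    have "norm (V k t x) \<le> norm ((k * D) *\<^sub>R E t x) + norm (u t x)" unfolding V_def by (rule norm_triangle_ineq4)
    also have "norm ((k * D) *\<^sub>R E t x) = zabs * D * norm (E t x)" using k D by (simp add: abs_mult)
    also have "\<dots> \<le> zabs * D * (3 * field_size t)" using field_bounds(1)[OF t] zabs_nonneg D by (intro mult_left_mono) auto
    finally have "?f x * (D + norm (V k t x)) \<le> ?f x * (D + (zabs * D * (3 * field_size t) + norm (u t x)))"
      by (intro mult_left_mono) auto
    also have "\<dots> = (D + 3 * zabs * D * field_size t) * ?f x + ?f x * norm (u t x)" by (simp add: algebra_simps)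
    also have "?f x * norm (u t x) \<le> 3/2 * field_size t * (pooled I t x)\<^sup>2 + 1 / (6 * field_size t) * (norm (u t x))\<^sup>2"
    proof -
      have "v * w \<le> 3/2 * l * v\<^sup>2 + 1 / (6 * l) * w\<^sup>2" if "0 < l" for v w l :: real
      proof -
        have "0 \<le> (3 * l * v - w)\<^sup>2 / (6 * l)" using that by simp
        also have "\<dots> = 3/2 * l * v\<^sup>2 + 1 / (6 * l) * w\<^sup>2 - v * w"
          using that by (simp add: power2_diff field_simps) (simp add: power2_eq_square)
        finally show ?thesis by simp
      qed
      from this[of "field_size t" "?f x" "norm (u t x)"] show ?thesis using field_size by simp
    qed
    finally show ?thesis by simp
  qed
  have m: "(\<lambda>x. ?f x * (D + norm (V k t x))) \<in> borel_measurable lborel"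
    using jcont_slice[OF jcont_pooled(1) t, of I] jcont_slice[OF jcont_V(1) t, of k]
    by (auto intro!: borel_measurable_continuous_onI continuous_intros)
  show I: "integrable lborel (\<lambda>x. ?f x * (D + norm (V k t x)))"
  proof (rule Bochner_Integration.integrable_bound[OF ig m])
    show "AE x in lborel. norm (?f x * (D + norm (V k t x))) \<le> norm (?g x)"
    proof (rule AE_I2)
      fix x
      have "norm (?f x * (D + norm (V k t x))) = ?f x * (D + norm (V k t x))" using D by simp
      also have "\<dots> \<le> norm (?g x)" unfolding real_norm_def by (rule order_trans[OF le abs_ge_self])
      finally show "norm (?f x * (D + norm (V k t x))) \<le> norm (?g x)" .
    qed
  qed
  have "(LINT x|lborel. ?f x * (D + norm (V k t x))) \<le> (LINT x|lborel. ?g x)"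
    by (rule integral_mono[OF I ig le])
  also have "\<dots> = (D + 3 * zabs * D * field_size t) * (LINT x|lborel. ?f x) + (3/2 * field_size t * (LINT x|lborel. (pooled I t x)\<^sup>2)
      + 1 / (6 * field_size t) * (LINT x|lborel. (norm (u t x))\<^sup>2))"
    using i u2 by simp
  also have "\<dots> \<le> (D * field_size t + 3 * zabs * D * field_size t) * (LINT x|lborel. ?f x) + (3/2 * field_size t * (LINT x|lborel. (pooled I t x)\<^sup>2)
      + 1 / (6 * field_size t) * (9 * (field_size t)\<^sup>2 * (LINT x|lborel. (\<rho> t x)\<^sup>2)))"
    using field_size D by (intro add_mono mult_right_mono mult_left_mono field_bounds t) (auto simp: mult_le_cancel_left1)
  also have "1 / (6 * field_size t) * (9 * (field_size t)\<^sup>2 * (LINT x|lborel. (\<rho> t x)\<^sup>2)) = 3/2 * field_size t * (LINT x|lborel. (\<rho> t x)\<^sup>2)"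
    using field_size by (simp add: power2_eq_square)
  finally show "(LINT x|lborel. ?f x * (D + norm (V k t x))) \<le>
       field_size t * ((D + 3 * zabs * D) * (LINT x|lborel. ?f x) + 3/2 * ((LINT x|lborel. (pooled I t x)\<^sup>2) + (LINT x|lborel. (\<rho> t x)\<^sup>2)))"
    by (simp add: algebra_simps)
qed

lemma local_flux_bound:
  obtains B where "0 \<le> B" "\<And>t I k. 0 < t \<Longrightarrow> t \<le> T \<Longrightarrow> \<bar>k\<bar> = zabs \<Longrightarrow>
    (LINT x|lborel. \<bar>pooled I t x\<bar> * (D + norm (V k t x))) \<le> B"
proof -
  obtain K where K: "1 \<le> K" "\<forall>t\<in>{0..T}. solution_size t \<le> K" using solution_size_bounded by blast
  let ?n = "real (card (UNIV :: 'n set))"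
  define M where "M = 2 * ?n * K"
  define B1 where "B1 = 8 * zabs\<^sup>2 * M + 10584 * zabs\<^sup>2 * M + cutoff_energy + 3/2 * zabs * K + 1"
  define B where "B = B1 * ((D + 3 * zabs * D) * K + 3/2 * (?n * K + 2 * zabs\<^sup>2 * M))"
  have ce: "0 \<le> cutoff_energy" by (simp add: cutoff_energy_def sum_nonneg)
  have B10: "0 \<le> B1" unfolding B1_def M_def using K(1) ce zabs_nonneg by simp
  have "0 \<le> B" unfolding B_def M_def using B10 K(1) zabs_nonneg D by simp
  moreover have "(LINT x|lborel. \<bar>pooled I t x\<bar> * (D + norm (V k t x))) \<le> B" if t: "0 < t" "t \<le> T" and k: "\<bar>k\<bar> = zabs" for t I k
  proof -
    have sK: "solution_size t \<le> K" using K t by auto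
    have nK: "?n * solution_size t \<le> ?n * K" using sK by (intro mult_left_mono) auto
    have m2: "pooled_square t \<le> M" using pooled_bounds(2)[OF t(1), of cations] pooled_bounds(2)[OF t(1), of "- cations"] nK
      unfolding pooled_square_def M_def by linarith
    have en: "energy t \<le> M"
    proof -
      have *: "(\<Sum>j\<in>UNIV. LINT x|lborel. (d_pooled I j t x)\<^sup>2) \<le> ?n * solution_size t" for I
      proof -
        have "(\<Sum>j\<in>UNIV. LINT x|lborel. (d_pooled I j t x)\<^sup>2) \<le> (\<Sum>j\<in>UNIV. real (card I) * (\<Sum>i\<in>I. LINT x|lborel. (dc i j t x)\<^sup>2))"
          unfolding d_pooled_def by (intro sum_mono integrable_sum_square(2) dc_square t
              borel_measurable_continuous_onI jcont_slice[OF jcont_c(3) t(1)]) auto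
        also have "\<dots> = real (card I) * (\<Sum>i\<in>I. \<Sum>j\<in>UNIV. LINT x|lborel. (dc i j t x)\<^sup>2)"
          by (simp add: sum_distrib_left[symmetric] sum.swap[of _ I])
        also have "\<dots> \<le> ?n * solution_size t"
          by (intro mult_mono solution_size_parts t) (auto intro!: card_mono sum_nonneg)
        finally show ?thesis .
      qed
      show ?thesis using *[of cations] *[of "- cations"] nK unfolding energy_def M_def sum.distrib by linarith
    qed
    have LB: "field_size t \<le> B1" unfolding B1_def
      using solution_size_parts(1)[of t UNIV] sK zabs_nonneg
      by (intro order_trans[OF field_size_le[OF t(1)]] add_mono mult_left_mono m2 en) auto
    have r: "(LINT x|lborel. (\<rho> t x)\<^sup>2) \<le> 2 * zabs\<^sup>2 * M"
      by (intro order_trans[OF \<rho>_bounds(5)[OF t(1)]] mult_left_mono m2) auto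
    show ?thesis unfolding B_def
      by (rule order_trans[OF flux_bound(2)[OF t(1) k]], intro mult_mono add_mono mult_left_mono LB r
          order_trans[OF pooled_bounds(1)[OF t(1)] sK] order_trans[OF pooled_bounds(2)[OF t(1)] nK])
         (use B10 D zabs_nonneg in auto)
  qed
  ultimately show ?thesis using that by blast
qed

end

section \<open>Nonnegativity and the bound on the mass\<close>

lemma closed_AE_everywhere:
  fixes f :: "space \<Rightarrow> real"
  assumes f: "continuous_on UNIV f" and ae: "AE x in lborel. f x = 0"
  shows "f x = 0"
proof -
  have "x \<in> {x. f x = 0}"
  proof (rule mem_closed_if_AE_lebesgue)
    show "closed {x. f x = 0}" using f by (intro closed_Collect_eq continuous_on_const)
    show "AE x in lebesgue. x \<in> {x. f x = 0}" using AE_completion[OF ae] by simp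
  qed
  thus ?thesis by simp
qed

context npd
begin

definition dissipation_term :: "(real \<Rightarrow> real) \<Rightarrow> 'n set \<Rightarrow> (real \<Rightarrow> real) \<Rightarrow> real \<Rightarrow> space \<Rightarrow> real" where
  "dissipation_term \<beta>2 I h t x = D * (\<beta>2 (pooled I t x) * (\<Sum>j\<in>UNIV. (d_pooled I j t x)\<^sup>2)) * h (x \<bullet> x)"

definition compression_term :: "(real \<Rightarrow> real) \<Rightarrow> (real \<Rightarrow> real) \<Rightarrow> real \<Rightarrow> 'n set \<Rightarrow> (real \<Rightarrow> real) \<Rightarrow> real \<Rightarrow> space \<Rightarrow> real" where
  "compression_term \<beta> \<beta>1 k I h t x = (pooled I t x * \<beta>1 (pooled I t x) - \<beta> (pooled I t x)) * - (k * D * \<rho> t x) * h (x \<bullet> x)"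

text \<open>The balance law for a pool of species of equal valence and a radial weight. The transport term
  appears as a number \<open>T\<close> that is bounded by the slope of the weight times the flux.\<close>

lemma evolution:
  assumes I: "\<And>i. i \<in> I \<Longrightarrow> z i = k" and k: "\<bar>k\<bar> = zabs" and rw: "radial_weight h h1 h2 R \<kappa>"
    and \<beta>: "\<And>s. (\<beta> has_real_derivative \<beta>1 s) (at s)" "\<And>s. (\<beta>1 has_real_derivative \<beta>2 s) (at s)" "continuous_on UNIV \<beta>2"
    and M: "\<And>s. \<bar>\<beta> s\<bar> \<le> M * \<bar>s\<bar>" "0 \<le> M" and t: "0 < t"
  obtains T where "((\<lambda>\<tau>. LINT x|lborel. \<beta> (pooled I \<tau> x) * h (x \<bullet> x)) has_real_derivative
      T - (LINT x|lborel. dissipation_term \<beta>2 I h t x) + (LINT x|lborel. compression_term \<beta> \<beta>1 k I h t x)) (at t)"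
    and "\<And>F. (LINT x|lborel. \<bar>pooled I t x\<bar> * (D + norm (V k t x))) \<le> F \<Longrightarrow> \<bar>T\<bar> \<le> M * \<kappa> * F"
    and "integrable lborel (dissipation_term \<beta>2 I h t)" "integrable lborel (compression_term \<beta> \<beta>1 k I h t)"
    and "integrable lborel (\<lambda>x. \<beta> (pooled I t x) * h (x \<bullet> x))"
proof -
  interpret A: drift_diffusion D "pooled I" "pooled_t I" "d_pooled I" "dd_pooled I" "V k" "dV k" by (rule drift_diffusion_pooled[OF I])
  interpret W: radial_weight h h1 h2 R \<kappa> by (rule rw)
  interpret X: radial_drift_diffusion D "pooled I" "pooled_t I" "d_pooled I" "dd_pooled I" "V k" "dV k" h h1 h2 R \<kappa> \<beta> \<beta>1 \<beta>2
    by unfold_locales (rule \<beta>)+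
  have d: "X.dissipation t = dissipation_term \<beta>2 I h t" by (simp add: X.dissipation_def dissipation_term_def W.w_def fun_eq_iff)
  have c: "X.compression t = compression_term \<beta> \<beta>1 k I h t"
    by (simp add: X.compression_def compression_term_def W.w_def fun_eq_iff equations(2)[OF t])
  show ?thesis
  proof (rule that)
    show "((\<lambda>\<tau>. LINT x|lborel. \<beta> (pooled I \<tau> x) * h (x \<bullet> x)) has_real_derivative
      (LINT x|lborel. X.transport t x) - (LINT x|lborel. dissipation_term \<beta>2 I h t x) + (LINT x|lborel. compression_term \<beta> \<beta>1 k I h t x)) (at t)"
      using X.balance[OF t] unfolding d c unfolding W.w_def[abs_def] .
    show "\<bar>LINT x|lborel. X.transport t x\<bar> \<le> M * \<kappa> * F"
      if "(LINT x|lborel. \<bar>pooled I t x\<bar> * (D + norm (V k t x))) \<le> F" for F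
      using D by (intro X.integral_transport_le M t flux_bound(1)[OF t k] that) simp
    show "integrable lborel (dissipation_term \<beta>2 I h t)" "integrable lborel (compression_term \<beta> \<beta>1 k I h t)"
      using X.integrable_terms[OF t] unfolding d c by auto
    have "jcont (\<lambda>t x. \<beta> (pooled I t x) * W.w x)" by (intro jcont_intros X.conts)
    from jcont_integrable[OF this t, where R = R]
    show "integrable lborel (\<lambda>x. \<beta> (pooled I t x) * h (x \<bullet> x))"
      by (simp add: W.weight_support W.w_def[symmetric])
  qed
qed

lemma integrable_mult_chi:
  fixes f :: "space \<Rightarrow> real"
  assumes "continuous_on UNIV f" "1 \<le> R" shows "integrable lborel (\<lambda>x. f x * chi R x)"
  by (rule integrable_continuous_compact_support[where R = R])
     (use assms in \<open>auto intro!: continuous_intros chi_continuous simp: chi_support\<close>)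

lemma c_continuous: "0 < t \<Longrightarrow> continuous_on UNIV (c i t)"
  by (rule jcont_slice[OF jcont_c(1)])

lemma initial_limit: "((\<lambda>t. l1_norm (\<lambda>x. c i t x - c0 i x)) \<longlongrightarrow> 0) (at_right 0)"
proof -
  have "((\<lambda>t. l1_norm (\<lambda>x. c i t x - c i 0 x)) \<longlongrightarrow> 0) (at 0 within {0..})"
    using sol unfolding npd_solution_def by blast
  hence "((\<lambda>t. l1_norm (\<lambda>x. c i t x - c i 0 x)) \<longlongrightarrow> 0) (at 0 within {0<..})"
    by (rule tendsto_within_subset) auto
  thus ?thesis by (simp add: c_at_0)
qed

lemma initial: "AE x in lborel. 0 \<le> c0 i x" "sobolev 2 (c0 i)" "integrable lborel (c0 i)"
  "integrable lborel (\<lambda>x. norm x ^ 6 * (c0 i x)\<^sup>2)"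
  using data by (auto simp: admissible_data_def)

text \<open>The negative part \<open>\<bar>c\<bar> - c\<close> is propagated: the balance law for \<open>\<beta> = soft_abs a - id\<close> has a good sign in
  the dissipation, a compression term of order \<open>a\<close> and a transport term of order \<open>1 / R\<close>. Sending
  first \<open>a\<close> to zero, then \<open>R\<close> to infinity, shows that the integral of the negative part does not
  increase, and at time zero it tends to zero.\<close>

theorem nonneg:
  assumes t: "0 < t"
  shows "0 \<le> c i t x"
proof -
  define f where "f \<tau> x = \<bar>c i \<tau> x\<bar> - c i \<tau> x" for \<tau> x
  have f0: "0 \<le> f \<tau> x" for \<tau> x by (simp add: f_def)
  have cf: "continuous_on UNIV (f \<tau>)" if "0 < \<tau>" for \<tau>
    unfolding f_def[abs_def] by (intro continuous_intros c_continuous that)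
  have if': "integrable lborel (f \<tau>)" if "0 \<le> \<tau>" for \<tau>
    unfolding f_def[abs_def] using sobolev_c(1)[OF that] by simp
  obtain B where B: "0 \<le> B" "\<And>\<tau> I k. 0 < \<tau> \<Longrightarrow> \<tau> \<le> t \<Longrightarrow> \<bar>k\<bar> = zabs \<Longrightarrow>
      (LINT x|lborel. \<bar>pooled I \<tau> x\<bar> * (D + norm (V k \<tau> x))) \<le> B"
    using local_flux_bound by metis
  have step: "(LINT x|lborel. f t x * chi R x) \<le> (LINT x|lborel. f s x) + (84 * B * (t - s)) / R"
    if s: "0 < s" "s < t" and R: "1 \<le> R" for s R
  proof -
    have R0: "0 < R" using R by simp
    define G where "G \<tau> = (LINT x|lborel. \<bar>z i * D * \<rho> \<tau> x\<bar> * chi R x)" for \<tau>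
    have "continuous_on {0<..} G" unfolding G_def
      by (rule jcont_integral_continuous[where R = R]) (auto intro!: jcont_intros jcont_\<rho> jcont_space chi_continuous simp: chi_support R0)
    hence "continuous_on {s..t} G" by (rule continuous_on_subset) (use s in auto)
    then obtain M where M: "\<And>\<tau>. \<tau> \<in> {s..t} \<Longrightarrow> G \<tau> \<le> M"
      using continuous_attains_sup[of "{s..t}" G] s by fastforce
    show ?thesis
    proof (rule le_of_le_add_mult)
      fix a :: real assume a: "0 < a"
      let ?\<beta> = "\<lambda>s. soft_abs a s - s" and ?\<beta>1 = "\<lambda>s. soft_abs1 a s - 1"
      have \<beta>: "(?\<beta> has_real_derivative ?\<beta>1 s) (at s)" "(?\<beta>1 has_real_derivative soft_abs2 a s) (at s)" for s
        using DERIV_diff[OF DERIV_soft_abs(1)[OF a] DERIV_ident] DERIV_diff[OF DERIV_soft_abs(2)[OF a] DERIV_const, of 1] by auto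
      have \<beta>b: "\<bar>?\<beta> s\<bar> \<le> 2 * \<bar>s\<bar>" for s using soft_abs_bounds[OF a, of s] by linarith
      let ?F = "\<lambda>\<tau>. LINT x|lborel. ?\<beta> (c i \<tau> x) * cutoff R (x \<bullet> x)"
      have ex: "\<exists>F'. (?F has_real_derivative F') (at \<tau>) \<and> F' \<le> 84 * B / R + a * M" if \<tau>: "s \<le> \<tau>" "\<tau> \<le> t" for \<tau>
      proof -
        have \<tau>0: "0 < \<tau>" using s \<tau> by simp
        obtain T where T: "(?F has_real_derivative
          T - (LINT x|lborel. dissipation_term (soft_abs2 a) {i} (cutoff R) \<tau> x) + (LINT x|lborel. compression_term ?\<beta> ?\<beta>1 (z i) {i} (cutoff R) \<tau> x)) (at \<tau>)"
          "\<And>F. (LINT x|lborel. \<bar>pooled {i} \<tau> x\<bar> * (D + norm (V (z i) \<tau> x))) \<le> F \<Longrightarrow> \<bar>T\<bar> \<le> 2 * (42 / R) * F"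
          "integrable lborel (dissipation_term (soft_abs2 a) {i} (cutoff R) \<tau>)" "integrable lborel (compression_term ?\<beta> ?\<beta>1 (z i) {i} (cutoff R) \<tau>)"
          by (rule evolution[of "{i}" "z i", OF _ valence radial_weight_cutoff[OF R] \<beta> DERIV_soft_abs(3)[OF a] \<beta>b _ \<tau>0]) (auto simp: pooled_singleton)
        have "\<bar>T\<bar> \<le> 2 * (42 / R) * B" by (rule T(2)[OF B(2)[OF \<tau>0 \<tau>(2) valence]])
        moreover have "0 \<le> (LINT x|lborel. dissipation_term (soft_abs2 a) {i} (cutoff R) \<tau> x)"
          using D R0 soft_abs_bounds(4)[OF a]
          by (intro Bochner_Integration.integral_nonneg) (auto simp: dissipation_term_def intro!: mult_nonneg_nonneg sum_nonneg cutoff_range)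
        moreover have "(LINT x|lborel. compression_term ?\<beta> ?\<beta>1 (z i) {i} (cutoff R) \<tau> x) \<le> (LINT x|lborel. a * (\<bar>z i * D * \<rho> \<tau> x\<bar> * chi R x))"
        proof (rule integral_mono[OF T(4)])
          show "integrable lborel (\<lambda>x. a * (\<bar>z i * D * \<rho> \<tau> x\<bar> * chi R x))"
            by (intro integrable_mult_right integrable_mult_chi R continuous_intros jcont_slice[OF jcont_\<rho>(1)] \<tau>0)
          fix x
          let ?s = "c i \<tau> x" and ?w = "z i * D * \<rho> \<tau> x"
          have "(?s * ?\<beta>1 ?s - ?\<beta> ?s) = ?s * soft_abs1 a ?s - soft_abs a ?s" by (simp add: algebra_simps)
          moreover have "(?s * soft_abs1 a ?s - soft_abs a ?s) * - ?w \<le> a * \<bar>?w\<bar>"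
            using soft_abs_compression(2,3)[OF a, of ?s]
              mult_mono[of "?s * soft_abs1 a ?s - soft_abs a ?s" a "\<bar>?w\<bar>" "\<bar>?w\<bar>"] mult_left_mono[of "- ?w" "\<bar>?w\<bar>" "?s * soft_abs1 a ?s - soft_abs a ?s"]
            by linarith
          ultimately have "(?s * ?\<beta>1 ?s - ?\<beta> ?s) * - ?w \<le> a * \<bar>?w\<bar>" by metis
          from mult_right_mono[OF this, of "chi R x"] chi_range(1)[OF R0, of x]
          show "compression_term ?\<beta> ?\<beta>1 (z i) {i} (cutoff R) \<tau> x \<le> a * (\<bar>z i * D * \<rho> \<tau> x\<bar> * chi R x)"
            by (simp add: compression_term_def chi_def mult.assoc)
        qed
        moreover have "(LINT x|lborel. a * (\<bar>z i * D * \<rho> \<tau> x\<bar> * chi R x)) = a * G \<tau>" by (simp add: G_def)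
        moreover have "a * G \<tau> \<le> a * M" using M[of \<tau>] \<tau> a by (intro mult_left_mono) auto
        moreover have "2 * (42 / R) * B = 84 * B / R" by simp
        ultimately have "T - (LINT x|lborel. dissipation_term (soft_abs2 a) {i} (cutoff R) \<tau> x)
            + (LINT x|lborel. compression_term ?\<beta> ?\<beta>1 (z i) {i} (cutoff R) \<tau> x) \<le> 84 * B / R + a * M"
          by linarith
        with T(1) show ?thesis by blast
      qed
      have gr: "?F t \<le> ?F s + (84 * B / R + a * M) * (t - s)"
        by (rule growth_le[OF ex]) (use s in auto)
      have cs: "continuous_on UNIV (\<lambda>x. ?\<beta> (c i \<tau> x))" if "0 < \<tau>" for \<tau>
      proof -
        have "continuous_on UNIV (soft_abs a)" using DERIV_soft_abs(1)[OF a] DERIV_isCont continuous_at_imp_continuous_on by blast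
        from continuous_on_compose2[OF this c_continuous[OF that]] show ?thesis
          by (intro continuous_intros c_continuous that) auto
      qed
      have "?F s \<le> (LINT x|lborel. f s x)"
      proof (rule integral_mono)
        show "integrable lborel (\<lambda>x. ?\<beta> (c i s x) * cutoff R (x \<bullet> x))"
          using integrable_mult_chi[OF cs[OF s(1)] R] by (simp add: chi_def)
        show "integrable lborel (f s)" using s by (intro if') simp
        fix x
        have "?\<beta> (c i s x) * chi R x \<le> f s x * chi R x"
          using soft_abs_bounds(3)[OF a, of "c i s x"] chi_range(1)[OF R0, of x] by (intro mult_right_mono) (auto simp: f_def)
        also have "\<dots> \<le> f s x * 1" using chi_range[OF R0, of x] f0 by (intro mult_left_mono) auto
        finally show "?\<beta> (c i s x) * cutoff R (x \<bullet> x) \<le> f s x" by (simp add: chi_def)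
      qed
      moreover have "(LINT x|lborel. f t x * chi R x) - a * (LINT x|lborel. 1 * chi R x) \<le> ?F t"
      proof -
        have i: "integrable lborel (\<lambda>x. f t x * chi R x)" "integrable lborel (\<lambda>x. 1 * chi R x)"
          by (intro integrable_mult_chi cf t R continuous_intros)+
        have "(LINT x|lborel. f t x * chi R x) - a * (LINT x|lborel. 1 * chi R x) = (LINT x|lborel. f t x * chi R x - a * (1 * chi R x))"
          using i by simp
        also have "\<dots> \<le> ?F t"
        proof (rule integral_mono)
          show "integrable lborel (\<lambda>x. f t x * chi R x - a * (1 * chi R x))" using i by simp
          show "integrable lborel (\<lambda>x. ?\<beta> (c i t x) * cutoff R (x \<bullet> x))"
            using integrable_mult_chi[OF cs[OF t] R] by (simp add: chi_def)
          fix x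
          have "(f t x - a) * chi R x \<le> ?\<beta> (c i t x) * chi R x"
            using soft_abs_bounds(1)[OF a, of "c i t x"] chi_range(1)[OF R0, of x] by (intro mult_right_mono) (auto simp: f_def)
          thus "f t x * chi R x - a * (1 * chi R x) \<le> ?\<beta> (c i t x) * cutoff R (x \<bullet> x)"
            by (simp add: chi_def left_diff_distrib)
        qed
        finally show ?thesis .
      qed
      ultimately show "(LINT x|lborel. f t x * chi R x) \<le> (LINT x|lborel. f s x) + (84 * B * (t - s)) / R
          + a * (M * (t - s) + (LINT x|lborel. 1 * chi R x))"
        using gr by (simp add: algebra_simps)
    qed
  qed
  have zero: "(LINT x|lborel. f t x * chi r x) = 0" if r: "1 \<le> r" for r
  proof -
    have i: "integrable lborel (\<lambda>x. f t x * chi R x)" if "1 \<le> R" for R by (intro integrable_mult_chi cf t that)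
    have "(LINT x|lborel. f t x * chi r x) \<le> (LINT x|lborel. f s x)" if s: "0 < s" "s < t" for s
    proof (rule le_of_le_add_divide)
      fix R assume R: "r \<le> R"
      have "(LINT x|lborel. f t x * chi r x) \<le> (LINT x|lborel. f t x * chi R x)"
        using r R by (intro integral_mono i mult_left_mono chi_mono f0) auto
      also have "\<dots> \<le> (LINT x|lborel. f s x) + (84 * B * (t - s)) / R" using r R by (intro step s) simp
      finally show "(LINT x|lborel. f t x * chi r x) \<le> (LINT x|lborel. f s x) + (84 * B * (t - s)) / R" .
    qed
    moreover have "(LINT x|lborel. f s x) \<le> 2 * l1_norm (\<lambda>x. c i s x - c0 i x)" if "0 < s" for s
    proof -
      have "(LINT x|lborel. f s x) \<le> (LINT x|lborel. 2 * \<bar>c i s x - c0 i x\<bar>)"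
      proof (rule integral_mono_AE)
        show "integrable lborel (f s)" using that by (intro if') simp
        show "integrable lborel (\<lambda>x. 2 * \<bar>c i s x - c0 i x\<bar>)" using sobolev_c(1)[of s i] initial(3)[of i] that by simp
        have *: "\<bar>p\<bar> - p \<le> 2 * \<bar>p - q\<bar>" if "0 \<le> q" for p q :: real
          using that by (cases "0 \<le> p") (auto simp: abs_if)
        show "AE x in lborel. f s x \<le> 2 * \<bar>c i s x - c0 i x\<bar>"
          unfolding f_def by (rule AE_mp[OF initial(1)[of i]]) (auto intro!: AE_I2 *)
      qed
      thus ?thesis by (simp add: l1_norm_def)
    qed
    ultimately have le: "(LINT x|lborel. f t x * chi r x) \<le> 2 * l1_norm (\<lambda>x. c i s x - c0 i x)" if "0 < s" "s < t" for s
      using that order_trans by blast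
    have "(LINT x|lborel. f t x * chi r x) \<le> 2 * 0"
    proof (rule tendsto_lowerbound)
      show "((\<lambda>s. 2 * l1_norm (\<lambda>x. c i s x - c0 i x)) \<longlongrightarrow> 2 * 0) (at_right 0)" by (intro tendsto_intros initial_limit)
      show "\<forall>\<^sub>F s in at_right 0. (LINT x|lborel. f t x * chi r x) \<le> 2 * l1_norm (\<lambda>x. c i s x - c0 i x)"
        using eventually_at_right_less[of 0] eventually_at_right_real[OF t] by eventually_elim (use le in auto)
    qed simp
    moreover have "0 \<le> (LINT x|lborel. f t x * chi r x)"
      using r by (intro Bochner_Integration.integral_nonneg) (auto intro!: mult_nonneg_nonneg f0 chi_range)
    ultimately show ?thesis by simp
  qed
  have "f t x * chi (real (Suc n)) x = 0" for n
  proof (rule closed_AE_everywhere[of "\<lambda>x. f t x * chi (real (Suc n)) x"])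
    show "continuous_on UNIV (\<lambda>x. f t x * chi (real (Suc n)) x)" by (intro continuous_intros cf t chi_continuous)
    have "integrable lborel (\<lambda>x. f t x * chi (real (Suc n)) x)" by (intro integrable_mult_chi cf t) simp
    moreover have "0 \<le> f t x * chi (real (Suc n)) x" for x by (intro mult_nonneg_nonneg f0 chi_range) simp
    ultimately show "AE x in lborel. f t x * chi (real (Suc n)) x = 0"
      using integral_nonneg_eq_0_iff_AE[of lborel "\<lambda>x. f t x * chi (real (Suc n)) x"] zero[of "real (Suc n)"] by simp
  qed
  hence "(\<lambda>n. f t x * chi (real (Suc n)) x) = (\<lambda>_. 0)" by auto
  moreover have "(\<lambda>n. f t x * chi (real (Suc n)) x) \<longlonglongrightarrow> f t x * 1" by (intro tendsto_mult tendsto_const chi_tendsto)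
  ultimately have "f t x = 0" by (simp add: LIMSEQ_const_iff)
  thus ?thesis by (simp add: f_def)
qed

lemma nonneg_pooled: "0 < t \<Longrightarrow> 0 \<le> pooled I t x"
  unfolding pooled_def by (intro sum_nonneg nonneg)

text \<open>For \<open>\<beta> = id\<close> only the transport term is left, and it is of order \<open>1 / R\<close>.\<close>

theorem mass_le:
  assumes t: "0 < t"
  shows "(LINT x|lborel. c i t x) \<le> l1_norm (c0 i)"
proof -
  obtain B where B: "0 \<le> B" "\<And>\<tau> I k. 0 < \<tau> \<Longrightarrow> \<tau> \<le> t \<Longrightarrow> \<bar>k\<bar> = zabs \<Longrightarrow>
      (LINT x|lborel. \<bar>pooled I \<tau> x\<bar> * (D + norm (V k \<tau> x))) \<le> B"
    using local_flux_bound by metis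
  have ic: "integrable lborel (\<lambda>x. c i \<tau> x * chi R x)" if "0 < \<tau>" "1 \<le> R" for \<tau> R
    by (intro integrable_mult_chi c_continuous that)
  have step: "(LINT x|lborel. c i t x * chi R x) \<le> (LINT x|lborel. c i s x) + (42 * B * (t - s)) / R"
    if s: "0 < s" "s < t" and R: "1 \<le> R" for s R
  proof -
    have R0: "0 < R" using R by simp
    let ?F = "\<lambda>\<tau>. LINT x|lborel. c i \<tau> x * cutoff R (x \<bullet> x)"
    have ex: "\<exists>F'. (?F has_real_derivative F') (at \<tau>) \<and> F' \<le> 42 * B / R" if \<tau>: "s \<le> \<tau>" "\<tau> \<le> t" for \<tau>
    proof -
      have \<tau>0: "0 < \<tau>" using s \<tau> by simp
      obtain T where T: "(?F has_real_derivative
        T - (LINT x|lborel. dissipation_term (\<lambda>_. 0) {i} (cutoff R) \<tau> x) + (LINT x|lborel. compression_term (\<lambda>s. s) (\<lambda>_. 1) (z i) {i} (cutoff R) \<tau> x)) (at \<tau>)"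
        "\<And>F. (LINT x|lborel. \<bar>pooled {i} \<tau> x\<bar> * (D + norm (V (z i) \<tau> x))) \<le> F \<Longrightarrow> \<bar>T\<bar> \<le> 1 * (42 / R) * F"
        by (rule evolution[of "{i}" "z i", OF _ valence radial_weight_cutoff[OF R] DERIV_ident DERIV_const continuous_on_const _ _ \<tau>0, of 1]) (auto simp: pooled_singleton)
      have "\<bar>T\<bar> \<le> 1 * (42 / R) * B" by (rule T(2)[OF B(2)[OF \<tau>0 \<tau>(2) valence]])
      hence "T \<le> 42 * B / R" by simp
      with T(1) show ?thesis by (auto simp: dissipation_term_def compression_term_def)
    qed
    have "?F t \<le> ?F s + (42 * B / R) * (t - s)"
      by (rule growth_le[OF ex]) (use s in auto)
    moreover have "?F s \<le> (LINT x|lborel. c i s x)"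
    proof (rule integral_mono)
      show "integrable lborel (\<lambda>x. c i s x * cutoff R (x \<bullet> x))" using ic[OF s(1) R] by (simp add: chi_def)
      show "integrable lborel (c i s)" using s by (intro sobolev_c) simp
      show "c i s x * cutoff R (x \<bullet> x) \<le> c i s x" for x
        using mult_left_mono[OF cutoff_range(2)[OF R0, of "x \<bullet> x"] nonneg[OF s(1), of i x]] by simp
    qed
    ultimately show ?thesis by (simp add: chi_def)
  qed
  have A: "(LINT x|lborel. c i t x * chi r x) \<le> l1_norm (c0 i)" if r: "1 \<le> r" for r
  proof -
    have "(LINT x|lborel. c i t x * chi r x) \<le> (LINT x|lborel. c i s x)" if s: "0 < s" "s < t" for s
    proof (rule le_of_le_add_divide)
      fix R assume R: "r \<le> R"
      have "(LINT x|lborel. c i t x * chi r x) \<le> (LINT x|lborel. c i t x * chi R x)"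
        using r R by (intro integral_mono ic t mult_left_mono chi_mono nonneg) auto
      also have "\<dots> \<le> (LINT x|lborel. c i s x) + (42 * B * (t - s)) / R" using r R by (intro step s) simp
      finally show "(LINT x|lborel. c i t x * chi r x) \<le> (LINT x|lborel. c i s x) + (42 * B * (t - s)) / R" .
    qed
    moreover have "(LINT x|lborel. c i s x) \<le> l1_norm (\<lambda>x. c i s x - c0 i x) + l1_norm (c0 i)" if "0 < s" for s
    proof -
      have i: "integrable lborel (c i s)" "integrable lborel (\<lambda>x. \<bar>c i s x - c0 i x\<bar>)" "integrable lborel (\<lambda>x. \<bar>c0 i x\<bar>)"
        using sobolev_c(1)[of s i] initial(3)[of i] that by auto
      have "(LINT x|lborel. c i s x) \<le> (LINT x|lborel. \<bar>c i s x - c0 i x\<bar> + \<bar>c0 i x\<bar>)"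
        using i by (intro integral_mono) auto
      thus ?thesis using i by (simp add: l1_norm_def)
    qed
    ultimately have le: "(LINT x|lborel. c i t x * chi r x) \<le> l1_norm (\<lambda>x. c i s x - c0 i x) + l1_norm (c0 i)" if "0 < s" "s < t" for s
      using that order_trans by blast
    have "(LINT x|lborel. c i t x * chi r x) \<le> 0 + l1_norm (c0 i)"
    proof (rule tendsto_lowerbound)
      show "((\<lambda>s. l1_norm (\<lambda>x. c i s x - c0 i x) + l1_norm (c0 i)) \<longlongrightarrow> 0 + l1_norm (c0 i)) (at_right 0)"
        by (intro tendsto_intros initial_limit)
      show "\<forall>\<^sub>F s in at_right 0. (LINT x|lborel. c i t x * chi r x) \<le> l1_norm (\<lambda>x. c i s x - c0 i x) + l1_norm (c0 i)"
        using eventually_at_right_less[of 0] eventually_at_right_real[OF t] by eventually_elim (use le in auto)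
    qed simp
    thus ?thesis by simp
  qed
  show ?thesis
    using t by (intro integrable_chi_limit(2)[OF nonneg[OF t] measurable_c ic[OF t] A]) auto
qed

section \<open>The energy inequality\<close>

lemma jcont_bounded:
  fixes f :: "real \<Rightarrow> space \<Rightarrow> real"
  assumes f: "jcont f" and s: "0 < s"
  obtains S where "0 \<le> S" "\<And>\<tau> x. s \<le> \<tau> \<Longrightarrow> \<tau> \<le> t \<Longrightarrow> norm x \<le> r \<Longrightarrow> \<bar>f \<tau> x\<bar> \<le> S"
proof -
  have "compact ({s..t} \<times> cball (0 :: space) r)" by (intro compact_Times compact_Icc compact_cball)
  moreover have "continuous_on ({s..t} \<times> cball 0 r) (\<lambda>p. f (fst p) (snd p))"
    using f s unfolding jcont_def by (elim continuous_on_subset) auto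
  ultimately have "bounded ((\<lambda>p. f (fst p) (snd p)) ` ({s..t} \<times> cball 0 r))"
    by (intro compact_imp_bounded compact_continuous_image)
  then obtain S where S: "\<forall>y\<in>(\<lambda>p. f (fst p) (snd p)) ` ({s..t} \<times> cball 0 r). norm y \<le> S"
    unfolding bounded_iff by blast
  have "\<bar>f \<tau> x\<bar> \<le> \<bar>S\<bar>" if "s \<le> \<tau>" "\<tau> \<le> t" "norm x \<le> r" for \<tau> x
  proof -
    have "(\<tau>, x) \<in> {s..t} \<times> cball 0 r" using that by simp
    hence "norm (f (fst (\<tau>, x)) (snd (\<tau>, x))) \<le> S" using S by blast
    thus ?thesis by simp
  qed
  thus ?thesis using that[of "\<bar>S\<bar>"] by simp
qed

definition local_energy :: "real \<Rightarrow> real \<Rightarrow> real" where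
  "local_energy r \<tau> = (LINT x|lborel. ((\<Sum>j\<in>UNIV. (d_pooled cations j \<tau> x)\<^sup>2) + (\<Sum>j\<in>UNIV. (d_pooled (- cations) j \<tau> x)\<^sup>2)) * chi r x)"

lemma jcont_gradients: "jcont (\<lambda>\<tau> x. (\<Sum>j\<in>UNIV. (d_pooled I j \<tau> x)\<^sup>2))"
  by (intro jcont_intros jcont_pooled)

lemma local_energy_continuous:
  assumes "1 \<le> r" shows "continuous_on {0<..} (local_energy r)"
  unfolding local_energy_def
  by (rule jcont_integral_continuous[where R = r])
     (use assms in \<open>auto intro!: jcont_intros jcont_gradients jcont_space chi_continuous simp: chi_support\<close>)

text \<open>The function \<open>s\<^sup>2\<close> itself would need integrability of \<open>P\<^sup>2 \<bar>u\<bar>\<close>. The functions \<open>2 a soft_abs a\<close> grow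
  linearly and lie below \<open>s\<^sup>2\<close>; on a bounded set of values and for large \<open>a\<close> they and their second
  derivatives are at least \<open>s\<^sup>2 / 2\<close> and 1. So \<open>a\<close> is chosen large for the inner radius \<open>r\<close> and the time
  interval, and then the outer radius \<open>R\<close> of the weight tends to infinity while \<open>a\<close> and \<open>r\<close> stay fixed.\<close>

theorem energy_inequality:
  assumes s: "0 < s" "s < t" and r: "1 \<le> r"
  shows "1/2 * (LINT x|lborel. ((pooled cations t x)\<^sup>2 + (pooled (- cations) t x)\<^sup>2) * chi r x) + D * integral {s..t} (local_energy r) \<le> pooled_square s"
proof -
  have t: "0 < t" and r0: "0 < r" using s r by auto
  obtain B where B: "0 \<le> B" "\<And>\<tau> I k. 0 < \<tau> \<Longrightarrow> \<tau> \<le> t \<Longrightarrow> \<bar>k\<bar> = zabs \<Longrightarrow>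
      (LINT x|lborel. \<bar>pooled I \<tau> x\<bar> * (D + norm (V k \<tau> x))) \<le> B"
    using local_flux_bound by metis
  obtain S1 where S1: "0 \<le> S1" "\<And>\<tau> x. s \<le> \<tau> \<Longrightarrow> \<tau> \<le> t \<Longrightarrow> norm x \<le> r \<Longrightarrow> \<bar>pooled cations \<tau> x\<bar> \<le> S1"
    using jcont_bounded[OF jcont_pooled(1) s(1)] by blast
  obtain S2 where S2: "0 \<le> S2" "\<And>\<tau> x. s \<le> \<tau> \<Longrightarrow> \<tau> \<le> t \<Longrightarrow> norm x \<le> r \<Longrightarrow> \<bar>pooled (- cations) \<tau> x\<bar> \<le> S2"
    using jcont_bounded[OF jcont_pooled(1) s(1)] by blast
  \<comment> \<open>On the inner ball all values have modulus at most half of \<open>a\<close>, the range of \<open>soft_square_bounds\<close>.\<close>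
  define a where "a = 2 * (S1 + S2) + 1"
  have a: "0 < a" using S1 S2 by (simp add: a_def)
  have small: "\<bar>pooled I \<tau> x\<bar> \<le> a / 2" if "I = cations \<or> I = - cations" "s \<le> \<tau>" "\<tau> \<le> t" "norm x \<le> r" for I \<tau> x
  proof -
    have "\<bar>pooled I \<tau> x\<bar> \<le> S1 + S2" using that S1(1) S2(1) S1(2)[OF that(2-4)] S2(2)[OF that(2-4)] by (elim disjE) auto
    thus ?thesis by (simp add: a_def)
  qed
  let ?\<beta> = "\<lambda>s. 2 * a * soft_abs a s" and ?\<beta>1 = "\<lambda>s. 2 * a * soft_abs1 a s" and ?\<beta>2 = "\<lambda>s. 2 * a * soft_abs2 a s"
  have \<beta>: "(?\<beta> has_real_derivative ?\<beta>1 s) (at s)" "(?\<beta>1 has_real_derivative ?\<beta>2 s) (at s)" for s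
    by (intro DERIV_cmult DERIV_soft_abs a)+
  have \<beta>c: "continuous_on UNIV ?\<beta>2" by (intro continuous_intros DERIV_soft_abs(3) a)
  have \<beta>b: "\<bar>?\<beta> s\<bar> \<le> 2 * a * \<bar>s\<bar>" for s
    using soft_abs_bounds(2,3)[OF a, of s] a by (simp add: abs_mult mult_left_mono)
  have c\<beta>: "continuous_on UNIV ?\<beta>" using \<beta>(1) DERIV_isCont continuous_at_imp_continuous_on by blast
  have step: "1/2 * (LINT x|lborel. ((pooled cations t x)\<^sup>2 + (pooled (- cations) t x)\<^sup>2) * chi r x) + D * integral {s..t} (local_energy r)
      \<le> pooled_square s + (168 * a * B * (t - s)) / R" if R: "r \<le> R" for R
  proof -
    have R1: "1 \<le> R" and R0: "0 < R" using r R by auto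
    let ?f = "\<lambda>I \<tau>. LINT x|lborel. ?\<beta> (pooled I \<tau> x) * cutoff R (x \<bullet> x)"
    let ?M = "168 * a * B / R"
    have ex: "\<exists>F'. ((\<lambda>\<tau>. ?f cations \<tau> + ?f (- cations) \<tau>) has_real_derivative F') (at \<tau>) \<and> F' \<le> ?M - D * local_energy r \<tau>"
      if \<tau>: "s \<le> \<tau>" "\<tau> \<le> t" for \<tau>
    proof -
      have \<tau>0: "0 < \<tau>" using s \<tau> by simp
      have k: "\<bar>zabs\<bar> = zabs" "\<bar>- zabs\<bar> = zabs" using zabs_nonneg by auto
      have a2: "0 \<le> 2 * a" using a by simp
      obtain T1 where T1: "(?f cations has_real_derivative T1 - (LINT x|lborel. dissipation_term ?\<beta>2 cations (cutoff R) \<tau> x)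
           + (LINT x|lborel. compression_term ?\<beta> ?\<beta>1 zabs cations (cutoff R) \<tau> x)) (at \<tau>)"
        "\<And>F. (LINT x|lborel. \<bar>pooled cations \<tau> x\<bar> * (D + norm (V zabs \<tau> x))) \<le> F \<Longrightarrow> \<bar>T1\<bar> \<le> 2 * a * (42 / R) * F"
        "integrable lborel (dissipation_term ?\<beta>2 cations (cutoff R) \<tau>)" "integrable lborel (compression_term ?\<beta> ?\<beta>1 zabs cations (cutoff R) \<tau>)"
        by (rule evolution[of cations zabs, OF valence_cations(1) k(1) radial_weight_cutoff[OF R1] \<beta> \<beta>c \<beta>b a2 \<tau>0]) auto
      obtain T2 where T2: "(?f (- cations) has_real_derivative T2 - (LINT x|lborel. dissipation_term ?\<beta>2 (- cations) (cutoff R) \<tau> x)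
           + (LINT x|lborel. compression_term ?\<beta> ?\<beta>1 (- zabs) (- cations) (cutoff R) \<tau> x)) (at \<tau>)"
        "\<And>F. (LINT x|lborel. \<bar>pooled (- cations) \<tau> x\<bar> * (D + norm (V (- zabs) \<tau> x))) \<le> F \<Longrightarrow> \<bar>T2\<bar> \<le> 2 * a * (42 / R) * F"
        "integrable lborel (dissipation_term ?\<beta>2 (- cations) (cutoff R) \<tau>)" "integrable lborel (compression_term ?\<beta> ?\<beta>1 (- zabs) (- cations) (cutoff R) \<tau>)"
        by (rule evolution[of "- cations" "- zabs", OF valence_cations(2) k(2) radial_weight_cutoff[OF R1] \<beta> \<beta>c \<beta>b a2 \<tau>0]) auto
      have "\<bar>T1\<bar> \<le> 2 * a * (42 / R) * B" "\<bar>T2\<bar> \<le> 2 * a * (42 / R) * B"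
        by (rule T1(2)[OF B(2)[OF \<tau>0 \<tau>(2) k(1)]] T2(2)[OF B(2)[OF \<tau>0 \<tau>(2) k(2)]])+
      moreover have "2 * a * (42 / R) * B + 2 * a * (42 / R) * B = ?M" by simp
      ultimately have T: "T1 + T2 \<le> ?M" by linarith
      have compression_term: "(LINT x|lborel. compression_term ?\<beta> ?\<beta>1 zabs cations (cutoff R) \<tau> x) + (LINT x|lborel. compression_term ?\<beta> ?\<beta>1 (- zabs) (- cations) (cutoff R) \<tau> x) \<le> 0"
      proof -
        have "(LINT x|lborel. compression_term ?\<beta> ?\<beta>1 zabs cations (cutoff R) \<tau> x) + (LINT x|lborel. compression_term ?\<beta> ?\<beta>1 (- zabs) (- cations) (cutoff R) \<tau> x)
          = (LINT x|lborel. compression_term ?\<beta> ?\<beta>1 zabs cations (cutoff R) \<tau> x + compression_term ?\<beta> ?\<beta>1 (- zabs) (- cations) (cutoff R) \<tau> x)"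
          using T1(4) T2(4) by (rule Bochner_Integration.integral_add[symmetric])
        also have "\<dots> \<le> (LINT x|(lborel :: space measure). 0)"
        proof (rule integral_mono)
          show "integrable lborel (\<lambda>x. compression_term ?\<beta> ?\<beta>1 zabs cations (cutoff R) \<tau> x + compression_term ?\<beta> ?\<beta>1 (- zabs) (- cations) (cutoff R) \<tau> x)"
            using T1(4) T2(4) by (rule Bochner_Integration.integrable_add)
          fix x
          let ?P = "pooled cations \<tau> x" and ?N = "pooled (- cations) \<tau> x"
          let ?g = "\<lambda>s. s * soft_abs1 a s - soft_abs a s"
          \<comment> \<open>The charge density is \<open>zabs\<close> times the difference of the two pools, which makes the sum a product of
            increments of \<open>?g\<close> and of its argument.\<close>
          have "compression_term ?\<beta> ?\<beta>1 zabs cations (cutoff R) \<tau> x + compression_term ?\<beta> ?\<beta>1 (- zabs) (- cations) (cutoff R) \<tau> x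
            = - (2 * a * (zabs\<^sup>2 * D) * cutoff R (x \<bullet> x) * ((?g ?P - ?g ?N) * (?P - ?N)))"
            unfolding compression_term_def \<rho>_eq(1) by (simp add: algebra_simps power2_eq_square)
          moreover have "0 \<le> 2 * a * (zabs\<^sup>2 * D) * cutoff R (x \<bullet> x) * ((?g ?P - ?g ?N) * (?P - ?N))"
            using a D cutoff_range(1)[OF R0, of "x \<bullet> x"]
            by (intro mult_nonneg_nonneg[OF _ soft_abs_compression_mono[OF a nonneg_pooled[OF \<tau>0] nonneg_pooled[OF \<tau>0]]]) simp
          ultimately show "compression_term ?\<beta> ?\<beta>1 zabs cations (cutoff R) \<tau> x + compression_term ?\<beta> ?\<beta>1 (- zabs) (- cations) (cutoff R) \<tau> x \<le> 0" by linarith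
        qed simp
        finally show ?thesis by simp
      qed
      have dissI: "(LINT x|lborel. D * ((\<Sum>j\<in>UNIV. (d_pooled I j \<tau> x)\<^sup>2) * chi r x)) \<le> (LINT x|lborel. dissipation_term ?\<beta>2 I (cutoff R) \<tau> x)"
        "integrable lborel (\<lambda>x. (\<Sum>j\<in>UNIV. (d_pooled I j \<tau> x)\<^sup>2) * chi r x)"
        if I: "I = cations \<or> I = - cations" for I
      proof -
        show i: "integrable lborel (\<lambda>x. (\<Sum>j\<in>UNIV. (d_pooled I j \<tau> x)\<^sup>2) * chi r x)"
          by (intro integrable_mult_chi r jcont_slice[OF jcont_gradients] \<tau>0)
        show "(LINT x|lborel. D * ((\<Sum>j\<in>UNIV. (d_pooled I j \<tau> x)\<^sup>2) * chi r x)) \<le> (LINT x|lborel. dissipation_term ?\<beta>2 I (cutoff R) \<tau> x)"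
        proof (rule integral_mono)
          show "integrable lborel (\<lambda>x. D * ((\<Sum>j\<in>UNIV. (d_pooled I j \<tau> x)\<^sup>2) * chi r x))" using i by (rule integrable_mult_right)
          show "integrable lborel (dissipation_term ?\<beta>2 I (cutoff R) \<tau>)" using T1(3) T2(3) I by auto
          fix x
          let ?G = "(\<Sum>j\<in>UNIV. (d_pooled I j \<tau> x)\<^sup>2)"
          have G: "0 \<le> ?G" by (intro sum_nonneg) simp
          show "D * (?G * chi r x) \<le> dissipation_term ?\<beta>2 I (cutoff R) \<tau> x"
          proof (cases "norm x \<le> r")
            case True
            have "?G * chi r x \<le> ?G * chi R x" using G R r0 by (intro mult_left_mono chi_mono) auto
            also have "\<dots> \<le> (?\<beta>2 (pooled I \<tau> x) * ?G) * chi R x"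
              using soft_square_bounds(3)[OF a small[OF I \<tau> True]] G chi_range(1)[OF R0, of x]
                mult_right_mono[of 1 "?\<beta>2 (pooled I \<tau> x)" ?G]
              by (intro mult_right_mono) auto
            finally show ?thesis using D by (simp add: dissipation_term_def chi_def mult.assoc)
          next
            case False
            have "0 \<le> dissipation_term ?\<beta>2 I (cutoff R) \<tau> x" unfolding dissipation_term_def
              using D a G soft_abs_bounds(4)[OF a] cutoff_range(1)[OF R0, of "x \<bullet> x"] by (intro mult_nonneg_nonneg) auto
            thus ?thesis using False chi_support[OF r0, of x] by simp
          qed
        qed
      qed
      have "D * local_energy r \<tau> = (LINT x|lborel. D * ((\<Sum>j\<in>UNIV. (d_pooled cations j \<tau> x)\<^sup>2) * chi r x))
          + (LINT x|lborel. D * ((\<Sum>j\<in>UNIV. (d_pooled (- cations) j \<tau> x)\<^sup>2) * chi r x))"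
        using dissI(2)[of cations] dissI(2)[of "- cations"] by (simp add: local_energy_def distrib_right distrib_left)
      hence "D * local_energy r \<tau> \<le> (LINT x|lborel. dissipation_term ?\<beta>2 cations (cutoff R) \<tau> x) + (LINT x|lborel. dissipation_term ?\<beta>2 (- cations) (cutoff R) \<tau> x)"
        using dissI(1)[of cations] dissI(1)[of "- cations"] by simp
      hence "(T1 - (LINT x|lborel. dissipation_term ?\<beta>2 cations (cutoff R) \<tau> x) + (LINT x|lborel. compression_term ?\<beta> ?\<beta>1 zabs cations (cutoff R) \<tau> x))
        + (T2 - (LINT x|lborel. dissipation_term ?\<beta>2 (- cations) (cutoff R) \<tau> x) + (LINT x|lborel. compression_term ?\<beta> ?\<beta>1 (- zabs) (- cations) (cutoff R) \<tau> x))
        \<le> ?M - D * local_energy r \<tau>"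
        using T compression_term by linarith
      with DERIV_add[OF T1(1) T2(1)] show ?thesis by blast
    qed
    define F where "F \<tau> = ?f cations \<tau> + ?f (- cations) \<tau>" for \<tau>
    have le: "local_energy r integrable_on {s..t}"
      by (intro integrable_continuous_real continuous_on_subset[OF local_energy_continuous[OF r]]) (use s in auto)
    have 2: "((\<lambda>\<tau>. ?M - D * local_energy r \<tau>) has_integral ?M * (t - s) - D * integral {s..t} (local_energy r)) {s..t}"
      using has_integral_diff[OF has_integral_const_real[of ?M s t] has_integral_mult_right[OF integrable_integral[OF le], of D]] s
      by (simp add: mult.commute)
    have FF: "F t \<le> F s + (?M * (t - s) - D * integral {s..t} (local_energy r))"
      by (rule growth_le_integral[OF ex[folded F_def] 2]) (use s in auto)
    have i\<beta>: "integrable lborel (\<lambda>x. ?\<beta> (pooled I \<tau> x) * chi R x)" if "0 < \<tau>" for I \<tau>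
      by (intro integrable_mult_chi R1 continuous_on_compose2[OF c\<beta> jcont_slice[OF jcont_pooled(1) that]]) auto
    have "F s \<le> pooled_square s"
    proof -
      have "?f I s \<le> (LINT x|lborel. (pooled I s x)\<^sup>2)" for I
      proof (rule integral_mono)
        show "integrable lborel (\<lambda>x. ?\<beta> (pooled I s x) * cutoff R (x \<bullet> x))" using i\<beta>[OF s(1)] by (simp add: chi_def)
        show "integrable lborel (\<lambda>x. (pooled I s x)\<^sup>2)" by (rule pooled_integrable(2)[OF s(1)])
        fix x
        have "?\<beta> (pooled I s x) * chi R x \<le> (pooled I s x)\<^sup>2 * 1"
          using chi_range[OF R0, of x] soft_square_bounds(1)[OF a, of "pooled I s x"] by (intro mult_mono) auto
        thus "?\<beta> (pooled I s x) * cutoff R (x \<bullet> x) \<le> (pooled I s x)\<^sup>2" by (simp add: chi_def)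
      qed
      from this[of cations] this[of "- cations"] show ?thesis by (simp only: F_def pooled_square_def)
    qed
    moreover have "1/2 * (LINT x|lborel. ((pooled cations t x)\<^sup>2 + (pooled (- cations) t x)\<^sup>2) * chi r x) \<le> F t"
    proof -
      have i2: "integrable lborel (\<lambda>x. (pooled I t x)\<^sup>2 * chi r x)" for I
        by (intro integrable_mult_chi r continuous_intros jcont_slice[OF jcont_pooled(1) t])
      have h: "1/2 * (LINT x|lborel. (pooled I t x)\<^sup>2 * chi r x) \<le> ?f I t" if I: "I = cations \<or> I = - cations" for I
      proof -
        have "1/2 * (LINT x|lborel. (pooled I t x)\<^sup>2 * chi r x) = (LINT x|lborel. 1/2 * ((pooled I t x)\<^sup>2 * chi r x))" by simp
        also have "\<dots> \<le> ?f I t"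
        proof (rule integral_mono)
          show "integrable lborel (\<lambda>x. 1/2 * ((pooled I t x)\<^sup>2 * chi r x))" using i2 by (rule integrable_mult_right)
          show "integrable lborel (\<lambda>x. ?\<beta> (pooled I t x) * cutoff R (x \<bullet> x))" using i\<beta>[OF t] by (simp add: chi_def)
          fix x
          show "1/2 * ((pooled I t x)\<^sup>2 * chi r x) \<le> ?\<beta> (pooled I t x) * cutoff R (x \<bullet> x)"
          proof (cases "norm x \<le> r")
            case True
            have "((pooled I t x)\<^sup>2 / 2) * chi r x \<le> ?\<beta> (pooled I t x) * chi R x"
              using soft_square_bounds(2)[OF a small[OF I _ order_refl True]] s chi_range(1)[OF r0, of x]
                chi_mono[OF r0 R, of x] a soft_abs_bounds(2)[OF a, of "pooled I t x"] by (intro mult_mono) auto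
            thus ?thesis by (simp add: chi_def)
          next
            case False
            have "0 \<le> ?\<beta> (pooled I t x) * cutoff R (x \<bullet> x)"
              using a soft_abs_bounds(2)[OF a] cutoff_range(1)[OF R0, of "x \<bullet> x"] by (intro mult_nonneg_nonneg) auto
            thus ?thesis using False chi_support[OF r0, of x] by simp
          qed
        qed
        finally show ?thesis .
      qed
      have "(LINT x|lborel. ((pooled cations t x)\<^sup>2 + (pooled (- cations) t x)\<^sup>2) * chi r x)
          = (LINT x|lborel. (pooled cations t x)\<^sup>2 * chi r x) + (LINT x|lborel. (pooled (- cations) t x)\<^sup>2 * chi r x)"
        unfolding distrib_right by (rule Bochner_Integration.integral_add[OF i2 i2])
      moreover have "F t = ?f cations t + ?f (- cations) t" by (simp only: F_def)
      ultimately show ?thesis using h[OF disjI1[OF refl]] h[OF disjI2[OF refl]] by linarith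
    qed
    moreover have "?M * (t - s) = (168 * a * B * (t - s)) / R" by simp
    ultimately show ?thesis using FF by linarith
  qed
  show ?thesis by (rule le_of_le_add_divide[OF step])
qed

definition square_data :: real where
  "square_data = 2 * real (card (UNIV :: 'n set)) * (\<Sum>i\<in>UNIV. 1 + 2 * (sobolev_norm 2 (c0 i))\<^sup>2)"

lemma square_data_nonneg: "0 \<le> square_data"
  unfolding square_data_def by (intro mult_nonneg_nonneg sum_nonneg) auto

lemma pooled_square_initial: "\<forall>\<^sub>F s in at_right 0. pooled_square s \<le> square_data"
proof -
  have "((\<lambda>t. sobolev_norm 1 (\<lambda>x. c i t x - c i 0 x)) \<longlongrightarrow> 0) (at 0 within {0..})" for i
    using sol unfolding npd_solution_def by blast
  hence "((\<lambda>t. sobolev_norm 1 (\<lambda>x. c i t x - c i 0 x)) \<longlongrightarrow> 0) (at 0 within {0<..})" for i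
    by (rule tendsto_within_subset) auto
  hence "\<forall>\<^sub>F s in at_right 0. sobolev_norm 1 (\<lambda>x. c i s x - c i 0 x) < 1/2" for i
    by (rule order_tendstoD(2)) simp
  hence "\<forall>\<^sub>F s in at_right 0. \<forall>i. sobolev_norm 1 (\<lambda>x. c i s x - c i 0 x) < 1/2"
    by (intro eventually_all_finite)
  thus ?thesis using eventually_at_right_less[of 0]
  proof eventually_elim
    case (elim s)
    have s: "0 \<le> s" using elim by simp
    have "(LINT x|lborel. (c i s x)\<^sup>2) \<le> 1 + 2 * (sobolev_norm 2 (c0 i))\<^sup>2" for i
    proof -
      have n: "0 \<le> sobolev_norm 1 (\<lambda>x. c i s x - c i 0 x)" by (simp add: sobolev_norm_def sum_nonneg)
      have "(sobolev_norm 1 (\<lambda>x. c i s x - c i 0 x))\<^sup>2 \<le> (1/2)\<^sup>2"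
        using elim(1) n by (intro power_mono) (auto simp: less_imp_le)
      moreover have "weak_energy [] (c i s) \<le> 2 * (sobolev_norm 1 (\<lambda>x. c i s x - c i 0 x))\<^sup>2 + 2 * weak_energy [] (c i 0)"
        by (rule weak_energy_triangle[OF sobolev_c(2)[OF s] sobolev_c(2)]) auto
      moreover have "weak_energy [] (c i 0) \<le> (sobolev_norm 2 (c0 i))\<^sup>2"
        unfolding c_at_0 by (rule weak_energy_le_sobolev_norm) simp
      ultimately show ?thesis unfolding c_square(2)[OF s] by (simp add: power_divide)
    qed
    hence A: "(\<Sum>i\<in>I. LINT x|lborel. (c i s x)\<^sup>2) \<le> (\<Sum>i\<in>I. 1 + 2 * (sobolev_norm 2 (c0 i))\<^sup>2)" for I by (intro sum_mono)
    have "(LINT x|lborel. (pooled I s x)\<^sup>2) \<le> real (card (UNIV :: 'n set)) * (\<Sum>i\<in>UNIV. 1 + 2 * (sobolev_norm 2 (c0 i))\<^sup>2)" for I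
    proof -
      have "(LINT x|lborel. (pooled I s x)\<^sup>2) \<le> real (card I) * (\<Sum>i\<in>I. LINT x|lborel. (c i s x)\<^sup>2)"
        unfolding pooled_def using s by (intro integrable_sum_square(2) measurable_c c_square) auto
      also have "\<dots> \<le> real (card (UNIV :: 'n set)) * (\<Sum>i\<in>UNIV. 1 + 2 * (sobolev_norm 2 (c0 i))\<^sup>2)"
        by (intro mult_mono order_trans[OF A] sum_mono2 sum_nonneg) (auto intro!: card_mono)
      finally show ?thesis .
    qed
    from this[of cations] this[of "- cations"] show ?case by (simp add: pooled_square_def square_data_def)
  qed
qed

lemma pooled_square_le:
  assumes t: "0 < t" shows "pooled_square t \<le> 2 * square_data"
proof -
  obtain s where s: "0 < s" "s < t" "pooled_square s \<le> square_data"
    using eventually_happens[OF eventually_conj[OF pooled_square_initial eventually_at_right_real[OF t]]] by auto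
  let ?f = "\<lambda>x. (pooled cations t x)\<^sup>2 + (pooled (- cations) t x)\<^sup>2"
  have c: "continuous_on UNIV ?f" by (intro continuous_intros jcont_slice[OF jcont_pooled(1) t])
  have "(LINT x|lborel. ?f x) \<le> 2 * square_data"
  proof (rule integrable_chi_limit(2))
    show "?f \<in> borel_measurable borel" using c by (rule borel_measurable_continuous_onI)
    show "integrable lborel (\<lambda>x. ?f x * chi R x)" if "1 \<le> R" for R by (intro integrable_mult_chi c that)
    show "(LINT x|lborel. ?f x * chi r x) \<le> 2 * square_data" if r: "1 \<le> r" for r
    proof -
      have "0 \<le> integral {s..t} (local_energy r)"
        using s r by (intro Henstock_Kurzweil_Integration.integral_nonneg integrable_continuous_real
            continuous_on_subset[OF local_energy_continuous[OF r]])
          (auto simp: local_energy_def intro!: Bochner_Integration.integral_nonneg mult_nonneg_nonneg add_nonneg_nonneg sum_nonneg chi_range)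
      hence "0 \<le> D * integral {s..t} (local_energy r)" using D by simp
      with energy_inequality[OF s(1,2) r] s(3) show ?thesis by linarith
    qed
  qed simp
  thus ?thesis unfolding pooled_square_def
    using Bochner_Integration.integral_add[OF pooled_integrable(2)[OF t, of cations] pooled_integrable(2)[OF t, of "- cations"]] by simp
qed

lemma energy_eq:
  assumes t: "0 < t"
  shows "(\<lambda>n. local_energy (real (Suc n)) t) \<longlonglongrightarrow> energy t"
proof -
  let ?f = "\<lambda>x. (\<Sum>j\<in>UNIV. (d_pooled cations j t x)\<^sup>2) + (\<Sum>j\<in>UNIV. (d_pooled (- cations) j t x)\<^sup>2)"
  have c: "continuous_on UNIV ?f" by (intro continuous_intros jcont_slice[OF jcont_pooled(2) t])
  have i: "integrable lborel ?f" by (intro Bochner_Integration.integrable_add Bochner_Integration.integrable_sum pooled_integrable t)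
  have f0: "0 \<le> ?f x" for x by (intro add_nonneg_nonneg sum_nonneg) auto
  have "(\<lambda>n. LINT x|lborel. ?f x * chi (real (Suc n)) x) \<longlonglongrightarrow> (LINT x|lborel. ?f x)"
  proof (rule integrable_chi_limit(3)[OF f0])
    show "?f \<in> borel_measurable borel" using c by (rule borel_measurable_continuous_onI)
    show ic: "integrable lborel (\<lambda>x. ?f x * chi R x)" if "1 \<le> R" for R by (intro integrable_mult_chi c that)
    show "(LINT x|lborel. ?f x * chi R x) \<le> (LINT x|lborel. ?f x)" if "1 \<le> R" for R
    proof (rule integral_mono[OF ic[OF that] i])
      show "?f x * chi R x \<le> ?f x" for x using mult_left_mono[OF chi_range(2) f0, of R x x] that by simp
    qed
  qed
  also have "(LINT x|lborel. ?f x) = energy t"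
    using pooled_integrable(3)[OF t] by (simp add: energy_def sum.distrib Bochner_Integration.integral_sum)
  finally show ?thesis by (simp only: local_energy_def)
qed

text \<open>Monotone convergence in the radius, uniformly bounded by the energy inequality.\<close>

lemma energy_integrable:
  assumes s: "0 < s" "s < t" and m: "pooled_square s \<le> square_data"
  shows "energy integrable_on {s..t}" "integral {s..t} energy \<le> square_data / D"
proof -
  have bd: "integral {s..t} (local_energy r) \<le> square_data / D" and nn: "0 \<le> integral {s..t} (local_energy r)"
    and int: "local_energy r integrable_on {s..t}" if r: "1 \<le> r" for r
  proof -
    show int: "local_energy r integrable_on {s..t}"
      by (intro integrable_continuous_real continuous_on_subset[OF local_energy_continuous[OF r]]) (use s in auto)
    show "0 \<le> integral {s..t} (local_energy r)"
      using r by (intro Henstock_Kurzweil_Integration.integral_nonneg int)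
        (auto simp: local_energy_def intro!: Bochner_Integration.integral_nonneg mult_nonneg_nonneg add_nonneg_nonneg sum_nonneg chi_range)
    have "0 \<le> (LINT x|lborel. ((pooled cations t x)\<^sup>2 + (pooled (- cations) t x)\<^sup>2) * chi r x)"
      using r by (intro Bochner_Integration.integral_nonneg) (auto intro!: mult_nonneg_nonneg chi_range)
    hence "D * integral {s..t} (local_energy r) \<le> square_data" using energy_inequality[OF s r] m by linarith
    thus "integral {s..t} (local_energy r) \<le> square_data / D" using D by (simp add: field_simps)
  qed
  have "energy integrable_on {s..t} \<and> (\<lambda>n. integral {s..t} (local_energy (real (Suc n)))) \<longlonglongrightarrow> integral {s..t} energy"
  proof (rule monotone_convergence_increasing)
    show "local_energy (real (Suc n)) integrable_on {s..t}" for n by (rule int) simp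
    show "(\<lambda>n. local_energy (real (Suc n)) \<tau>) \<longlonglongrightarrow> energy \<tau>" if "\<tau> \<in> {s..t}" for \<tau>
      using that s by (intro energy_eq) auto
    show "local_energy (real (Suc n)) \<tau> \<le> local_energy (real (Suc (Suc n))) \<tau>" if "\<tau> \<in> {s..t}" for n \<tau>
    proof -
      have \<tau>: "0 < \<tau>" using that s by auto
      show ?thesis unfolding local_energy_def
        by (intro integral_mono integrable_mult_chi continuous_intros jcont_slice[OF jcont_pooled(2) \<tau>] mult_left_mono chi_mono
            add_nonneg_nonneg sum_nonneg) auto
    qed
    show "bounded (range (\<lambda>n. integral {s..t} (local_energy (real (Suc n)))))"
      using bd nn by (intro boundedI[of _ "square_data / D"]) auto
  qed
  thus "energy integrable_on {s..t}" "integral {s..t} energy \<le> square_data / D"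
    using LIMSEQ_le_const2[of _ _ "square_data / D"] bd by auto
qed

end

section \<open>A reference density\<close>

definition reference :: "space \<Rightarrow> real" where "reference x = 1 / (1 + x \<bullet> x)\<^sup>2"

lemma reference_pos: "0 < reference x"
proof -
  have "0 < 1 + x \<bullet> x" using inner_ge_zero[of x] by linarith
  thus ?thesis by (simp add: reference_def)
qed

text \<open>Dyadic balls: the function is at most \<open>16 \<cdot> 16\<^sup>-\<^sup>k\<close> outside the ball of radius \<open>2\<^sup>k\<^sup>-\<^sup>1\<close>, and the ball of
  radius \<open>2\<^sup>k\<close> has volume proportional to \<open>8\<^sup>k\<close>.\<close>

lemma integrable_reference: "integrable lborel reference"
proof -
  define f :: "nat \<Rightarrow> space \<Rightarrow> real"
    where "f k x = 16 * (1 / 16) ^ k * indicator (cball 0 (2 ^ k)) x" for k x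
  have f0: "0 \<le> f k x" for k x by (simp add: f_def)
  have fi: "integrable lborel (f k)" for k
    unfolding f_def by (intro integrable_mult_right integrable_indicator_cball)
  have meas: "measure lborel (cball (0 :: space) (2 ^ k)) = unit_ball_vol 3 * 8 ^ k" for k
    using content_cball[of "2 ^ k" "0 :: space"] by (simp add: power_mult[symmetric] mult.commute[of k] power_mult)
  have fint: "(LINT x|lborel. f k x) = 16 * unit_ball_vol 3 * (1 / 2) ^ k" for k
  proof -
    have "(LINT x|lborel. f k x) = 16 * (1 / 16) ^ k * (unit_ball_vol 3 * 8 ^ k)"
      by (simp add: f_def meas)
    also have "\<dots> = 16 * unit_ball_vol 3 * ((1 / 16) ^ k * 8 ^ k)" by simp
    also have "(1 / 16) ^ k * 8 ^ k = (1 / 2 :: real) ^ k" by (simp add: power_mult_distrib[symmetric])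
    finally show ?thesis .
  qed
  have sm: "summable (\<lambda>k. f k x)" for x
  proof (rule summable_comparison_test')
    show "summable (\<lambda>k. 16 * (1 / 16 :: real) ^ k)" by (intro summable_mult summable_geometric) simp
    show "norm (f k x) \<le> 16 * (1 / 16) ^ k" for k by (simp add: f_def indicator_def)
  qed
  have S: "integrable lborel (\<lambda>x. \<Sum>k. f k x)"
  proof (rule integrable_suminf[OF fi])
    show "AE x in lborel. summable (\<lambda>k. norm (f k x))" using sm f0 by (intro AE_I2) simp
    have "summable (\<lambda>k. 16 * unit_ball_vol 3 * (1 / 2 :: real) ^ k)" by (intro summable_mult summable_geometric) simp
    thus "summable (\<lambda>k. LINT x|lborel. norm (f k x))" using f0 fint by simp
  qed
  have le: "reference x \<le> (\<Sum>k. f k x)" for x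
  proof -
    obtain n where n: "norm x < 2 ^ n" using real_arch_pow[of 2 "norm x"] by auto
    \<comment> \<open>The first dyadic ball that contains \<open>x\<close>.\<close>
    define k where "k = (LEAST n. norm x < 2 ^ n)"
    have k: "norm x < 2 ^ k" unfolding k_def by (rule LeastI) (rule n)
    have "reference x \<le> f k x"
    proof (cases k)
      case 0
      have "1 \<le> (1 + x \<bullet> x)\<^sup>2" using inner_ge_zero[of x] by (intro one_le_power) simp
      hence "reference x \<le> 1 / 1" unfolding reference_def by (intro frac_le) auto
      thus ?thesis using k 0 by (simp add: f_def)
    next
      case (Suc m)
      have "\<not> norm x < 2 ^ m" using not_less_Least[of m "\<lambda>n. norm x < 2 ^ n"] Suc by (simp add: k_def)
      hence "(2 ^ m)\<^sup>2 \<le> (norm x)\<^sup>2" by (intro power_mono) auto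
      hence "(4 :: real) ^ m \<le> 1 + x \<bullet> x" by (simp add: power2_norm_eq_inner power_mult[symmetric] mult.commute[of m] power_mult)
      hence "(4 ^ m)\<^sup>2 \<le> (1 + x \<bullet> x)\<^sup>2" by (intro power_mono) auto
      hence "(16 :: real) ^ m \<le> (1 + x \<bullet> x)\<^sup>2" by (simp add: power_mult[symmetric] mult.commute[of m] power_mult)
      hence "reference x \<le> 1 / 16 ^ m" unfolding reference_def by (intro frac_le) auto
      thus ?thesis using k Suc by (simp add: f_def power_divide)
    qed
    also have "\<dots> \<le> (\<Sum>k. f k x)" using sum_le_suminf[OF sm, of "{k}" x] f0 by simp
    finally show ?thesis .
  qed
  have c: "continuous_on UNIV reference"
  proof -
    have "1 + x \<bullet> x \<noteq> 0" for x :: space using inner_ge_zero[of x] by linarith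
    thus ?thesis unfolding reference_def[abs_def] by (intro continuous_intros) auto
  qed
  show ?thesis
  proof (rule Bochner_Integration.integrable_bound[OF S])
    show "reference \<in> borel_measurable lborel" using borel_measurable_continuous_onI[OF c] by simp
    show "AE x in lborel. norm (reference x) \<le> norm (\<Sum>k. f k x)"
    proof (rule AE_I2)
      fix x
      show "norm (reference x) \<le> norm (\<Sum>k. f k x)"
        using le[of x] reference_pos[of x] by (simp only: real_norm_def)
    qed
  qed
qed

definition bracket :: "space \<Rightarrow> real" where "bracket x = sqrt (1 + x \<bullet> x)"

lemma bracket_ge_1: "1 \<le> bracket x"
  by (simp add: bracket_def)

lemma bracket_le: assumes "norm x \<le> R" shows "bracket x \<le> 1 + R"
proof -
  have R: "0 \<le> R" using assms norm_ge_zero[of x] by linarith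
  have "(norm x)\<^sup>2 \<le> R\<^sup>2" using assms by (intro power_mono) auto
  hence "1 + x \<bullet> x \<le> (1 + R)\<^sup>2" using R by (simp add: power2_norm_eq_inner power2_sum)
  thus ?thesis unfolding bracket_def using R by (intro real_le_lsqrt) auto
qed

lemma bracket_continuous: "continuous_on UNIV bracket"
  unfolding bracket_def[abs_def] by (intro continuous_intros)

lemma reference_bracket: "reference x = 1 / bracket x ^ 4"
proof -
  have "(sqrt (1 + x \<bullet> x))\<^sup>2 = 1 + x \<bullet> x" by (rule real_sqrt_pow2) simp
  moreover have "p ^ 4 = (p\<^sup>2)\<^sup>2" for p :: real by (simp add: eval_nat_numeral)
  hence "bracket x ^ 4 = ((sqrt (1 + x \<bullet> x))\<^sup>2)\<^sup>2" unfolding bracket_def .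
  ultimately show ?thesis by (simp only: reference_def)
qed

text \<open>The inequality \<open>ln y \<le> y - 1\<close>, once for \<open>y = reference x / c\<close> and once for \<open>y = bracket x / R\<close>.\<close>

lemma entropy_integrand_le:
  fixes c :: real
  assumes c: "0 \<le> c" and R: "1 \<le> R"
  shows "- (c * ln c) \<le> reference x + 4 * (ln R * c + c * bracket x / R)"
    "\<bar>c * ln c\<bar> \<le> c\<^sup>2 + (reference x + 4 * (ln R * c + c * bracket x / R))"
proof -
  have q: "1 \<le> bracket x" by (rule bracket_ge_1)
  have lR: "0 \<le> ln R" using R by simp
  have rhs: "0 \<le> reference x + 4 * (ln R * c + c * bracket x / R)"
    using reference_pos[of x] lR c q R by (intro add_nonneg_nonneg mult_nonneg_nonneg divide_nonneg_nonneg) auto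
  show 1: "- (c * ln c) \<le> reference x + 4 * (ln R * c + c * bracket x / R)"
  proof (cases "c = 0")
    case True thus ?thesis using reference_pos[of x] by simp
  next
    case False
    hence c0: "0 < c" using c by simp
    have "ln (reference x / c) \<le> reference x / c - 1"
      using reference_pos[of x] c0 by (intro ln_le_minus_one) simp
    moreover have "ln (reference x / c) = - 4 * ln (bracket x) - ln c"
    proof -
      have "ln (reference x / c) = ln (reference x) - ln c"
        using reference_pos[of x] c0 by (simp add: ln_div)
      moreover have "ln (bracket x ^ 4) = 4 * ln (bracket x)"
        using ln_realpow[of "bracket x" 4] q by simp
      moreover have "ln (1 / p) = - ln p" if "0 < p" for p :: real using that by (simp add: ln_div)
      hence "ln (reference x) = - ln (bracket x ^ 4)" unfolding reference_bracket using q by simp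
      ultimately show ?thesis by linarith
    qed
    ultimately have "- ln c \<le> reference x / c + 4 * ln (bracket x)" by linarith
    hence "c * (- ln c) \<le> c * (reference x / c + 4 * ln (bracket x))" using c by (rule mult_left_mono)
    also have "\<dots> = reference x + 4 * (c * ln (bracket x))" using c0 by (simp add: distrib_left)
    also have "ln (bracket x) \<le> ln R + bracket x / R"
    proof -
      have "ln (bracket x / R) \<le> bracket x / R - 1" using q R by (intro ln_le_minus_one) simp
      moreover have "ln (bracket x / R) = ln (bracket x) - ln R" using q R by (simp add: ln_div)
      ultimately show ?thesis by linarith
    qed
    hence "reference x + 4 * (c * ln (bracket x)) \<le> reference x + 4 * (c * (ln R + bracket x / R))"
      using c by (intro add_left_mono mult_left_mono) auto
    finally show ?thesis by (simp add: distrib_left mult.commute)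
  qed
  have "c * ln c \<le> c\<^sup>2"
  proof (cases "c = 0")
    case False
    hence "ln c \<le> c" using c ln_le_minus_one[of c] by simp
    thus ?thesis using mult_left_mono[OF _ c, of "ln c" c] by (simp add: power2_eq_square)
  qed simp
  with 1 rhs show "\<bar>c * ln c\<bar> \<le> c\<^sup>2 + (reference x + 4 * (ln R * c + c * bracket x / R))"
    using zero_le_power2[of c] by (simp only: abs_le_iff) linarith
qed

section \<open>Linear growth of the first moment\<close>

text \<open>The constants depend on the data only through the three families of norms: \<open>a\<close> stands for the
  \<open>L\<^sup>1\<close> norms, \<open>b\<close> for the Sobolev norms and \<open>m\<close> for the weighted \<open>L\<^sup>2\<close> norms.\<close>

definition mass_const :: "('n::finite \<Rightarrow> real) \<Rightarrow> real" where
  "mass_const a = (\<Sum>i\<in>UNIV. a i)"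

definition square_const :: "('n::finite \<Rightarrow> real) \<Rightarrow> real" where
  "square_const b = 2 * real (card (UNIV :: 'n set)) * (\<Sum>i\<in>UNIV. 1 + 2 * (b i)\<^sup>2)"

definition moment_const :: "real \<Rightarrow> real \<Rightarrow> ('n::finite \<Rightarrow> real) \<Rightarrow> ('n \<Rightarrow> real) \<Rightarrow> ('n \<Rightarrow> real) \<Rightarrow> 'n \<Rightarrow> real" where
  "moment_const D zabs a b m i =
     2 * ((b i)\<^sup>2 + (m i)\<^sup>2) + 1/2 * (LINT x|lborel. reference x)
     + 100 * ((D + 3 * zabs * D) * mass_const a + 3/2 * (2 * square_const b + 4 * zabs\<^sup>2 * square_const b))
       * ((21168 * zabs\<^sup>2 * square_const b + cutoff_energy + 3/2 * zabs * mass_const a + 1)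
          + 8 * zabs\<^sup>2 * (square_const b / D))"

context npd
begin

abbreviation "a0 \<equiv> \<lambda>i. l1_norm (c0 i)"
abbreviation "b0 \<equiv> \<lambda>i. sobolev_norm 2 (c0 i)"
abbreviation "m0 \<equiv> \<lambda>i. l2_norm (\<lambda>x. norm x ^ 3 * c0 i x)"

lemma square_const_eq: "square_const b0 = square_data"
  by (simp add: square_const_def square_data_def)

lemma a0_nonneg: "0 \<le> a0 i" by (simp add: l1_norm_def)

lemma l1_le_total: "\<bar>LINT x|lborel. c i t x\<bar> \<le> a0 i \<and> (LINT x|lborel. \<bar>c i t x\<bar>) \<le> a0 i" if "0 < t"
proof -
  have "\<bar>c i t x\<bar> = c i t x" for x using nonneg[OF that] by simp
  moreover have "0 \<le> (LINT x|lborel. c i t x)" using nonneg[OF that] by (intro Bochner_Integration.integral_nonneg)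
  ultimately show ?thesis using mass_le[OF that, of i] by simp
qed

lemma a0_le: "a0 i \<le> mass_const a0"
  unfolding mass_const_def by (rule member_le_sum) (auto simp: a0_nonneg)

lemma flux_le:
  assumes t: "0 < t"
  shows "(LINT x|lborel. \<bar>pooled {i} t x\<bar> * (D + norm (V (z i) t x))) \<le>
     ((D + 3 * zabs * D) * mass_const a0 + 3/2 * (2 * square_data + 4 * zabs\<^sup>2 * square_data))
      * (8 * zabs\<^sup>2 * energy t + (21168 * zabs\<^sup>2 * square_data + cutoff_energy + 3/2 * zabs * mass_const a0 + 1))"
proof -
  have zD: "0 \<le> D + 3 * zabs * D" using D zabs_nonneg by simp
  have 1: "(LINT x|lborel. \<bar>pooled {i} t x\<bar>) \<le> mass_const a0"
    using l1_le_total[OF t, of i] a0_le[of i] by simp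
  have 2: "(LINT x|lborel. (pooled {i} t x)\<^sup>2) \<le> 2 * square_data"
  proof -
    have "(LINT x|lborel. (pooled {i} t x)\<^sup>2) \<le> (LINT x|lborel. (pooled cations t x)\<^sup>2 + (pooled (- cations) t x)\<^sup>2)"
    proof (rule integral_mono)
      show "integrable lborel (\<lambda>x. (pooled {i} t x)\<^sup>2)" by (rule pooled_integrable(2)[OF t])
      show "integrable lborel (\<lambda>x. (pooled cations t x)\<^sup>2 + (pooled (- cations) t x)\<^sup>2)"
        by (intro Bochner_Integration.integrable_add pooled_integrable t)
      fix x
      have "(c i t x)\<^sup>2 \<le> (pooled I t x)\<^sup>2" if "i \<in> I" for I
        unfolding pooled_def using that nonneg[OF t] by (intro power_mono member_le_sum) auto
      hence "(c i t x)\<^sup>2 \<le> (pooled cations t x)\<^sup>2 \<or> (c i t x)\<^sup>2 \<le> (pooled (- cations) t x)\<^sup>2"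
        by (cases "i \<in> cations") auto
      thus "(pooled {i} t x)\<^sup>2 \<le> (pooled cations t x)\<^sup>2 + (pooled (- cations) t x)\<^sup>2"
        using zero_le_power2[of "pooled cations t x"] zero_le_power2[of "pooled (- cations) t x"]
        unfolding pooled_singleton by linarith
    qed
    also have "\<dots> = pooled_square t" unfolding pooled_square_def by (intro Bochner_Integration.integral_add pooled_integrable t)
    also have "\<dots> \<le> 2 * square_data" by (rule pooled_square_le[OF t])
    finally show ?thesis .
  qed
  have 3: "(LINT x|lborel. (\<rho> t x)\<^sup>2) \<le> 4 * zabs\<^sup>2 * square_data"
  proof -
    have "2 * zabs\<^sup>2 * pooled_square t \<le> 2 * zabs\<^sup>2 * (2 * square_data)" by (intro mult_left_mono pooled_square_le t) simp
    thus ?thesis using \<rho>_bounds(5)[OF t] by linarith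
  qed
  have 4: "field_size t \<le> 8 * zabs\<^sup>2 * energy t + (21168 * zabs\<^sup>2 * square_data + cutoff_energy + 3/2 * zabs * mass_const a0 + 1)"
  proof -
    have "10584 * zabs\<^sup>2 * pooled_square t \<le> 10584 * zabs\<^sup>2 * (2 * square_data)" by (intro mult_left_mono pooled_square_le t) simp
    moreover have "3/2 * zabs * (\<Sum>i\<in>UNIV. LINT x|lborel. \<bar>c i t x\<bar>) \<le> 3/2 * zabs * mass_const a0"
      unfolding mass_const_def using zabs_nonneg l1_le_total[OF t] by (intro mult_left_mono sum_mono) auto
    ultimately show ?thesis using field_size_le[OF t] by linarith
  qed
  have "(LINT x|lborel. \<bar>pooled {i} t x\<bar> * (D + norm (V (z i) t x))) \<le>
      field_size t * ((D + 3 * zabs * D) * (LINT x|lborel. \<bar>pooled {i} t x\<bar>) + 3/2 * ((LINT x|lborel. (pooled {i} t x)\<^sup>2) + (LINT x|lborel. (\<rho> t x)\<^sup>2)))"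
    by (rule flux_bound(2)[OF t valence])
  also have "\<dots> \<le> (8 * zabs\<^sup>2 * energy t + (21168 * zabs\<^sup>2 * square_data + cutoff_energy + 3/2 * zabs * mass_const a0 + 1))
      * ((D + 3 * zabs * D) * mass_const a0 + 3/2 * (2 * square_data + 4 * zabs\<^sup>2 * square_data))"
  proof (rule mult_mono[OF 4])
    show "(D + 3 * zabs * D) * (LINT x|lborel. \<bar>pooled {i} t x\<bar>) + 3/2 * ((LINT x|lborel. (pooled {i} t x)\<^sup>2) + (LINT x|lborel. (\<rho> t x)\<^sup>2))
      \<le> (D + 3 * zabs * D) * mass_const a0 + 3/2 * (2 * square_data + 4 * zabs\<^sup>2 * square_data)"
      by (intro add_mono mult_left_mono 1 2 3 zD) simp
    show "0 \<le> 8 * zabs\<^sup>2 * energy t + (21168 * zabs\<^sup>2 * square_data + cutoff_energy + 3/2 * zabs * mass_const a0 + 1)"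
      using 4 field_size_ge_1[of t] by linarith
    show "0 \<le> (D + 3 * zabs * D) * (LINT x|lborel. \<bar>pooled {i} t x\<bar>) + 3/2 * ((LINT x|lborel. (pooled {i} t x)\<^sup>2) + (LINT x|lborel. (\<rho> t x)\<^sup>2))"
      using D zabs_nonneg by (intro add_nonneg_nonneg mult_nonneg_nonneg Bochner_Integration.integral_nonneg) auto
  qed
  finally show ?thesis by (simp only: mult.commute)
qed

text \<open>Young's inequality applied to the product of \<open>c0 bracket\<^sup>3\<close> and \<open>bracket\<^sup>-\<^sup>2\<close>; this is where the
  weight \<open>\<bar>x\<bar>\<^sup>3\<close> in the assumption on the data is used.\<close>

lemma initial_moment:
  shows "integrable lborel (\<lambda>x. \<bar>c0 i x\<bar> * bracket x)"
    "(LINT x|lborel. \<bar>c0 i x\<bar> * bracket x) \<le> 2 * ((b0 i)\<^sup>2 + (m0 i)\<^sup>2) + 1/2 * (LINT x|lborel. reference x)"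
proof -
  have m[measurable]: "c0 i \<in> borel_measurable borel" using borel_measurable_integrable[OF initial(3)[of i]] by simp
  have [measurable]: "bracket \<in> borel_measurable borel" using bracket_continuous by (rule borel_measurable_continuous_onI)
  have s: "integrable lborel (\<lambda>x. (c0 i x)\<^sup>2)" using sobolev_square_integrable[OF initial(2)[of i]] by (simp add: square_integrable_def)
  note h = initial(4)[of i]
  let ?g = "\<lambda>x. 2 * ((c0 i x)\<^sup>2 + norm x ^ 6 * (c0 i x)\<^sup>2) + 1/2 * reference x"
  have ig: "integrable lborel ?g" by (intro Bochner_Integration.integrable_add integrable_mult_right s h integrable_reference)
  have le: "\<bar>c0 i x\<bar> * bracket x \<le> ?g x" for x
  proof -
    let ?q = "bracket x" and ?a = "\<bar>c0 i x\<bar>" and ?s = "x \<bullet> x"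
    have q: "0 < ?q" using bracket_ge_1[of x] by linarith
    have q2: "?q\<^sup>2 = 1 + ?s" unfolding bracket_def by (rule real_sqrt_pow2) simp
    have "0 \<le> (?a * ?q ^ 3 - 1 / ?q\<^sup>2)\<^sup>2" by simp
    also have "\<dots> = ?a\<^sup>2 * (?q\<^sup>2) ^ 3 + 1 / ?q ^ 4 - 2 * (?a * ?q)"
    proof -
      have "(p * r ^ 3 - 1 / r\<^sup>2)\<^sup>2 = p\<^sup>2 * (r\<^sup>2) ^ 3 + 1 / r ^ 4 - 2 * (p * r)" if "0 < r" for p r :: real
        using that by (simp add: power2_diff power_mult_distrib power_divide flip: power_mult) (simp add: field_simps eval_nat_numeral)
      from this[OF q] show ?thesis .
    qed
    finally have 1: "2 * (?a * ?q) \<le> (c0 i x)\<^sup>2 * (1 + ?s) ^ 3 + reference x"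
      unfolding q2 reference_bracket by simp
    have "(1 + ?s) ^ 3 \<le> 4 * (1 + ?s ^ 3)"
    proof -
      have "0 \<le> 3 * ((1 + r) * (1 - r)\<^sup>2)" if "0 \<le> r" for r :: real using that by simp
      hence "(1 + r) ^ 3 \<le> 4 * (1 + r ^ 3)" if "0 \<le> r" for r :: real
        using that by (fastforce simp: power2_eq_square power3_eq_cube algebra_simps)
      thus ?thesis by simp
    qed
    hence "(c0 i x)\<^sup>2 * (1 + ?s) ^ 3 \<le> (c0 i x)\<^sup>2 * (4 * (1 + ?s ^ 3))" by (intro mult_left_mono) auto
    moreover have "?s ^ 3 = norm x ^ 6" by (simp add: power2_norm_eq_inner[symmetric] flip: power_mult)
    ultimately have "2 * (?a * ?q) \<le> (c0 i x)\<^sup>2 * (4 * (1 + norm x ^ 6)) + reference x" using 1 by simp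
    thus ?thesis by (simp add: algebra_simps)
  qed
  show I: "integrable lborel (\<lambda>x. \<bar>c0 i x\<bar> * bracket x)"
  proof (rule Bochner_Integration.integrable_bound[OF ig])
    show "AE x in lborel. norm (\<bar>c0 i x\<bar> * bracket x) \<le> norm (?g x)"
    proof (rule AE_I2)
      fix x
      have "norm (\<bar>c0 i x\<bar> * bracket x) = \<bar>c0 i x\<bar> * bracket x" using bracket_ge_1[of x] by (simp add: abs_mult)
      also have "\<dots> \<le> norm (?g x)" unfolding real_norm_def by (rule order_trans[OF le abs_ge_self])
      finally show "norm (\<bar>c0 i x\<bar> * bracket x) \<le> norm (?g x)" .
    qed
  qed simp
  have "(LINT x|lborel. \<bar>c0 i x\<bar> * bracket x) \<le> (LINT x|lborel. ?g x)" by (rule integral_mono[OF I ig le])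
  also have "\<dots> = 2 * ((LINT x|lborel. (c0 i x)\<^sup>2) + (LINT x|lborel. norm x ^ 6 * (c0 i x)\<^sup>2)) + 1/2 * (LINT x|lborel. reference x)"
    using s h integrable_reference by simp
  also have "\<dots> \<le> 2 * ((b0 i)\<^sup>2 + (m0 i)\<^sup>2) + 1/2 * (LINT x|lborel. reference x)"
  proof -
    have "(LINT x|lborel. (c0 i x)\<^sup>2) \<le> (b0 i)\<^sup>2"
      unfolding weak_energy_Nil[OF initial(2), symmetric] by (rule weak_energy_le_sobolev_norm) simp
    moreover have "(LINT x|lborel. norm x ^ 6 * (c0 i x)\<^sup>2) = (m0 i)\<^sup>2"
      unfolding l2_norm_def by (simp add: power_mult_distrib flip: power_mult)
    ultimately show ?thesis by simp
  qed
  finally show "(LINT x|lborel. \<bar>c0 i x\<bar> * bracket x) \<le> 2 * ((b0 i)\<^sup>2 + (m0 i)\<^sup>2) + 1/2 * (LINT x|lborel. reference x)" .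
qed

text \<open>The truncated moment changes at most by 100 times the flux, the flux is at most affine in the
  energy, and the energy is integrable in time. The bound starts from small positive times, where the
  truncated moment is compared with that of the initial data in \<open>L\<^sup>1\<close>; the radius tends to infinity last.\<close>

theorem first_moment:
  assumes t: "1 \<le> t"
  shows "integrable lborel (\<lambda>x. c i t x * bracket x)"
    "(LINT x|lborel. c i t x * bracket x) \<le> moment_const D zabs a0 b0 m0 i * (1 + t)"
proof -
  have t0: "0 < t" using t by simp
  define K1 where "K1 = (D + 3 * zabs * D) * mass_const a0 + 3/2 * (2 * square_data + 4 * zabs\<^sup>2 * square_data)"
  define K2 where "K2 = 21168 * zabs\<^sup>2 * square_data + cutoff_energy + 3/2 * zabs * mass_const a0 + 1"
  define K0 where "K0 = 2 * ((b0 i)\<^sup>2 + (m0 i)\<^sup>2) + 1/2 * (LINT x|lborel. reference x)"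
  have mc: "moment_const D zabs a0 b0 m0 i = K0 + 100 * K1 * (K2 + 8 * zabs\<^sup>2 * (square_data / D))"
    unfolding moment_const_def K0_def K1_def K2_def square_const_eq by simp
  have ce: "0 \<le> cutoff_energy" by (simp add: cutoff_energy_def sum_nonneg)
  have M0: "0 \<le> mass_const a0" unfolding mass_const_def by (intro sum_nonneg a0_nonneg)
  have K1: "0 \<le> K1" unfolding K1_def using D zabs_nonneg square_data_nonneg M0 by simp
  have K2: "0 \<le> K2" unfolding K2_def using zabs_nonneg square_data_nonneg M0 ce by simp
  have K0: "0 \<le> K0" unfolding K0_def using reference_pos by (intro add_nonneg_nonneg mult_nonneg_nonneg Bochner_Integration.integral_nonneg) (auto simp: less_imp_le)
  have dD: "0 \<le> 8 * zabs\<^sup>2 * (square_data / D)" using square_data_nonneg D by simp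
  have bound: "(LINT x|lborel. (c i t x * bracket x) * chi R x) \<le> moment_const D zabs a0 b0 m0 i * (1 + t)" if R: "1 \<le> R" for R
  proof -
    have R0: "0 < R" using R by simp
    define F where "F \<tau> = (LINT x|lborel. c i \<tau> x * moment_weight R (x \<bullet> x))" for \<tau>
    have w: "moment_weight R (x \<bullet> x) = bracket x * chi R x" for x by (simp add: moment_weight_def bracket_def chi_def)
    have w0: "0 \<le> bracket x * chi R x" for x using bracket_ge_1[of x] chi_range(1)[OF R0, of x] by simp
    have w1: "bracket x * chi R x \<le> 1 + R" for x
    proof (cases "norm x \<le> R")
      case True
      have "bracket x * chi R x \<le> (1 + R) * 1"
        using bracket_le[OF True] bracket_ge_1[of x] chi_range[OF R0, of x] by (intro mult_mono) auto
      thus ?thesis by simp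
    next
      case False thus ?thesis using chi_support[OF R0, of x] R0 by simp
    qed
    have icw: "integrable lborel (\<lambda>x. c i \<tau> x * (bracket x * chi R x))" if "0 < \<tau>" for \<tau>
    proof -
      have "integrable lborel (\<lambda>x. (c i \<tau> x * bracket x) * chi R x)"
        by (intro integrable_mult_chi R continuous_intros c_continuous bracket_continuous that)
      thus ?thesis by (simp only: mult.assoc)
    qed
    have ex: "\<exists>F'. (F has_real_derivative F') (at \<tau>) \<and> F' \<le> 100 * (K1 * (8 * zabs\<^sup>2 * energy \<tau> + K2))" if \<tau>0: "0 < \<tau>" for \<tau>
    proof -
      obtain T where T: "((\<lambda>\<tau>. LINT x|lborel. pooled {i} \<tau> x * moment_weight R (x \<bullet> x)) has_real_derivative
        T - (LINT x|lborel. dissipation_term (\<lambda>_. 0) {i} (moment_weight R) \<tau> x) + (LINT x|lborel. compression_term (\<lambda>s. s) (\<lambda>_. 1) (z i) {i} (moment_weight R) \<tau> x)) (at \<tau>)"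
        "\<And>F. (LINT x|lborel. \<bar>pooled {i} \<tau> x\<bar> * (D + norm (V (z i) \<tau> x))) \<le> F \<Longrightarrow> \<bar>T\<bar> \<le> 1 * 100 * F"
        by (rule evolution[of "{i}" "z i", OF _ valence radial_weight_moment[OF R] DERIV_ident DERIV_const continuous_on_const _ _ \<tau>0, of 1]) auto
      have "\<bar>T\<bar> \<le> 1 * 100 * (K1 * (8 * zabs\<^sup>2 * energy \<tau> + K2))"
        unfolding K1_def K2_def by (rule T(2)[OF flux_le[OF \<tau>0]])
      hence "T \<le> 100 * (K1 * (8 * zabs\<^sup>2 * energy \<tau> + K2))" by linarith
      with T(1) show ?thesis by (auto simp: dissipation_term_def compression_term_def F_def[abs_def])
    qed
    \<comment> \<open>For small \<open>s\<close> the estimate holds from \<open>s\<close> on, up to the \<open>L\<^sup>1\<close> distance to the initial data times the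
      supremum \<open>1 + R\<close> of the weight.\<close>
    have le: "F t \<le> K0 + (1 + R) * l1_norm (\<lambda>x. c i s x - c0 i x) + 100 * K1 * (8 * zabs\<^sup>2 * (square_data / D) + K2 * t)"
      if s: "0 < s" "s < t" and m: "pooled_square s \<le> square_data" for s
    proof -
      note en = energy_integrable[OF s m]
      have 2: "((\<lambda>\<tau>. 100 * (K1 * (8 * zabs\<^sup>2 * energy \<tau> + K2))) has_integral
          100 * (K1 * (8 * zabs\<^sup>2 * integral {s..t} energy + K2 * (t - s)))) {s..t}"
        using has_integral_mult_right[OF has_integral_mult_right[OF has_integral_add[OF has_integral_mult_right[OF integrable_integral[OF en(1)], of "8 * zabs\<^sup>2"]
           has_integral_const_real[of K2 s t]], of K1], of 100] s by (simp add: mult.commute[of K2])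
      have "F t \<le> F s + 100 * (K1 * (8 * zabs\<^sup>2 * integral {s..t} energy + K2 * (t - s)))"
        by (rule growth_le_integral[OF ex 2]) (use s in auto)
      also have "\<dots> \<le> F s + 100 * (K1 * (8 * zabs\<^sup>2 * (square_data / D) + K2 * t))"
        using en(2) K1 K2 s by (intro add_left_mono mult_left_mono add_mono) auto
      finally have A: "F t \<le> F s + 100 * K1 * (8 * zabs\<^sup>2 * (square_data / D) + K2 * t)" by (simp only: mult.assoc)
      have s0: "0 \<le> s" using s by simp
      have i1: "integrable lborel (\<lambda>x. \<bar>c0 i x\<bar> * bracket x)" "integrable lborel (\<lambda>x. \<bar>c i s x - c0 i x\<bar>)"
        using initial_moment(1)[of i] sobolev_c(1)[OF s0, of i] initial(3)[of i] by auto
      have "F s \<le> (LINT x|lborel. \<bar>c0 i x\<bar> * bracket x + (1 + R) * \<bar>c i s x - c0 i x\<bar>)"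
        unfolding F_def w
      proof (rule integral_mono[OF icw[OF s(1)]])
        show "integrable lborel (\<lambda>x. \<bar>c0 i x\<bar> * bracket x + (1 + R) * \<bar>c i s x - c0 i x\<bar>)" using i1 by simp
        fix x
        have "c i s x * (bracket x * chi R x) \<le> (\<bar>c0 i x\<bar> + \<bar>c i s x - c0 i x\<bar>) * (bracket x * chi R x)"
          by (intro mult_right_mono w0) linarith
        also have "\<dots> = \<bar>c0 i x\<bar> * (bracket x * chi R x) + \<bar>c i s x - c0 i x\<bar> * (bracket x * chi R x)" by (rule distrib_right)
        also have "\<dots> \<le> \<bar>c0 i x\<bar> * bracket x + \<bar>c i s x - c0 i x\<bar> * (1 + R)"
          using chi_range(2)[OF R0, of x] bracket_ge_1[of x] by (intro add_mono mult_left_mono w1) auto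
        finally show "c i s x * (bracket x * chi R x) \<le> \<bar>c0 i x\<bar> * bracket x + (1 + R) * \<bar>c i s x - c0 i x\<bar>" by (simp only: mult.commute)
      qed
      also have "\<dots> = (LINT x|lborel. \<bar>c0 i x\<bar> * bracket x) + (1 + R) * l1_norm (\<lambda>x. c i s x - c0 i x)"
        using i1 by (simp add: l1_norm_def)
      also have "\<dots> \<le> K0 + (1 + R) * l1_norm (\<lambda>x. c i s x - c0 i x)"
        unfolding K0_def by (intro add_right_mono initial_moment)
      finally show ?thesis using A by linarith
    qed
    have "F t \<le> K0 + (1 + R) * 0 + 100 * K1 * (8 * zabs\<^sup>2 * (square_data / D) + K2 * t)"
    proof (rule tendsto_lowerbound)
      show "((\<lambda>s. K0 + (1 + R) * l1_norm (\<lambda>x. c i s x - c0 i x) + 100 * K1 * (8 * zabs\<^sup>2 * (square_data / D) + K2 * t))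
        \<longlongrightarrow> K0 + (1 + R) * 0 + 100 * K1 * (8 * zabs\<^sup>2 * (square_data / D) + K2 * t)) (at_right 0)"
        by (intro tendsto_add tendsto_mult tendsto_const initial_limit)
      show "\<forall>\<^sub>F s in at_right 0. F t \<le> K0 + (1 + R) * l1_norm (\<lambda>x. c i s x - c0 i x) + 100 * K1 * (8 * zabs\<^sup>2 * (square_data / D) + K2 * t)"
        using pooled_square_initial eventually_at_right_real[OF t0]
      proof eventually_elim
        case (elim s) thus ?case using le[of s] by auto
      qed
    qed simp
    also have "\<dots> \<le> moment_const D zabs a0 b0 m0 i * (1 + t)"
    proof -
      have "8 * zabs\<^sup>2 * (square_data / D) * 1 \<le> 8 * zabs\<^sup>2 * (square_data / D) * (1 + t)" "K2 * t \<le> K2 * (1 + t)" "K0 * 1 \<le> K0 * (1 + t)"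
        using t K2 K0 dD by (intro mult_left_mono; simp)+
      hence k: "8 * zabs\<^sup>2 * (square_data / D) + K2 * t \<le> (K2 + 8 * zabs\<^sup>2 * (square_data / D)) * (1 + t)" "K0 \<le> K0 * (1 + t)"
        by (simp_all add: distrib_right)
      have "100 * K1 * (8 * zabs\<^sup>2 * (square_data / D) + K2 * t) \<le> 100 * K1 * ((K2 + 8 * zabs\<^sup>2 * (square_data / D)) * (1 + t))"
        using K1 k(1) by (intro mult_left_mono) auto
      thus ?thesis unfolding mc distrib_right[of K0] using k(2) by (simp only: mult.assoc)
    qed
    finally show ?thesis by (simp add: F_def w mult.assoc)
  qed
  have m: "(\<lambda>x. c i t x * bracket x) \<in> borel_measurable borel"
    by (intro borel_measurable_continuous_onI continuous_intros c_continuous bracket_continuous t0)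
  have n: "0 \<le> c i t x * bracket x" for x using nonneg[OF t0, of i x] bracket_ge_1[of x] by simp
  have ic: "integrable lborel (\<lambda>x. (c i t x * bracket x) * chi R x)" if "1 \<le> R" for R
    by (intro integrable_mult_chi continuous_intros c_continuous bracket_continuous t0 that)
  show "integrable lborel (\<lambda>x. c i t x * bracket x)" by (rule integrable_chi_limit(1)[OF n m ic bound])
  show "(LINT x|lborel. c i t x * bracket x) \<le> moment_const D zabs a0 b0 m0 i * (1 + t)"
    by (rule integrable_chi_limit(2)[OF n m ic bound])
qed

text \<open>The inequality between entropy and first moment is used with radius \<open>R = 1 + t\<close>, which makes the
  contribution of the moment bounded and that of \<open>ln R\<close> logarithmic.\<close>

theorem entropy_bound:
  assumes t: "1 \<le> t"
  shows "integrable lborel (\<lambda>x. c i t x * ln (c i t x))"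
    "- (LINT x|lborel. c i t x * ln (c i t x)) \<le>
       (LINT x|lborel. reference x) + 4 * (ln (1 + t) * a0 i + moment_const D zabs a0 b0 m0 i)"
proof -
  have t0: "0 < t" "0 \<le> t" and R: "1 \<le> 1 + t" using t by auto
  let ?g = "\<lambda>x. reference x + 4 * (ln (1 + t) * c i t x + c i t x * bracket x / (1 + t))"
  note fm = first_moment[OF t, of i]
  have i2: "integrable lborel (\<lambda>x. c i t x * bracket x / (1 + t))" using fm(1) by simp
  have ig: "integrable lborel ?g"
    by (intro Bochner_Integration.integrable_add integrable_mult_right integrable_reference sobolev_c t0 i2)
  have m[measurable]: "c i t \<in> borel_measurable borel" by (rule measurable_c[OF t0(2)])
  show I: "integrable lborel (\<lambda>x. c i t x * ln (c i t x))"
  proof (rule Bochner_Integration.integrable_bound)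
    show "integrable lborel (\<lambda>x. (c i t x)\<^sup>2 + ?g x)" by (intro Bochner_Integration.integrable_add[OF c_square(1)[OF t0(2)] ig])
    show "AE x in lborel. norm (c i t x * ln (c i t x)) \<le> norm ((c i t x)\<^sup>2 + ?g x)"
      unfolding real_norm_def by (intro AE_I2 order_trans[OF entropy_integrand_le(2)[OF nonneg[OF t0(1)] R] abs_ge_self])
  qed simp
  have "- (LINT x|lborel. c i t x * ln (c i t x)) = (LINT x|lborel. - (c i t x * ln (c i t x)))" by simp
  also have "\<dots> \<le> (LINT x|lborel. ?g x)"
    by (intro integral_mono ig entropy_integrand_le(1) nonneg t0 R) (use I in simp)
  also have "\<dots> = (LINT x|lborel. reference x) + 4 * (ln (1 + t) * (LINT x|lborel. c i t x) + (LINT x|lborel. c i t x * bracket x) / (1 + t))"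
    using integrable_reference sobolev_c(1)[OF t0(2), of i] fm(1) i2 by simp
  also have "\<dots> \<le> (LINT x|lborel. reference x) + 4 * (ln (1 + t) * a0 i + moment_const D zabs a0 b0 m0 i)"
    using mass_le[OF t0(1), of i] fm(2) t by (intro add_mono mult_left_mono) (auto simp: field_simps)
  finally show "- (LINT x|lborel. c i t x * ln (c i t x)) \<le>
       (LINT x|lborel. reference x) + 4 * (ln (1 + t) * a0 i + moment_const D zabs a0 b0 m0 i)" .
qed

end

section \<open>Logarithmic growth of the entropy\<close>

definition entropy_const :: "real \<Rightarrow> real \<Rightarrow> ('n::finite \<Rightarrow> real) \<Rightarrow> ('n \<Rightarrow> real) \<Rightarrow> ('n \<Rightarrow> real) \<Rightarrow> real" where
  "entropy_const D zabs a b m =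
     1 + 2 * \<bar>\<Sum>i\<in>UNIV. (LINT x|lborel. reference x) + 4 * (a i + \<bar>moment_const D zabs a b m i\<bar>)\<bar>"

text \<open>The number \<open>1 + t\<close> is at most the square of \<open>1 + t powr (15 / 16)\<close>, as twice \<open>15 / 16\<close> is
  at least 1.\<close>

lemma log_growth:
  fixes t :: real
  assumes t: "1 \<le> t"
  shows "1 + ln (1 + t) \<le> 2 * ln (exp 1 + exp 1 * t powr (15 / 16))"
proof -
  let ?p = "t powr (15 / 16)"
  have p: "1 \<le> ?p" using t by (intro ge_one_powr_ge_zero) auto
  have "t = t powr 1" using t by simp
  also have "\<dots> \<le> t powr (15 / 16 + 15 / 16)" using t by (intro powr_mono) auto
  also have "\<dots> = ?p * ?p" by (rule powr_add)
  finally have "t \<le> ?p * ?p" .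
  moreover have "(1 + r)\<^sup>2 = 1 + 2 * r + r * r" for r :: real by (simp add: power2_eq_square algebra_simps)
  ultimately have "1 + t \<le> (1 + ?p)\<^sup>2" using p by simp
  hence "ln (1 + t) \<le> ln ((1 + ?p)\<^sup>2)" using t p by (subst ln_le_cancel_iff) auto
  also have "\<dots> = 2 * ln (1 + ?p)" using p by (simp add: ln_realpow)
  finally have "1 + ln (1 + t) \<le> 2 * (1 + ln (1 + ?p))" by simp
  also have "1 + ln (1 + ?p) = ln (exp 1 * (1 + ?p))" using p by (simp add: ln_mult)
  finally show ?thesis by (simp add: distrib_left)
qed

theorem proposition7:
  fixes D :: real and z :: "'n::finite \<Rightarrow> real" and zabs :: real
  assumes "0 < D"
    and "\<And>i. \<bar>z i\<bar> = zabs"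
  shows "\<exists>(T :: ('n \<Rightarrow> real) \<Rightarrow> ('n \<Rightarrow> real) \<Rightarrow> real)
      (\<Gamma>4 :: ('n \<Rightarrow> real) \<Rightarrow> ('n \<Rightarrow> real) \<Rightarrow> ('n \<Rightarrow> real) \<Rightarrow> real)
      (\<Gamma>5 :: ('n \<Rightarrow> real) \<Rightarrow> ('n \<Rightarrow> real) \<Rightarrow> ('n \<Rightarrow> real) \<Rightarrow> real)
      (\<Gamma>6 :: ('n \<Rightarrow> real) \<Rightarrow> ('n \<Rightarrow> real) \<Rightarrow> ('n \<Rightarrow> real) \<Rightarrow> real).
    (\<forall>a b. 0 < T a b) \<and>
    (\<forall>a b m. 0 < \<Gamma>4 a b m \<and> 0 < \<Gamma>5 a b m \<and> 0 < \<Gamma>6 a b m) \<and>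
    (\<forall>c0 c u p \<phi>. admissible_data z c0 \<and> npd_solution D z c0 c u p \<phi> \<longrightarrow>
      (let a = (\<lambda>i. l1_norm (c0 i));
           b = (\<lambda>i. sobolev_norm 2 (c0 i));
           m = (\<lambda>i. l2_norm (\<lambda>x. norm x ^ 3 * c0 i x))
       in \<forall>t \<ge> T a b.
            (\<forall>i. integrable lborel (\<lambda>x. c i t x * ln (c i t x))) \<and>
            - entropy (\<lambda>i. c i t) \<le> \<Gamma>4 a b m * ln (\<Gamma>5 a b m + \<Gamma>6 a b m * t powr (15 / 16))))"
proof (rule exI[of _ "\<lambda>_ _. 1"], rule exI[of _ "entropy_const D zabs"], rule exI[of _ "\<lambda>_ _ _. exp 1"],
    rule exI[of _ "\<lambda>_ _ _. exp 1"], intro conjI allI impI)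
  show "0 < entropy_const D zabs a b m" for a b m :: "'n \<Rightarrow> real"
    by (simp add: entropy_const_def)
  fix c0 :: "'n \<Rightarrow> space \<Rightarrow> real" and c u p \<phi>
  assume "admissible_data z c0 \<and> npd_solution D z c0 c u p \<phi>"
  then interpret npd D zabs z c0 c u p \<phi> using assms by unfold_locales auto
  let ?G = "entropy_const D zabs a0 b0 m0"
  have "(\<forall>i. integrable lborel (\<lambda>x. c i t x * ln (c i t x))) \<and>
      - entropy (\<lambda>i. c i t) \<le> ?G * ln (exp 1 + exp 1 * t powr (15 / 16))" if t: "1 \<le> t" for t
  proof (intro conjI allI)
    show "integrable lborel (\<lambda>x. c i t x * ln (c i t x))" for i by (rule entropy_bound(1)[OF t])
    define I where "I = (LINT x|lborel. reference x)"
    have I: "0 \<le> I" unfolding I_def using reference_pos by (intro Bochner_Integration.integral_nonneg) (auto simp: less_imp_le)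
    let ?s = "\<Sum>i\<in>UNIV. I + 4 * (a0 i + \<bar>moment_const D zabs a0 b0 m0 i\<bar>)"
    have l: "0 \<le> ln (1 + t)" using t by simp
    have "- entropy (\<lambda>i. c i t) = (\<Sum>i\<in>UNIV. - (LINT x|lborel. c i t x * ln (c i t x)))"
      by (simp add: entropy_def sum_negf)
    also have "\<dots> \<le> (\<Sum>i\<in>UNIV. (I + 4 * (a0 i + \<bar>moment_const D zabs a0 b0 m0 i\<bar>)) * (1 + ln (1 + t)))"
    proof (rule sum_mono)
      fix i
      let ?k = "moment_const D zabs a0 b0 m0 i"
      define X where "X = (I + 4 * (a0 i + \<bar>?k\<bar>)) * (1 + ln (1 + t))"
      have "X - (I + 4 * (ln (1 + t) * a0 i + \<bar>?k\<bar>))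
          = I * ln (1 + t) + 4 * a0 i + 4 * \<bar>?k\<bar> * ln (1 + t)" by (simp add: X_def algebra_simps)
      moreover have "0 \<le> I * ln (1 + t)" "0 \<le> 4 * a0 i" "0 \<le> 4 * \<bar>?k\<bar> * ln (1 + t)"
        using I l a0_nonneg[of i] by (auto intro!: mult_nonneg_nonneg)
      moreover have "?k \<le> \<bar>?k\<bar>" by (rule abs_ge_self)
      ultimately show "- (LINT x|lborel. c i t x * ln (c i t x)) \<le> (I + 4 * (a0 i + \<bar>?k\<bar>)) * (1 + ln (1 + t))"
        using entropy_bound(2)[OF t, of i, folded I_def] unfolding X_def[symmetric] by argo
    qed
    also have "\<dots> = ?s * (1 + ln (1 + t))" by (simp only: sum_distrib_right)
    also have "\<dots> \<le> \<bar>?s\<bar> * (2 * ln (exp 1 + exp 1 * t powr (15 / 16)))"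
      using l by (intro mult_mono log_growth t abs_ge_self) auto
    also have "\<dots> \<le> ?G * ln (exp 1 + exp 1 * t powr (15 / 16))"
    proof -
      have "0 \<le> ln (exp 1 + exp 1 * t powr (15 / 16))" using log_growth[OF t] l by linarith
      moreover have "?G = 1 + 2 * \<bar>?s\<bar>" by (simp only: entropy_const_def I_def)
      ultimately show ?thesis by (simp add: distrib_right)
    qed
    finally show "- entropy (\<lambda>i. c i t) \<le> ?G * ln (exp 1 + exp 1 * t powr (15 / 16))" .
  qed
  thus "let a = (\<lambda>i. l1_norm (c0 i));
           b = (\<lambda>i. sobolev_norm 2 (c0 i));
           m = (\<lambda>i. l2_norm (\<lambda>x. norm x ^ 3 * c0 i x))
       in \<forall>t \<ge> 1.
            (\<forall>i. integrable lborel (\<lambda>x. c i t x * ln (c i t x))) \<and>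
            - entropy (\<lambda>i. c i t) \<le> entropy_const D zabs a b m * ln (exp 1 + exp 1 * t powr (15 / 16))"
    unfolding Let_def by blast
qed simp_all

end
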